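(* Let $(\Theta_n)_{n\in\mathbb{N}}$ be a sequence of inner functions on the unit disc $\mathbb{D}$, and for each $n$ let $H_{\Theta_n}=\mathrm{H}^2\ominus\Theta_n\mathrm{H}^2$ be the associated model space. If the sequence $(H_{\Theta_n})_{n\in\mathbb{N}}$ is weakly separated and is a Bessel system, then it is a Riesz system.
   Context: $\mathrm{H}^2$ is the Hardy space on the unit disc $\mathbb{D}$ (power series centered at $0$ with square-summable Taylor coefficients, with the $\ell^2$ inner product of the coefficients). An inner function is a bounded analytic function on $\mathbb{D}$ whose radial limits on the unit circle are unimodular almost everywhere. For an inner function $\Theta$, the model space is the orthogonal complement $H_\Theta:=\mathrm{H}^2\ominus\Theta\mathrm{H}^2$ of $\Theta\mathrm{H}^2=\{\Theta f: f\in\mathrm{H}^2\}$ in $\mathrm{H}^2$. For closed subspaces $K_1,K_2$ of a Hilbert space, $\sin(K_1,K_2)$ is the infimum of the sines of the angles between a nonzero vector of $K_1$ and a nonzero vector of $K_2$; equivalently $\sin(K_1,K_2)=\|T\|^{-1}$, where $T$ is the linear map on $\mathrm{span}\{K_1,K_2\}$ with $T|_{K_1}=\mathrm{Id}$, $T|_{K_2}=0$ (and $\sin(K_1,K_2)=0$ if $T$ is not well defined or is unbounded); equivalently $\sin(K_1,K_2)=\inf\{\mathrm{dist}(x,K_2): x\in K_1,\ \|x\|=1\}$. A sequence $(H_n)_{n\in\mathbb{N}}$ of closed subspaces of a Hilbert space is: - weakly separated if $\inf_{n\neq j}\sin(H_n,H_j)>0$; - a Bessel system if there is a finite constant $C\ge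 1$ such that, for every choice of unit vectors $h_n\in H_n$ ($n\in\mathbb{N}$) and every $(a_n)_{n\in\mathbb{N}}\in\ell^2$, $\left\|\sum_n a_nh_n\right\|^2\le C^2\sum_n|a_n|^2$; - a Riesz system if there is a finite constant $C\geq 1$ such that, for every choice of unit vectors $h_n\in H_n$ and every $(a_n)\in\ell^2$, $\frac{1}{C^2}\sum_n|a_n|^2\le\left\|\sum_n a_nh_n\right\|^2\le C^2\sum_n|a_n|^2$. *)

theory Defs
  imports "HOL-Complex_Analysis.Complex_Analysis" "HOL-Library.Extended_Real"
begin

definition square_summable :: "(nat \<Rightarrow> complex) \<Rightarrow> bool" where
  "square_summable a \<longleftrightarrow> summable (\<lambda>n. (cmod (a n))\<^sup>2)"

text \<open>Elements of the Hardy space are represented by their power series at 0.  The library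
  topology on formal power series (the adic one) plays no role: convergence is always taken in
  the Hardy norm defined below.\<close>

definition hardy2 :: "complex fps set" where
  "hardy2 = {F. square_summable (fps_nth F)}"

definition hardy_inner :: "complex fps \<Rightarrow> complex fps \<Rightarrow> complex" where
  "hardy_inner F G = (\<Sum>n. fps_nth F n * cnj (fps_nth G n))"

definition hardy_norm :: "complex fps \<Rightarrow> real" where
  "hardy_norm F = sqrt (\<Sum>n. (cmod (fps_nth F n))\<^sup>2)"

definition hardy_sums :: "(nat \<Rightarrow> complex fps) \<Rightarrow> complex fps \<Rightarrow> bool" where
  "hardy_sums u S \<longleftrightarrow>
     S \<in> hardy2 \<and> (\<lambda>N. hardy_norm ((\<Sum>n<N. u n) - S)) \<longlonglongrightarrow> 0"

text \<open>Only the values of \<open>\<theta>\<close> on the open unit disc are relevant.\<close>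

definition inner_function :: "(complex \<Rightarrow> complex) \<Rightarrow> bool" where
  "inner_function \<theta> \<longleftrightarrow>
     \<theta> holomorphic_on ball 0 1 \<and> bounded (\<theta> ` ball 0 1) \<and>
     (AE t\<in>{0..2 * pi} in lebesgue.
        \<exists>l. cmod l = 1 \<and> ((\<lambda>r. \<theta> (complex_of_real r * cis t)) \<longlongrightarrow> l) (at_left 1))"

definition model_space :: "(complex \<Rightarrow> complex) \<Rightarrow> complex fps set" where
  "model_space \<theta> =
     {F \<in> hardy2. \<forall>G\<in>hardy2. hardy_inner F (fps_expansion \<theta> 0 * G) = 0}"

text \<open>The sine of the angle between nonzero \<open>F\<close> and \<open>G\<close>, whose cosine is
  \<open>\<bar>\<langle>F, G\<rangle>\<bar> / (\<parallel>F\<parallel> \<parallel>G\<parallel>)\<close>.\<close>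

definition vector_sin :: "complex fps \<Rightarrow> complex fps \<Rightarrow> real" where
  "vector_sin F G =
     sqrt (1 - (cmod (hardy_inner F G) / (hardy_norm F * hardy_norm G))\<^sup>2)"

text \<open>The infimum is taken in the extended reals, so that it is \<open>\<infinity>\<close> when one of the
  subspaces is trivial.\<close>

definition subspace_sin :: "complex fps set \<Rightarrow> complex fps set \<Rightarrow> ereal" where
  "subspace_sin K L = (INF (F, G) \<in> (K - {0}) \<times> (L - {0}). ereal (vector_sin F G))"

definition weakly_separated :: "(nat \<Rightarrow> complex fps set) \<Rightarrow> bool" where
  "weakly_separated K \<longleftrightarrow> (INF (n, j) \<in> {(n, j). n \<noteq> j}. subspace_sin (K n) (K j)) > 0"

definition unit_selection :: "(nat \<Rightarrow> complex fps set) \<Rightarrow> (nat \<Rightarrow> complex fps) \<Rightarrow> bool" where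
  "unit_selection K h \<longleftrightarrow> (\<forall>n. h n \<in> K n \<and> hardy_norm (h n) = 1)"

text \<open>Norm convergence of the series is part of the upper estimate.\<close>

definition bessel_system :: "(nat \<Rightarrow> complex fps set) \<Rightarrow> bool" where
  "bessel_system K \<longleftrightarrow>
     (\<exists>C::real. C \<ge> 1 \<and>
       (\<forall>h a. unit_selection K h \<longrightarrow> square_summable a \<longrightarrow>
         (\<exists>S. hardy_sums (\<lambda>n. fps_const (a n) * h n) S \<and>
              (hardy_norm S)\<^sup>2 \<le> C\<^sup>2 * (\<Sum>n. (cmod (a n))\<^sup>2))))"

definition riesz_system :: "(nat \<Rightarrow> complex fps set) \<Rightarrow> bool" where
  "riesz_system K \<longleftrightarrow>
     (\<exists>C::real. C \<ge> 1 \<and>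
       (\<forall>h a. unit_selection K h \<longrightarrow> square_summable a \<longrightarrow>
         (\<exists>S. hardy_sums (\<lambda>n. fps_const (a n) * h n) S \<and>
              1 / C\<^sup>2 * (\<Sum>n. (cmod (a n))\<^sup>2) \<le> (hardy_norm S)\<^sup>2 \<and>
              (hardy_norm S)\<^sup>2 \<le> C\<^sup>2 * (\<Sum>n. (cmod (a n))\<^sup>2))))"

end

theory Submission
  imports Defs
begin

text \<open>For an inner function \<open>\<Theta>\<close> the model space is the kernel of the co-analytic Toeplitz operator
\<open>T\<^sub>\<Theta>\<^sup>*\<close>, the adjoint of multiplication by \<open>\<Theta>\<close>.  These adjoints commute, which makes it possible to
isolate one summand of \<open>S = \<Sum>n<N. g\<^sub>n\<close> with \<open>g\<^sub>n\<close> in the \<open>n\<close>-th model space: if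
\<open>B\<^sub>n\<close> is the product of all \<open>\<Theta>\<^sub>j\<close> with \<open>j < N\<close> and \<open>j \<noteq> n\<close>, then \<open>T\<^sub>B\<^sub>n\<^sup>*\<close> kills every \<open>g\<^sub>j\<close> with
\<open>j \<noteq> n\<close>, so that \<open>T\<^sub>B\<^sub>n\<^sup>* S = T\<^sub>B\<^sub>n\<^sup>* g\<^sub>n =: y\<^sub>n\<close>.  The lower Riesz estimate
\<open>(\<Sum>n<N. \<parallel>g\<^sub>n\<parallel>\<^sup>2) \<le> L \<parallel>S\<parallel>\<^sup>2\<close>, with \<open>L\<close> independent of \<open>N\<close>, follows from two facts.

The first is \<open>\<parallel>g\<^sub>n\<parallel>\<^sup>2 \<le> K \<parallel>y\<^sub>n\<parallel>\<^sup>2\<close>.  Projecting the Szego kernel of a point \<open>z\<close> to the model spaces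
turns the Bessel inequality into \<open>(\<Sum>n. 1 - \<bar>\<Theta>\<^sub>n z\<bar>\<^sup>2) \<le> C\<^sup>2\<close> (lemma \<open>sum_defect_le\<close>) and weak
separation into \<open>max \<bar>\<Theta>\<^sub>n z\<bar> \<bar>\<Theta>\<^sub>j z\<bar> \<ge> \<eta>\<close> for \<open>n \<noteq> j\<close> (lemma \<open>separation_pointwise\<close>).  At a point
where \<open>\<bar>\<Theta>\<^sub>n z\<bar> < \<eta>\<close> all the other values are at least \<open>\<eta>\<close> and their defects are summable, so their
product stays away from \<open>0\<close>.  Hence \<open>\<bar>\<Theta>\<^sub>n\<bar>\<^sup>2 + \<bar>B\<^sub>n\<bar>\<^sup>2 \<ge> \<epsilon>\<^sup>2\<close> on the disc.  The corona theorem in its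
Hardy space form (lemma \<open>corona_hardy\<close>) says that then
\<open>\<parallel>h\<parallel>\<^sup>2 \<le> K (\<parallel>T\<^sub>\<Theta>\<^sub>n\<^sup>* h\<parallel>\<^sup>2 + \<parallel>T\<^sub>B\<^sub>n\<^sup>* h\<parallel>\<^sup>2)\<close> for all \<open>h\<close>, and the first term vanishes for \<open>h = g\<^sub>n\<close>.

The second is \<open>(\<Sum>n<N. \<parallel>y\<^sub>n\<parallel>\<^sup>2) \<le> C\<^sup>2 \<parallel>S\<parallel>\<^sup>2\<close>.  The left side is \<open>\<langle>S, w\<rangle>\<close> for \<open>w = \<Sum>n<N. B\<^sub>n y\<^sub>n\<close>, so it is
enough to bound \<open>\<parallel>w\<parallel>\<^sup>2\<close> by \<open>C\<^sup>2\<close> times the left side.  On the circle a model space carries the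
isometric conjugation \<open>y \<mapsto> \<Theta> cnj (z y)\<close>.  The conjugation that belongs to the product of all
\<open>\<Theta>\<^sub>j\<close> takes \<open>B\<^sub>n y\<^sub>n\<close> to the conjugate of \<open>y\<^sub>n\<close> in the \<open>n\<close>-th model space, because
\<open>B\<^sub>n cnj B\<^sub>n = 1\<close> there (lemma \<open>conj_op_mult\<close>).  Thus \<open>\<parallel>w\<parallel>\<close> is the norm of a sum of elements of the model
spaces to which the Bessel inequality applies.

The Hardy space corona estimate is proved by Wolff's method.  One writes
\<open>h = \<phi> f + \<psi> g\<close> with the obvious non-holomorphic \<open>f\<close> and \<open>g\<close>, converts the resulting error on the circle
into an area integral by Stokes' theorem (twice, so as to gain the weight \<open>1 - \<bar>z\<bar>\<^sup>2\<close>), and estimates that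
by Littlewood--Paley inequalities.  The Carleson measures
\<open>(1 - \<bar>z\<bar>\<^sup>2) \<bar>\<phi>'\<bar>\<^sup>2 dA\<close> that occur have bounded symbols \<open>\<phi>\<close>, and for these the embedding is immediate from
\<open>\<phi>' f = (\<phi> f)' - \<phi> f'\<close>.  By dilation and truncation it is enough to treat polynomials.\<close>

section \<open>The Hardy space of square-summable power series\<close>

lemma hardy2_iff: "F \<in> hardy2 \<longleftrightarrow> summable (\<lambda>n. (cmod (fps_nth F n))\<^sup>2)"
  by (simp add: hardy2_def square_summable_def)

lemma hardy2_add [intro]:
  assumes "F \<in> hardy2" "G \<in> hardy2" shows "F + G \<in> hardy2"
  unfolding hardy2_iff
proof (rule summable_comparison_test')
  show "summable (\<lambda>n. 2 * (cmod (fps_nth F n))\<^sup>2 + 2 * (cmod (fps_nth G n))\<^sup>2)"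
    using assms unfolding hardy2_iff by (intro summable_add summable_mult)
  fix n
  have "(cmod (fps_nth (F + G) n))\<^sup>2 \<le> (cmod (fps_nth F n) + cmod (fps_nth G n))\<^sup>2"
    by (simp add: norm_triangle_ineq)
  also have "\<dots> \<le> 2 * (cmod (fps_nth F n))\<^sup>2 + 2 * (cmod (fps_nth G n))\<^sup>2"
    using sum_squares_bound[of "cmod (fps_nth F n)" "cmod (fps_nth G n)"]
    by (simp add: power2_sum)
  finally show "norm ((cmod (fps_nth (F + G) n))\<^sup>2)
      \<le> 2 * (cmod (fps_nth F n))\<^sup>2 + 2 * (cmod (fps_nth G n))\<^sup>2" by simp
qed

lemma hardy2_const_mult [intro]: "F \<in> hardy2 \<Longrightarrow> fps_const c * F \<in> hardy2"
  unfolding hardy2_iff by (simp add: norm_mult power_mult_distrib summable_mult)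

lemma hardy2_uminus [intro]: "F \<in> hardy2 \<Longrightarrow> - F \<in> hardy2"
  unfolding hardy2_iff by simp

lemma hardy2_diff [intro]: "F \<in> hardy2 \<Longrightarrow> G \<in> hardy2 \<Longrightarrow> F - G \<in> hardy2"
  using hardy2_add[of F "- G"] hardy2_uminus[of G] by simp

lemma hardy2_finite: "(\<And>n. n \<ge> N \<Longrightarrow> fps_nth F n = 0) \<Longrightarrow> F \<in> hardy2"
  unfolding hardy2_iff by (rule summable_finite[of "{..<N}"]) (auto simp: not_less)

lemma hardy2_0 [simp, intro]: "0 \<in> hardy2"
  by (rule hardy2_finite[of 0]) auto

lemma hardy2_1 [simp, intro]: "1 \<in> hardy2"
  by (rule hardy2_finite[of 1]) auto

lemma hardy2_X_power [simp, intro]: "fps_X ^ k \<in> hardy2"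
  by (rule hardy2_finite[of "Suc k"]) (auto simp: fps_X_power_nth)

lemma hardy2_sum [intro]: "(\<And>i. i \<in> I \<Longrightarrow> F i \<in> hardy2) \<Longrightarrow> (\<Sum>i\<in>I. F i) \<in> hardy2"
  by (induction I rule: infinite_finite_induct) auto

lemma hardy2_cutoff [simp, intro]: "fps_cutoff N F \<in> hardy2"
  by (rule hardy2_finite[of N]) auto

lemma sums_X_power_mult:
  assumes "F \<in> hardy2"
  shows "(\<lambda>n. (cmod (fps_nth (fps_X ^ k * F) n))\<^sup>2) sums (\<Sum>n. (cmod (fps_nth F n))\<^sup>2)"
proof -
  have "(\<lambda>n. (cmod (fps_nth (fps_X ^ k * F) (n + k)))\<^sup>2) sums (\<Sum>n. (cmod (fps_nth F n))\<^sup>2)"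
    using assms by (simp add: hardy2_iff fps_X_power_mult_nth summable_sums)
  then show ?thesis
    by (subst (asm) sums_iff_shift) (simp add: fps_X_power_mult_nth)
qed

lemma hardy2_X_power_mult [intro]: "F \<in> hardy2 \<Longrightarrow> fps_X ^ k * F \<in> hardy2"
  using sums_X_power_mult[of F k] unfolding hardy2_iff by (rule sums_summable)

lemma hardy_norm_X_power_mult [simp]:
  "F \<in> hardy2 \<Longrightarrow> hardy_norm (fps_X ^ k * F) = hardy_norm F"
  using sums_X_power_mult[of F k] by (simp add: hardy_norm_def sums_iff)

lemma hardy_norm_sq: "F \<in> hardy2 \<Longrightarrow> (hardy_norm F)\<^sup>2 = (\<Sum>n. (cmod (fps_nth F n))\<^sup>2)"
  unfolding hardy_norm_def hardy2_iff by (simp add: suminf_nonneg)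

lemma hardy_norm_nonneg [simp]: "F \<in> hardy2 \<Longrightarrow> hardy_norm F \<ge> 0"
  unfolding hardy_norm_def hardy2_iff by (simp add: suminf_nonneg)

lemma hardy_norm_0 [simp]: "hardy_norm 0 = 0"
  by (simp add: hardy_norm_def)

lemma hardy_norm_eq_0_iff: "F \<in> hardy2 \<Longrightarrow> hardy_norm F = 0 \<longleftrightarrow> F = 0"
  unfolding hardy_norm_def hardy2_iff by (auto simp: suminf_eq_zero_iff fps_eq_iff)

lemma hardy_norm_uminus [simp]: "hardy_norm (- F) = hardy_norm F"
  by (simp add: hardy_norm_def)

lemma hardy_norm_minus_commute: "hardy_norm (F - G) = hardy_norm (G - F)"
  using hardy_norm_uminus[of "F - G"] by simp

lemma hardy_norm_const_mult:
  assumes "F \<in> hardy2" shows "hardy_norm (fps_const c * F) = cmod c * hardy_norm F"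
  using assms unfolding hardy_norm_def hardy2_iff
  by (simp add: norm_mult power_mult_distrib suminf_mult real_sqrt_mult)

lemma hardy_inner_summable_norm:
  assumes "F \<in> hardy2" "G \<in> hardy2"
  shows "summable (\<lambda>n. cmod (fps_nth F n) * cmod (fps_nth G n))"
proof (rule summable_comparison_test')
  show "summable (\<lambda>n. (cmod (fps_nth F n))\<^sup>2 + (cmod (fps_nth G n))\<^sup>2)"
    using assms unfolding hardy2_iff by (intro summable_add)
  fix n
  show "norm (cmod (fps_nth F n) * cmod (fps_nth G n))
      \<le> (cmod (fps_nth F n))\<^sup>2 + (cmod (fps_nth G n))\<^sup>2"
    using sum_squares_bound[of "cmod (fps_nth F n)" "cmod (fps_nth G n)"]
      mult_nonneg_nonneg[OF norm_ge_zero[of "fps_nth F n"] norm_ge_zero[of "fps_nth G n"]]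
    by (simp only: real_norm_def abs_of_nonneg)
qed

lemma hardy_inner_summable:
  assumes "F \<in> hardy2" "G \<in> hardy2"
  shows "summable (\<lambda>n. fps_nth F n * cnj (fps_nth G n))"
  using hardy_inner_summable_norm[OF assms]
  by (intro summable_norm_cancel[of "\<lambda>n. fps_nth F n * cnj (fps_nth G n)"]) (simp add: norm_mult)

lemma hardy_inner_self:
  assumes "F \<in> hardy2" shows "hardy_inner F F = of_real ((hardy_norm F)\<^sup>2)"
proof -
  have "(\<Sum>n. complex_of_real ((cmod (fps_nth F n))\<^sup>2)) = of_real (\<Sum>n. (cmod (fps_nth F n))\<^sup>2)"
    using assms unfolding hardy2_iff by (simp add: suminf_of_real)
  then show ?thesis
    unfolding hardy_inner_def hardy_norm_sq[OF assms] complex_norm_square by simp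
qed

lemma hardy_inner_add_left:
  "F \<in> hardy2 \<Longrightarrow> G \<in> hardy2 \<Longrightarrow> H \<in> hardy2 \<Longrightarrow>
    hardy_inner (F + G) H = hardy_inner F H + hardy_inner G H"
  unfolding hardy_inner_def
  by (subst suminf_add) (auto simp: algebra_simps hardy_inner_summable)

lemma hardy_inner_const_left:
  "F \<in> hardy2 \<Longrightarrow> H \<in> hardy2 \<Longrightarrow> hardy_inner (fps_const c * F) H = c * hardy_inner F H"
  unfolding hardy_inner_def
  by (subst suminf_mult[symmetric]) (auto simp: algebra_simps hardy_inner_summable)

lemma hardy_inner_commute:
  assumes "F \<in> hardy2" "G \<in> hardy2" shows "hardy_inner G F = cnj (hardy_inner F G)"
proof -
  have "(\<lambda>n. cnj (fps_nth F n * cnj (fps_nth G n))) sums cnj (hardy_inner F G)"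
    unfolding hardy_inner_def sums_cnj by (intro summable_sums hardy_inner_summable assms)
  then show ?thesis unfolding hardy_inner_def[of G F] by (simp add: sums_iff mult.commute)
qed

lemma hardy_inner_0_left [simp]: "hardy_inner 0 F = 0"
  and hardy_inner_0_right [simp]: "hardy_inner F 0 = 0"
  by (simp_all add: hardy_inner_def)

lemma hardy_inner_minus_left: "F \<in> hardy2 \<Longrightarrow> H \<in> hardy2 \<Longrightarrow> hardy_inner (- F) H = - hardy_inner F H"
  using hardy_inner_const_left[of F H "- 1"] by (simp flip: fps_const_neg)

lemma hardy_inner_diff_left:
  "F \<in> hardy2 \<Longrightarrow> G \<in> hardy2 \<Longrightarrow> H \<in> hardy2 \<Longrightarrow>
    hardy_inner (F - G) H = hardy_inner F H - hardy_inner G H"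
  using hardy_inner_add_left[of F "- G" H] by (simp add: hardy_inner_minus_left hardy2_uminus)

lemma hardy_inner_add_right:
  "F \<in> hardy2 \<Longrightarrow> G \<in> hardy2 \<Longrightarrow> H \<in> hardy2 \<Longrightarrow>
    hardy_inner H (F + G) = hardy_inner H F + hardy_inner H G"
  by (simp add: hardy_inner_commute[of _ H] hardy_inner_add_left hardy2_add)

lemma hardy_inner_diff_right:
  "F \<in> hardy2 \<Longrightarrow> G \<in> hardy2 \<Longrightarrow> H \<in> hardy2 \<Longrightarrow>
    hardy_inner H (F - G) = hardy_inner H F - hardy_inner H G"
  by (simp add: hardy_inner_commute[of _ H] hardy_inner_diff_left hardy2_diff)

lemma hardy_inner_const_right:
  "F \<in> hardy2 \<Longrightarrow> H \<in> hardy2 \<Longrightarrow> hardy_inner H (fps_const c * F) = cnj c * hardy_inner H F"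
  by (simp add: hardy_inner_commute[of _ H] hardy_inner_const_left hardy2_const_mult)

lemma hardy_inner_sum_left:
  "(\<And>i. i \<in> I \<Longrightarrow> F i \<in> hardy2) \<Longrightarrow> H \<in> hardy2 \<Longrightarrow>
    hardy_inner (\<Sum>i\<in>I. F i) H = (\<Sum>i\<in>I. hardy_inner (F i) H)"
  by (induction I rule: infinite_finite_induct) (auto simp: hardy_inner_add_left hardy2_sum)

lemma hardy_inner_sum_right:
  "(\<And>i. i \<in> I \<Longrightarrow> F i \<in> hardy2) \<Longrightarrow> H \<in> hardy2 \<Longrightarrow>
    hardy_inner H (\<Sum>i\<in>I. F i) = (\<Sum>i\<in>I. hardy_inner H (F i))"
  by (induction I rule: infinite_finite_induct) (auto simp: hardy_inner_add_right hardy2_sum)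

lemma hardy_inner_X_power_mult:
  assumes "F \<in> hardy2" "G \<in> hardy2"
  shows "hardy_inner F (fps_X ^ k * G) = (\<Sum>n. fps_nth F (n + k) * cnj (fps_nth G n))"
proof -
  have s: "summable (\<lambda>n. fps_nth F n * cnj (fps_nth (fps_X ^ k * G) n))"
    by (intro hardy_inner_summable assms hardy2_X_power_mult)
  show ?thesis
    unfolding hardy_inner_def suminf_split_initial_segment[OF s, of k]
    by (simp add: fps_X_power_mult_nth)
qed

lemma hardy_inner_finite_right:
  assumes "\<And>n. n \<ge> N \<Longrightarrow> fps_nth G n = 0"
  shows "hardy_inner F G = (\<Sum>n<N. fps_nth F n * cnj (fps_nth G n))"
  unfolding hardy_inner_def by (rule suminf_finite) (auto simp: assms not_less)

lemma hardy_inner_X_power [simp]: "hardy_inner F (fps_X ^ k) = fps_nth F k"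
  by (subst hardy_inner_finite_right[of "Suc k"]) (auto simp: fps_X_power_nth if_distrib cong: if_cong)

lemma hardy_inner_bound:
  assumes "F \<in> hardy2" "G \<in> hardy2"
  shows "cmod (hardy_inner F G) \<le> hardy_norm F * hardy_norm G"
proof -
  have s: "summable (\<lambda>n. norm (fps_nth F n * cnj (fps_nth G n)))"
    using hardy_inner_summable_norm[OF assms] by (simp add: norm_mult)
  have L: "L2_set (\<lambda>n. cmod (fps_nth H n)) A \<le> hardy_norm H" if "H \<in> hardy2" "finite A" for H A
    using that unfolding L2_set_def hardy_norm_def hardy2_iff
    by (auto intro!: sum_le_suminf)
  have "cmod (hardy_inner F G) \<le> (\<Sum>n. norm (fps_nth F n * cnj (fps_nth G n)))"
    unfolding hardy_inner_def by (rule summable_norm[OF s])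
  also have "\<dots> \<le> hardy_norm F * hardy_norm G"
  proof (rule suminf_le_const[OF s])
    fix n
    have "(\<Sum>i<n. norm (fps_nth F i * cnj (fps_nth G i)))
        \<le> L2_set (\<lambda>n. cmod (fps_nth F n)) {..<n} * L2_set (\<lambda>n. cmod (fps_nth G n)) {..<n}"
      using L2_set_mult_ineq[of "\<lambda>n. cmod (fps_nth F n)" "\<lambda>n. cmod (fps_nth G n)" "{..<n}"]
      by (simp add: norm_mult)
    also have "\<dots> \<le> hardy_norm F * hardy_norm G"
      by (intro mult_mono L assms) (auto simp: assms)
    finally show "(\<Sum>i<n. norm (fps_nth F i * cnj (fps_nth G i))) \<le> hardy_norm F * hardy_norm G" .
  qed
  finally show ?thesis .
qed

lemma hardy_norm_add_sq:
  assumes "F \<in> hardy2" "G \<in> hardy2"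
  shows "(hardy_norm (F + G))\<^sup>2 = (hardy_norm F)\<^sup>2 + 2 * Re (hardy_inner F G) + (hardy_norm G)\<^sup>2"
proof -
  have "complex_of_real ((hardy_norm (F + G))\<^sup>2) = hardy_inner (F + G) (F + G)"
    using assms by (intro hardy_inner_self[symmetric]) auto
  also have "\<dots> = hardy_inner F F + (hardy_inner F G + cnj (hardy_inner F G)) + hardy_inner G G"
    using assms by (simp add: hardy_inner_add_left hardy_inner_add_right hardy2_add
        hardy_inner_commute[of F G])
  also have "\<dots> = of_real ((hardy_norm F)\<^sup>2 + 2 * Re (hardy_inner F G) + (hardy_norm G)\<^sup>2)"
    using assms by (simp add: hardy_inner_self complex_add_cnj)
  finally show ?thesis by (simp only: of_real_eq_iff)
qed

lemma hardy_norm_triangle: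
  assumes "F \<in> hardy2" "G \<in> hardy2"
  shows "hardy_norm (F + G) \<le> hardy_norm F + hardy_norm G"
proof (rule power2_le_imp_le)
  have "Re (hardy_inner F G) \<le> hardy_norm F * hardy_norm G"
    using hardy_inner_bound[OF assms] complex_Re_le_cmod order_trans by blast
  then show "(hardy_norm (F + G))\<^sup>2 \<le> (hardy_norm F + hardy_norm G)\<^sup>2"
    by (simp add: hardy_norm_add_sq[OF assms] power2_sum)
qed (use assms in auto)

lemma hardy_norm_diff_bound:
  assumes "F \<in> hardy2" "G \<in> hardy2"
  shows "\<bar>hardy_norm F - hardy_norm G\<bar> \<le> hardy_norm (F - G)"
  using hardy_norm_triangle[of "F - G" G] hardy_norm_triangle[of "G - F" F]
    hardy_norm_minus_commute[of F G] assms
  by (simp add: hardy2_diff abs_le_iff)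

lemma hardy_norm_tendsto:
  assumes "F \<in> hardy2" "\<And>k. G k \<in> hardy2" "(\<lambda>k. hardy_norm (G k - F)) \<longlonglongrightarrow> 0"
  shows "(\<lambda>k. hardy_norm (G k)) \<longlonglongrightarrow> hardy_norm F"
proof (rule LIM_zero_cancel, rule Lim_null_comparison[OF _ assms(3)])
  show "\<forall>\<^sub>F k in sequentially. norm (hardy_norm (G k) - hardy_norm F) \<le> hardy_norm (G k - F)"
    using hardy_norm_diff_bound[OF assms(2,1)] by auto
qed

lemma hardy_inner_tendsto_left:
  assumes "F \<in> hardy2" "\<And>k. G k \<in> hardy2" "(\<lambda>k. hardy_norm (G k - F)) \<longlonglongrightarrow> 0" "H \<in> hardy2"
  shows "(\<lambda>k. hardy_inner (G k) H) \<longlonglongrightarrow> hardy_inner F H"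
proof (rule LIM_zero_cancel, rule Lim_null_comparison)
  show "\<forall>\<^sub>F k in sequentially. norm (hardy_inner (G k) H - hardy_inner F H)
      \<le> hardy_norm (G k - F) * hardy_norm H"
    using hardy_inner_bound[of "G _ - F" H] assms
    by (auto simp: hardy_inner_diff_left hardy2_diff)
  show "(\<lambda>k. hardy_norm (G k - F) * hardy_norm H) \<longlonglongrightarrow> 0"
    using tendsto_mult_right[OF assms(3), of "hardy_norm H"] by simp
qed

lemma hardy_inner_tendsto_right:
  assumes "F \<in> hardy2" "\<And>k. G k \<in> hardy2" "(\<lambda>k. hardy_norm (G k - F)) \<longlonglongrightarrow> 0" "H \<in> hardy2"
  shows "(\<lambda>k. hardy_inner H (G k)) \<longlonglongrightarrow> hardy_inner H F"
  using tendsto_cnj[OF hardy_inner_tendsto_left[OF assms]] assms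
  by (simp add: hardy_inner_commute[of _ H])

text \<open>Polynomials are dense.  Every later extension from polynomials to the whole
space uses this particular approximation.\<close>

lemma hardy_cutoff_tendsto:
  assumes "F \<in> hardy2" shows "(\<lambda>N. hardy_norm (fps_cutoff N F - F)) \<longlonglongrightarrow> 0"
proof -
  have s: "summable (\<lambda>n. (cmod (fps_nth F n))\<^sup>2)" using assms by (simp add: hardy2_iff)
  have e: "hardy_norm (fps_cutoff N F - F)
      = sqrt ((\<Sum>n. (cmod (fps_nth F n))\<^sup>2) - (\<Sum>n<N. (cmod (fps_nth F n))\<^sup>2))" for N
  proof -
    have "(\<Sum>n. (cmod (fps_nth (fps_cutoff N F - F) n))\<^sup>2)
        = (\<Sum>n. (cmod (fps_nth F n))\<^sup>2 - (if n < N then (cmod (fps_nth F n))\<^sup>2 else 0))"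
      by (rule suminf_cong) auto
    also have "\<dots> = (\<Sum>n. (cmod (fps_nth F n))\<^sup>2) - (\<Sum>n. if n < N then (cmod (fps_nth F n))\<^sup>2 else 0)"
      by (rule suminf_diff[symmetric, OF s summable_finite[of "{..<N}"]]) auto
    also have "(\<Sum>n. if n < N then (cmod (fps_nth F n))\<^sup>2 else 0) = (\<Sum>n<N. (cmod (fps_nth F n))\<^sup>2)"
      by (subst suminf_finite[of "{..<N}"]) auto
    finally show ?thesis by (simp add: hardy_norm_def)
  qed
  have "(\<lambda>N. sqrt ((\<Sum>n. (cmod (fps_nth F n))\<^sup>2) - (\<Sum>n<N. (cmod (fps_nth F n))\<^sup>2))) \<longlonglongrightarrow>
      sqrt ((\<Sum>n. (cmod (fps_nth F n))\<^sup>2) - (\<Sum>n. (cmod (fps_nth F n))\<^sup>2))"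
    by (intro tendsto_intros summable_LIMSEQ s)
  then show ?thesis by (simp add: e)
qed

lemma cutoff_eq_sum: "fps_cutoff N F = (\<Sum>k<N. fps_const (fps_nth F k) * fps_X ^ k)"
  for F :: "complex fps"
  by (rule fps_ext) (simp add: fps_sum_nth fps_X_power_nth if_distrib cong: if_cong)

lemma hardy_norm_cutoff_sq: "(hardy_norm (fps_cutoff N F))\<^sup>2 = (\<Sum>n<N. (cmod (fps_nth F n))\<^sup>2)"
  by (subst hardy_norm_sq, simp, subst suminf_finite[of "{..<N}"]) auto

lemma hardy_norm_cutoff_le:
  assumes "F \<in> hardy2" shows "hardy_norm (fps_cutoff N F) \<le> hardy_norm F"
proof (rule power2_le_imp_le)
  show "(hardy_norm (fps_cutoff N F))\<^sup>2 \<le> (hardy_norm F)\<^sup>2"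
    using assms unfolding hardy_norm_cutoff_sq hardy_norm_sq[OF assms] hardy2_iff
    by (intro sum_le_suminf) auto
qed (use assms in auto)

text \<open>Fatou's lemma for the coefficient norm: membership and the norm bound can both be read off
from the initial segments, so that they survive coefficientwise limits.\<close>

lemma hardy2_by_cutoffs:
  assumes "\<And>N. hardy_norm (fps_cutoff N F) \<le> M"
  shows "F \<in> hardy2" "hardy_norm F \<le> M"
proof -
  have M: "M \<ge> 0" using assms[of 0] by simp
  have b: "(\<Sum>n<N. (cmod (fps_nth F n))\<^sup>2) \<le> M\<^sup>2" for N
    unfolding hardy_norm_cutoff_sq[symmetric] by (intro power_mono assms) auto
  show F: "F \<in> hardy2" unfolding hardy2_iff
    by (rule summableI_nonneg_bounded[of _ "M\<^sup>2"]) (use b in auto)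
  show "hardy_norm F \<le> M"
  proof (rule power2_le_imp_le[OF _ M])
    show "(hardy_norm F)\<^sup>2 \<le> M\<^sup>2"
      using F b unfolding hardy_norm_sq[OF F] hardy2_iff by (intro suminf_le_const) auto
  qed
qed

section \<open>Wirtinger calculus and integration in polar coordinates\<close>

definition disc_integral :: "(complex \<Rightarrow> 'a::banach) \<Rightarrow> 'a" where
  "disc_integral F =
     integral (cbox (0, 0) (1, 2 * pi)) (\<lambda>(r, t). r *\<^sub>R F (of_real r * cis t))"

definition circle_integral :: "(complex \<Rightarrow> 'a::banach) \<Rightarrow> 'a" where
  "circle_integral F = integral {0..2 * pi} (\<lambda>t. F (cis t))"

lemma polar_in_cball: "x \<in> cbox (0, 0) (1, 2 * pi) \<Longrightarrow> complex_of_real (fst x) * cis (snd x) \<in> cball 0 1"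
  by (cases x) (auto simp: cbox_Pair_eq norm_mult)

lemma continuous_on_polar:
  assumes "continuous_on (cball 0 1) F"
  shows "continuous_on (cbox (0, 0) (1, 2 * pi)) (\<lambda>x. F (of_real (fst x) * cis (snd x)))"
proof (rule continuous_on_compose2[OF assms])
  show "continuous_on (cbox (0, 0) (1, 2 * pi)) (\<lambda>x. complex_of_real (fst x) * cis (snd x))"
    by (intro continuous_intros)
qed (use polar_in_cball in blast)

lemma continuous_on_polar_density:
  fixes F :: "complex \<Rightarrow> 'a::banach"
  assumes "continuous_on (cball 0 1) F"
  shows "continuous_on (cbox (0, 0) (1, 2 * pi)) (\<lambda>(r, t). r *\<^sub>R F (of_real r * cis t))"
  unfolding case_prod_unfold by (intro continuous_intros continuous_on_polar assms)

lemma polar_integrable: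
  fixes F :: "complex \<Rightarrow> 'a::banach"
  assumes "continuous_on (cball 0 1) F"
  shows "(\<lambda>(r, t). r *\<^sub>R F (of_real r * cis t)) integrable_on cbox (0, 0) (1, 2 * pi)"
  by (rule integrable_continuous[OF continuous_on_polar_density[OF assms]])

lemma disc_integral_add:
  assumes "continuous_on (cball 0 1) F" "continuous_on (cball 0 1) G"
  shows "disc_integral (\<lambda>z. F z + G z) = disc_integral F + disc_integral G"
  unfolding disc_integral_def
  using integral_add[OF polar_integrable[OF assms(1)] polar_integrable[OF assms(2)]]
  by (simp add: scaleR_add_right case_prod_unfold)

lemma disc_integral_cmult:
  fixes F :: "complex \<Rightarrow> real"
  shows "disc_integral (\<lambda>z. c * F z) = c * disc_integral F"
proof -
  have "(\<lambda>(r, t). r *\<^sub>R (c * F (of_real r * cis t)))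
      = (\<lambda>x. c * (case x of (r, t) \<Rightarrow> r *\<^sub>R F (of_real r * cis t)))"
    by (auto simp: fun_eq_iff)
  then show ?thesis unfolding disc_integral_def by simp
qed

lemma norm_disc_integral_le:
  fixes F :: "complex \<Rightarrow> complex" and g :: "complex \<Rightarrow> real"
  assumes "continuous_on (cball 0 1) F" "continuous_on (cball 0 1) g"
    and "\<And>z. z \<in> cball 0 1 \<Longrightarrow> cmod (F z) \<le> g z"
  shows "cmod (disc_integral F) \<le> disc_integral g"
  unfolding disc_integral_def
proof (rule integral_norm_bound_integral[OF polar_integrable[OF assms(1)] polar_integrable[OF assms(2)]])
  fix x :: "real \<times> real" assume x: "x \<in> cbox (0, 0) (1, 2 * pi)"
  then have "0 \<le> fst x" by (cases x) (auto simp: cbox_Pair_eq)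
  then show "norm (case x of (r, t) \<Rightarrow> r *\<^sub>R F (of_real r * cis t))
      \<le> (case x of (r, t) \<Rightarrow> r *\<^sub>R g (of_real r * cis t))"
    using assms(3)[OF polar_in_cball[OF x]] by (simp add: case_prod_unfold mult_left_mono)
qed

lemma disc_integral_mono:
  fixes F g :: "complex \<Rightarrow> real"
  assumes "continuous_on (cball 0 1) F" "continuous_on (cball 0 1) g"
    and "\<And>z. z \<in> cball 0 1 \<Longrightarrow> F z \<le> g z"
  shows "disc_integral F \<le> disc_integral g"
  unfolding disc_integral_def
proof (rule integral_le[OF polar_integrable[OF assms(1)] polar_integrable[OF assms(2)]])
  fix x :: "real \<times> real" assume x: "x \<in> cbox (0, 0) (1, 2 * pi)"
  then have "0 \<le> fst x" by (cases x) (auto simp: cbox_Pair_eq)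
  then show "(case x of (r, t) \<Rightarrow> r *\<^sub>R F (of_real r * cis t))
      \<le> (case x of (r, t) \<Rightarrow> r *\<^sub>R g (of_real r * cis t))"
    using assms(3)[OF polar_in_cball[OF x]] by (simp add: case_prod_unfold mult_left_mono)
qed

lemma disc_integral_cnj: "disc_integral (\<lambda>z. cnj (F z)) = cnj (disc_integral F)"
  unfolding disc_integral_def integral_cnj
  by (rule arg_cong[where f = "integral _"]) (auto simp: fun_eq_iff)

lemma disc_integral_polar:
  fixes F :: "complex \<Rightarrow> 'a::banach"
  assumes "continuous_on (cball 0 1) F"
  shows "disc_integral F
     = integral {0..1} (\<lambda>r. r *\<^sub>R integral {0..2 * pi} (\<lambda>t. F (of_real r * cis t)))"
  unfolding disc_integral_def integral_prod_continuous[OF continuous_on_polar_density[OF assms]]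
  by simp

text \<open>The numbers \<open>a\<close> and \<open>b\<close> are the Wirtinger derivatives of \<open>f\<close> with respect to \<open>z\<close> and \<open>cnj z\<close> at the
point; they are arguments of a relation because the relation determines them.\<close>

definition wirtinger :: "(complex \<Rightarrow> complex) \<Rightarrow> complex \<Rightarrow> complex \<Rightarrow> complex \<Rightarrow> bool" where
  "wirtinger f a b z \<longleftrightarrow> (f has_derivative (\<lambda>v. a * v + b * cnj v)) (at z)"

lemma wirtinger_holomorphic: "(f has_field_derivative a) (at z) \<Longrightarrow> wirtinger f a 0 z"
  by (simp add: wirtinger_def has_field_derivative_def)

lemma wirtinger_cnj: "wirtinger f a b z \<Longrightarrow> wirtinger (\<lambda>z. cnj (f z)) (cnj b) (cnj a) z"
  unfolding wirtinger_def by (drule has_derivative_cnj) (simp add: algebra_simps)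

lemma wirtinger_add:
  "wirtinger f a b z \<Longrightarrow> wirtinger g c d z \<Longrightarrow> wirtinger (\<lambda>z. f z + g z) (a + c) (b + d) z"
  unfolding wirtinger_def by (drule (1) has_derivative_add) (simp add: algebra_simps)

lemma wirtinger_mult:
  "wirtinger f a b z \<Longrightarrow> wirtinger g c d z \<Longrightarrow>
    wirtinger (\<lambda>z. f z * g z) (a * g z + f z * c) (b * g z + f z * d) z"
  unfolding wirtinger_def by (drule (1) has_derivative_mult) (simp add: algebra_simps)

lemma wirtinger_inverse:
  assumes "wirtinger f a b z" "f z \<noteq> 0"
  shows "wirtinger (\<lambda>z. inverse (f z)) (- a / (f z)\<^sup>2) (- b / (f z)\<^sup>2) z"
proof -
  have e: "(\<lambda>v. - (inverse (f z) * (a * v + b * cnj v) * inverse (f z)))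
      = (\<lambda>v. - a / (f z)\<^sup>2 * v + - b / (f z)\<^sup>2 * cnj v)"
    using assms(2) by (auto simp: fun_eq_iff field_simps power2_eq_square)
  show ?thesis
    using Deriv.has_derivative_inverse[OF assms(2) assms(1)[unfolded wirtinger_def]]
    unfolding wirtinger_def e .
qed

lemma wirtinger_cong:
  "wirtinger f a b z \<Longrightarrow> a = a' \<Longrightarrow> b = b' \<Longrightarrow> wirtinger f a' b' z"
  by simp

lemma wirtinger_isCont: "wirtinger f a b z \<Longrightarrow> isCont f z"
  unfolding wirtinger_def by (rule has_derivative_continuous)

lemma wirtinger_radial:
  assumes "wirtinger f a b (complex_of_real r * cis t)"
  shows "((\<lambda>r. f (of_real r * cis t)) has_vector_derivative a * cis t + b * cis (- t)) (at r within S)"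
proof -
  have d: "((\<lambda>r. complex_of_real r * cis t) has_derivative (\<lambda>h. complex_of_real h * cis t)) (at r within S)"
    by (auto intro!: derivative_eq_intros)
  have "(f \<circ> (\<lambda>r. complex_of_real r * cis t) has_derivative
     (\<lambda>v. a * v + b * cnj v) \<circ> (\<lambda>h. complex_of_real h * cis t)) (at r within S)"
    by (rule diff_chain_within[OF d has_derivative_at_withinI[OF assms[unfolded wirtinger_def]]])
  then show ?thesis
    by (simp add: has_vector_derivative_def o_def scaleR_conv_of_real cis_cnj algebra_simps)
qed

lemma wirtinger_angular:
  assumes "wirtinger f a b (complex_of_real r * cis t)"
  shows "((\<lambda>t. f (of_real r * cis t)) has_vector_derivative
            \<i> * r * (a * cis t - b * cis (- t))) (at t within S)"
proof -
  have d: "((\<lambda>t. complex_of_real r * cis t) has_derivative (\<lambda>h. complex_of_real h * (r * \<i> * cis t))) (at t within S)"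
    by (auto intro!: derivative_eq_intros simp: scaleR_conv_of_real)
  have "(f \<circ> (\<lambda>t. complex_of_real r * cis t) has_derivative
     (\<lambda>v. a * v + b * cnj v) \<circ> (\<lambda>h. complex_of_real h * (r * \<i> * cis t))) (at t within S)"
    by (rule diff_chain_within[OF d has_derivative_at_withinI[OF assms[unfolded wirtinger_def]]])
  then show ?thesis
    by (simp add: has_vector_derivative_def o_def scaleR_conv_of_real cis_cnj algebra_simps)
qed

text \<open>In polar coordinates \<open>2 r\<close> times the derivative by \<open>cnj z\<close> is
\<open>\<partial>\<^sub>r (r e\<^sup>i\<^sup>t f) + \<partial>\<^sub>t (\<i> e\<^sup>i\<^sup>t f)\<close>.  The first term integrates to the circle integral and the
second, being a derivative of a periodic function, to \<open>0\<close>.\<close>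

lemma stokes_dbar:
  assumes w: "\<And>z. z \<in> cball 0 1 \<Longrightarrow> wirtinger f (a z) (b z) z"
    and a: "continuous_on (cball 0 1) a" and b: "continuous_on (cball 0 1) b"
  shows "disc_integral b = (1 / 2) * circle_integral (\<lambda>z. z * f z)"
proof -
  define P where "P = (\<lambda>r t. cis t * f (of_real r * cis t) + r * (a (of_real r * cis t) * cis t
      + b (of_real r * cis t) * cis (- t)) * cis t)"
  define Q where "Q = (\<lambda>r t. - cis t * f (of_real r * cis t) - r * (a (of_real r * cis t) * cis t
      - b (of_real r * cis t) * cis (- t)) * cis t)"
  have inb: "complex_of_real r * cis t \<in> cball 0 1" if "r \<in> {0..1}" for r t
    using that by (simp add: norm_mult)
  have f: "continuous_on (cball 0 1) f"
    using w wirtinger_isCont by (intro continuous_at_imp_continuous_on) blast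
  have PQ: "P r t + Q r t = 2 * (r *\<^sub>R b (of_real r * cis t))" for r t
  proof -
    have "cis (- t) * cis t = 1" by (simp add: cis_mult)
    then show ?thesis unfolding P_def Q_def scaleR_conv_of_real by algebra
  qed
  have contP: "continuous_on (cbox (0, 0) (1, 2 * pi)) (\<lambda>(r, t). P r t)"
    unfolding P_def case_prod_unfold
    by (intro continuous_intros continuous_on_polar a b f)
  have contQ: "continuous_on (cbox (0, 0) (1, 2 * pi)) (\<lambda>(r, t). Q r t)"
    unfolding Q_def case_prod_unfold
    by (intro continuous_intros continuous_on_polar a b f)
  have P: "((\<lambda>r. P r t) has_integral (cis t * f (cis t))) {0..1}" for t
  proof -
    have "((\<lambda>r. P r t) has_integral (of_real 1 * cis t * f (of_real 1 * cis t) - of_real 0 * cis t * f (of_real 0 * cis t))) {0..1}"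
    proof (rule fundamental_theorem_of_calculus)
      fix r :: real assume "r \<in> {0..1}"
      have "((\<lambda>r. of_real r * cis t) has_vector_derivative cis t) (at r within {0..1})"
        unfolding has_vector_derivative_def
        by (auto intro!: derivative_eq_intros simp: scaleR_conv_of_real)
      from has_vector_derivative_mult[OF this wirtinger_radial[OF w[OF inb[OF \<open>r \<in> {0..1}\<close>]]]]
      show "((\<lambda>r. of_real r * cis t * f (of_real r * cis t)) has_vector_derivative P r t) (at r within {0..1})"
        by (rule has_vector_derivative_eq_rhs) (simp add: P_def algebra_simps)
    qed simp
    then show ?thesis by simp
  qed
  have Q: "((\<lambda>t. Q r t) has_integral 0) {0..2 * pi}" if r: "r \<in> {0..1}" for r
  proof -
    have "((\<lambda>t. Q r t) has_integral (\<i> * cis (2 * pi) * f (of_real r * cis (2 * pi)) - \<i> * cis 0 * f (of_real r * cis 0))) {0..2 * pi}"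
    proof (rule fundamental_theorem_of_calculus)
      fix t :: real
      have "((\<lambda>t. \<i> * cis t) has_vector_derivative - cis t) (at t within {0..2 * pi})"
        unfolding has_vector_derivative_def
        by (auto intro!: derivative_eq_intros simp: scaleR_conv_of_real fun_eq_iff complex_eq_iff)
      from has_vector_derivative_mult[OF this wirtinger_angular[OF w[OF inb[OF r]]]]
      show "((\<lambda>t. \<i> * cis t * f (of_real r * cis t)) has_vector_derivative Q r t) (at t within {0..2 * pi})"
        by (rule has_vector_derivative_eq_rhs) (simp add: Q_def algebra_simps)
    qed simp
    then show ?thesis by simp
  qed
  have "2 * disc_integral b = integral (cbox (0, 0) (1, 2 * pi)) (\<lambda>x. 2 * (case x of (r, t) \<Rightarrow> r *\<^sub>R b (of_real r * cis t)))"
    unfolding disc_integral_def by simp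
  also have "\<dots> = integral (cbox (0, 0) (1, 2 * pi)) (\<lambda>x. (case x of (r, t) \<Rightarrow> P r t) + (case x of (r, t) \<Rightarrow> Q r t))"
    by (intro Henstock_Kurzweil_Integration.integral_cong) (auto simp: PQ)
  also have "\<dots> = integral (cbox (0, 0) (1, 2 * pi)) (\<lambda>(r, t). P r t) + integral (cbox (0, 0) (1, 2 * pi)) (\<lambda>(r, t). Q r t)"
    by (intro integral_add integrable_continuous contP contQ)
  also have "integral (cbox (0, 0) (1, 2 * pi)) (\<lambda>(r, t). P r t) = integral {0..2 * pi} (\<lambda>t. integral {0..1} (\<lambda>r. P r t))"
    using integral_prod_continuous[OF contP] integral_swap_continuous[OF contP] by simp
  also have "\<dots> = circle_integral (\<lambda>z. z * f z)"
    unfolding circle_integral_def by (rule Henstock_Kurzweil_Integration.integral_cong) (rule integral_unique[OF P])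
  also have "integral (cbox (0, 0) (1, 2 * pi)) (\<lambda>(r, t). Q r t) = integral {0..1} (\<lambda>r. integral {0..2 * pi} (\<lambda>t. Q r t))"
    using integral_prod_continuous[OF contQ] by simp
  also have "\<dots> = integral {0..1} (\<lambda>r::real. 0)"
    by (rule Henstock_Kurzweil_Integration.integral_cong) (rule integral_unique[OF Q])
  finally show ?thesis by (simp add: mult.commute)
qed

text \<open>The function \<open>(1 - \<bar>z\<bar>\<^sup>2) * z * G z\<close> vanishes on the circle, so its \<open>z\<close>-derivative has integral
\<open>0\<close>.  This trades a factor \<open>1 - \<bar>z\<bar>\<^sup>2\<close> for a derivative of \<open>G\<close>; the factor is what makes the
Littlewood--Paley inequalities applicable.\<close>

lemma disc_integral_weighted:
  assumes w: "\<And>z. z \<in> cball 0 1 \<Longrightarrow> wirtinger G (a z) (b z) z"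
    and a: "continuous_on (cball 0 1) a" and b: "continuous_on (cball 0 1) b"
  shows "disc_integral G = disc_integral (\<lambda>z. of_real (1 - (cmod z)\<^sup>2) * (2 * G z + z * a z))"
proof -
  define X where "X = (\<lambda>z. (1 + (- z) * cnj z) * (z * G z))"
  define A where "A = (\<lambda>z. - cnj z * (z * G z) + (1 + - z * cnj z) * (G z + z * a z))"
  define B where "B = (\<lambda>z. - z * (z * G z) + (1 + - z * cnj z) * (z * b z))"
  have G: "continuous_on (cball 0 1) G"
    using w wirtinger_isCont by (intro continuous_at_imp_continuous_on) blast
  have id: "wirtinger (\<lambda>z. z) 1 0 z" for z
    by (rule wirtinger_holomorphic) (auto intro!: derivative_eq_intros)
  have neg: "wirtinger (\<lambda>z. - z) (- 1) 0 z" for z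
    by (rule wirtinger_holomorphic) (auto intro!: derivative_eq_intros)
  have one: "wirtinger (\<lambda>z. 1) 0 0 z" for z
    by (rule wirtinger_holomorphic) (auto intro!: derivative_eq_intros)
  have X: "wirtinger X (A z) (B z) z" if "z \<in> cball 0 1" for z
    unfolding X_def
    by (rule wirtinger_cong[OF wirtinger_mult[OF
          wirtinger_add[OF one wirtinger_mult[OF neg wirtinger_cnj[OF id]]]
          wirtinger_mult[OF id w[OF that]]]]) (simp_all add: A_def B_def)
  have cA: "continuous_on (cball 0 1) A" and cB: "continuous_on (cball 0 1) B"
    unfolding A_def B_def by (intro continuous_intros a b G)+
  have "disc_integral (\<lambda>z. cnj (A z)) = (1 / 2) * circle_integral (\<lambda>z. z * cnj (X z))"
    by (rule stokes_dbar[where a = "\<lambda>z. cnj (B z)"])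
      (auto intro!: wirtinger_cnj X continuous_on_cnj cA cB)
  also have "circle_integral (\<lambda>z. z * cnj (X z)) = 0"
    unfolding circle_integral_def X_def by (simp add: cis_cnj cis_mult)
  finally have 0: "disc_integral A = 0" by (simp add: disc_integral_cnj)
  have m: "of_real (1 - (cmod z)\<^sup>2) = 1 - z * cnj z" for z
    by (simp only: of_real_diff of_real_1 complex_norm_square)
  have "disc_integral (\<lambda>z. of_real (1 - (cmod z)\<^sup>2) * (2 * G z + z * a z))
      = disc_integral (\<lambda>z. A z + G z)"
    unfolding A_def m by (simp add: algebra_simps)
  also have "\<dots> = disc_integral G" using 0 by (simp add: disc_integral_add cA G)
  finally show ?thesis by simp
qed

lemma has_integral_cis_int:
  "((\<lambda>t. cis (of_int n * t)) has_integral (if n = 0 then 2 * pi else 0)) {0..2 * pi}"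
proof (cases "n = 0")
  case True
  then show ?thesis using has_integral_const_real[of "1::complex" 0 "2 * pi"]
    by (simp add: scaleR_conv_of_real)
next
  case False
  have "((\<lambda>t. cis (of_int n * t)) has_integral
      (cis (of_int n * (2 * pi)) / (\<i> * of_int n) - cis (of_int n * 0) / (\<i> * of_int n))) {0..2 * pi}"
  proof (rule fundamental_theorem_of_calculus)
    fix t :: real
    show "((\<lambda>t. cis (of_int n * t) / (\<i> * of_int n)) has_vector_derivative cis (of_int n * t)) (at t within {0..2 * pi})"
      using False unfolding has_vector_derivative_def
      by (auto intro!: derivative_eq_intros simp: scaleR_conv_of_real fun_eq_iff complex_eq_iff)
  qed simp
  moreover have "cis (of_int n * (2 * pi)) = 1"
    using cis_multiple_2pi[of "of_int n"] by (simp add: mult_ac)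
  ultimately show ?thesis using False by simp
qed

text \<open>Orthogonality of the characters, for trigonometric sums with nonnegative frequencies.\<close>

lemma parseval_circle:
  fixes a :: "nat \<Rightarrow> complex"
  shows "((\<lambda>t. (cmod (\<Sum>k<n. a k * cis t ^ k))\<^sup>2) has_integral 2 * pi * (\<Sum>k<n. (cmod (a k))\<^sup>2)) {0..2 * pi}"
proof -
  have "((\<lambda>t. \<Sum>k<n. \<Sum>l<n. a k * cnj (a l) * cis (of_int (int k - int l) * t)) has_integral
     (\<Sum>k<n. \<Sum>l<n. a k * cnj (a l) * (if int k - int l = 0 then 2 * pi else 0))) {0..2 * pi}"
    by (intro has_integral_sum has_integral_mult_right has_integral_cis_int) auto
  also have "(\<lambda>t. \<Sum>k<n. \<Sum>l<n. a k * cnj (a l) * cis (of_int (int k - int l) * t))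
      = (\<lambda>t. complex_of_real ((cmod (\<Sum>k<n. a k * cis t ^ k))\<^sup>2))"
    unfolding complex_norm_square cnj_sum sum_product
    by (intro ext sum.cong refl)
      (simp add: Complex.DeMoivre cis_cnj cis_mult algebra_simps)
  also have "(\<Sum>k<n. \<Sum>l<n. a k * cnj (a l) * (if int k - int l = 0 then 2 * pi else 0))
      = complex_of_real (2 * pi * (\<Sum>k<n. (cmod (a k))\<^sup>2))"
  proof -
    have "(\<Sum>k<n. \<Sum>l<n. a k * cnj (a l) * (if int k - int l = 0 then 2 * pi else 0))
        = (\<Sum>k<n. a k * cnj (a k) * (2 * pi))"
      by (intro sum.cong refl) (simp add: if_distrib cong: if_cong)
    then show ?thesis by (simp add: complex_norm_square sum_distrib_left mult_ac del: of_real_power)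
  qed
  finally have "((\<lambda>t. complex_of_real ((cmod (\<Sum>k<n. a k * cis t ^ k))\<^sup>2)) has_integral
      complex_of_real (2 * pi * (\<Sum>k<n. (cmod (a k))\<^sup>2))) {0..2 * pi}" .
  from has_integral_linear[OF this bounded_linear_Re] show ?thesis
    by (simp only: o_def Re_complex_of_real)
qed

section \<open>Littlewood--Paley and Carleson inequalities for polynomials\<close>

abbreviation poly_norm2 :: "complex poly \<Rightarrow> real" where
  "poly_norm2 f \<equiv> (hardy_norm (fps_of_poly f))\<^sup>2"

lemma hardy2_fps_of_poly [simp, intro]: "fps_of_poly f \<in> hardy2"
  by (rule hardy2_finite[of "Suc (degree f)"]) (auto simp: coeff_eq_0)

lemma poly_norm2_eq:
  assumes "degree f < n" shows "poly_norm2 f = (\<Sum>k<n. (cmod (coeff f k))\<^sup>2)"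
  using assms by (subst hardy_norm_sq) (auto intro!: suminf_finite intro: le_less_trans[OF le_degree])

lemma poly_lessThan: "poly f z = (\<Sum>k<Suc (degree f). coeff f k * z ^ k)" for f :: "complex poly"
  by (simp add: poly_altdef lessThan_Suc_atMost)

lemma parseval_poly: "((\<lambda>t. (cmod (poly f (cis t)))\<^sup>2) has_integral 2 * pi * poly_norm2 f) {0..2 * pi}"
  using parseval_circle[of "coeff f" "Suc (degree f)"]
  unfolding poly_lessThan poly_norm2_eq[OF lessI] .

text \<open>On the circle of radius \<open>r\<close> the square mean is \<open>\<Sum>k. \<bar>f\<^sub>k\<bar>\<^sup>2 r\<^sup>2\<^sup>k\<close>, and \<open>2 r\<^sup>2\<^sup>k\<^sup>+\<^sup>1 (1 - r\<^sup>2)\<close> has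
integral \<open>1 / ((k + 1) (k + 2))\<close> over the unit interval.\<close>

lemma weighted_disc_integral_poly:
  "disc_integral (\<lambda>z. (1 - (cmod z)\<^sup>2) * (cmod (poly f z))\<^sup>2)
     = pi * (\<Sum>k<Suc (degree f). (cmod (coeff f k))\<^sup>2 / (real (k + 1) * real (k + 2)))"
proof -
  let ?n = "Suc (degree f)"
  have c: "integral {0..2 * pi} (\<lambda>t. (1 - (cmod (of_real r * cis t))\<^sup>2) * (cmod (poly f (of_real r * cis t)))\<^sup>2)
      = (1 - r\<^sup>2) * (2 * pi * (\<Sum>k<?n. (cmod (coeff f k))\<^sup>2 * r ^ (2 * k)))" for r
  proof (rule integral_unique)
    have "((\<lambda>t. (1 - r\<^sup>2) * (cmod (\<Sum>k<?n. (coeff f k * of_real r ^ k) * cis t ^ k))\<^sup>2) has_integral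
       (1 - r\<^sup>2) * (2 * pi * (\<Sum>k<?n. (cmod (coeff f k * of_real r ^ k))\<^sup>2))) {0..2 * pi}"
      by (intro has_integral_mult_right parseval_circle)
    also have "(\<Sum>k<?n. (cmod (coeff f k * of_real r ^ k))\<^sup>2) = (\<Sum>k<?n. (cmod (coeff f k))\<^sup>2 * r ^ (2 * k))"
      by (intro sum.cong refl)
        (simp add: norm_mult norm_power power_mult_distrib power_mult[symmetric] mult.commute power_even_abs)
    finally show "((\<lambda>t. (1 - (cmod (of_real r * cis t))\<^sup>2) * (cmod (poly f (of_real r * cis t)))\<^sup>2)
        has_integral (1 - r\<^sup>2) * (2 * pi * (\<Sum>k<?n. (cmod (coeff f k))\<^sup>2 * r ^ (2 * k)))) {0..2 * pi}"
      unfolding poly_lessThan by (simp add: norm_mult power_mult_distrib mult.assoc del: sum.lessThan_Suc)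
  qed
  have "((\<lambda>r. r *\<^sub>R ((1 - r\<^sup>2) * (2 * pi * (\<Sum>k<?n. (cmod (coeff f k))\<^sup>2 * r ^ (2 * k))))) has_integral
     (\<Sum>k<?n. 2 * pi * (cmod (coeff f k))\<^sup>2 * (1 ^ (2 * k + 2) / (2 * k + 2) - 1 ^ (2 * k + 4) / (2 * k + 4)))
     - (\<Sum>k<?n. 2 * pi * (cmod (coeff f k))\<^sup>2 * (0 ^ (2 * k + 2) / (2 * k + 2) - 0 ^ (2 * k + 4) / (2 * k + 4)))) {0..1}"
  proof (rule fundamental_theorem_of_calculus)
    fix r :: real
    have p: "((\<lambda>r. r ^ Suc m / real (Suc m)) has_vector_derivative r ^ m) (at r within {0..1})" for m
      unfolding has_real_derivative_iff_has_vector_derivative[symmetric]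
      by (auto intro!: derivative_eq_intros simp del: of_nat_Suc power_Suc)
    have "((\<lambda>r. \<Sum>k<?n. 2 * pi * (cmod (coeff f k))\<^sup>2 * (r ^ Suc (2 * k + 1) / real (Suc (2 * k + 1)) - r ^ Suc (2 * k + 3) / real (Suc (2 * k + 3))))
       has_vector_derivative (\<Sum>k<?n. 2 * pi * (cmod (coeff f k))\<^sup>2 * (r ^ (2 * k + 1) - r ^ (2 * k + 3)))) (at r within {0..1})"
      by (intro has_vector_derivative_sum has_vector_derivative_mult_right has_vector_derivative_diff p)
    moreover have "(\<Sum>k<?n. 2 * pi * (cmod (coeff f k))\<^sup>2 * (r ^ (2 * k + 1) - r ^ (2 * k + 3)))
       = r *\<^sub>R ((1 - r\<^sup>2) * (2 * pi * (\<Sum>k<?n. (cmod (coeff f k))\<^sup>2 * r ^ (2 * k))))"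
      unfolding sum_distrib_left scaleR_conv_of_real
      by (intro sum.cong refl) (simp add: algebra_simps power_add power2_eq_square power3_eq_cube)
    ultimately show "((\<lambda>r. \<Sum>k<?n. 2 * pi * (cmod (coeff f k))\<^sup>2 * (r ^ (2 * k + 2) / (2 * k + 2) - r ^ (2 * k + 4) / (2 * k + 4)))
       has_vector_derivative r *\<^sub>R ((1 - r\<^sup>2) * (2 * pi * (\<Sum>k<?n. (cmod (coeff f k))\<^sup>2 * r ^ (2 * k))))) (at r within {0..1})"
      by (simp del: sum.lessThan_Suc power_Suc add: numeral_eq_Suc add_ac)
  qed simp
  moreover have "(\<Sum>k<?n. 2 * pi * (cmod (coeff f k))\<^sup>2 * (1 ^ (2 * k + 2) / (2 * k + 2) - 1 ^ (2 * k + 4) / (2 * k + 4)))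
     - (\<Sum>k<?n. 2 * pi * (cmod (coeff f k))\<^sup>2 * (0 ^ (2 * k + 2) / (2 * k + 2) - 0 ^ (2 * k + 4) / (2 * k + 4)))
     = pi * (\<Sum>k<?n. (cmod (coeff f k))\<^sup>2 / (real (k + 1) * real (k + 2)))"
    unfolding sum_distrib_left sum_subtractf[symmetric]
  proof (intro sum.cong refl)
    fix k
    have "1 / (2 * real k + 2) - 1 / (2 * real k + 4) = 1 / (2 * ((real k + 1) * (real k + 2)))"
      by (simp add: divide_simps add_eq_0_iff) (simp add: algebra_simps)
    moreover have "(0::real) ^ (2 * k + 2) = 0" "(0::real) ^ (2 * k + 4) = 0" by auto
    ultimately show "2 * pi * (cmod (coeff f k))\<^sup>2 * (1 ^ (2 * k + 2) / (2 * k + 2) - 1 ^ (2 * k + 4) / (2 * k + 4))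
        - 2 * pi * (cmod (coeff f k))\<^sup>2 * (0 ^ (2 * k + 2) / (2 * k + 2) - 0 ^ (2 * k + 4) / (2 * k + 4))
        = pi * ((cmod (coeff f k))\<^sup>2 / (real (k + 1) * real (k + 2)))"
      by (simp only: power_one of_nat_add of_nat_mult of_nat_numeral of_nat_1) simp
  qed
  ultimately show ?thesis
    by (subst disc_integral_polar) (auto simp: c integral_unique intro!: continuous_intros)
qed

lemma weighted_disc_integral_poly_le:
  "disc_integral (\<lambda>z. (1 - (cmod z)\<^sup>2) * (cmod (poly f z))\<^sup>2) \<le> pi * poly_norm2 f"
proof -
  have "(\<Sum>k<Suc (degree f). (cmod (coeff f k))\<^sup>2 / (real (k + 1) * real (k + 2))) \<le> (\<Sum>k<Suc (degree f). (cmod (coeff f k))\<^sup>2)"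
  proof (rule sum_mono)
    fix k
    have "1 * 1 \<le> real (k + 1) * real (k + 2)" by (intro mult_mono) auto
    then have "(cmod (coeff f k))\<^sup>2 / (real (k + 1) * real (k + 2)) \<le> (cmod (coeff f k))\<^sup>2 / 1"
      by (intro divide_left_mono) auto
    then show "(cmod (coeff f k))\<^sup>2 / (real (k + 1) * real (k + 2)) \<le> (cmod (coeff f k))\<^sup>2" by simp
  qed
  then show ?thesis
    unfolding weighted_disc_integral_poly poly_norm2_eq[OF lessI]
    by (rule mult_left_mono) simp
qed

text \<open>The factor \<open>k\<^sup>2\<close> that differentiation produces is absorbed by the weights
\<open>1 / (k (k + 1))\<close> of the preceding formula.\<close>

lemma littlewood_paley_poly:
  "disc_integral (\<lambda>z. (1 - (cmod z)\<^sup>2) * (cmod (poly (pderiv f) z))\<^sup>2) \<le> pi * poly_norm2 f"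
proof -
  have "(\<Sum>k<Suc (degree (pderiv f)). (cmod (coeff (pderiv f) k))\<^sup>2 / (real (k + 1) * real (k + 2)))
      \<le> (\<Sum>k<Suc (degree f). (cmod (coeff f (Suc k)))\<^sup>2)"
  proof -
    have "(\<Sum>k<Suc (degree (pderiv f)). (cmod (coeff (pderiv f) k))\<^sup>2 / (real (k + 1) * real (k + 2)))
        \<le> (\<Sum>k<Suc (degree (pderiv f)). (cmod (coeff f (Suc k)))\<^sup>2)"
    proof (rule sum_mono)
      fix k
      have "(cmod (coeff (pderiv f) k))\<^sup>2 = real (k + 1) * real (k + 1) * (cmod (coeff f (Suc k)))\<^sup>2"
        unfolding coeff_pderiv norm_mult norm_of_nat power_mult_distrib
        by (simp add: power2_eq_square)
      also have "\<dots> \<le> real (k + 1) * real (k + 2) * (cmod (coeff f (Suc k)))\<^sup>2"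
        by (intro mult_mono) auto
      finally show "(cmod (coeff (pderiv f) k))\<^sup>2 / (real (k + 1) * real (k + 2)) \<le> (cmod (coeff f (Suc k)))\<^sup>2"
        by (simp add: divide_simps mult_ac)
    qed
    also have "\<dots> \<le> (\<Sum>k<Suc (degree f). (cmod (coeff f (Suc k)))\<^sup>2)"
      by (rule sum_mono2) (auto simp: degree_pderiv)
    finally show ?thesis .
  qed
  also have "\<dots> \<le> (\<Sum>k<Suc (Suc (degree f)). (cmod (coeff f k))\<^sup>2)"
    by (subst (2) sum.lessThan_Suc_shift) simp
  also have "\<dots> = poly_norm2 f" by (rule poly_norm2_eq[symmetric]) simp
  finally show ?thesis
    unfolding weighted_disc_integral_poly
    by (rule mult_left_mono) simp
qed

lemma poly_norm2_mult_le:
  assumes "\<And>z. cmod z \<le> 1 \<Longrightarrow> cmod (poly \<phi> z) \<le> M"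
  shows "poly_norm2 (\<phi> * f) \<le> M\<^sup>2 * poly_norm2 f"
proof -
  have "2 * pi * poly_norm2 (\<phi> * f) \<le> M\<^sup>2 * (2 * pi * poly_norm2 f)"
  proof (rule has_integral_le[OF parseval_poly has_integral_mult_right[OF parseval_poly]])
    fix t
    show "(cmod (poly (\<phi> * f) (cis t)))\<^sup>2 \<le> M\<^sup>2 * (cmod (poly f (cis t)))\<^sup>2"
      using assms[of "cis t"] by (simp add: norm_mult power_mult_distrib mult_right_mono power_mono)
  qed
  then have "2 * pi * poly_norm2 (\<phi> * f) \<le> 2 * pi * (M\<^sup>2 * poly_norm2 f)" by (simp add: mult_ac)
  then show ?thesis by (rule mult_left_le_imp_le) simp
qed

text \<open>The Carleson embedding for the measure \<open>(1 - \<bar>z\<bar>\<^sup>2) \<bar>\<phi>'\<bar>\<^sup>2 dA\<close> with a bounded symbol \<open>\<phi>\<close>: in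
\<open>\<phi>' f = (\<phi> f)' - \<phi> f'\<close> both terms are controlled by the Littlewood--Paley inequality.\<close>

lemma carleson_embedding_poly:
  assumes M: "\<And>z. cmod z \<le> 1 \<Longrightarrow> cmod (poly \<phi> z) \<le> M"
  shows "disc_integral (\<lambda>z. (1 - (cmod z)\<^sup>2) * ((cmod (poly (pderiv \<phi>) z))\<^sup>2 * (cmod (poly f z))\<^sup>2))
     \<le> 4 * M\<^sup>2 * pi * poly_norm2 f"
proof -
  let ?w = "\<lambda>z::complex. 1 - (cmod z)\<^sup>2"
  have "disc_integral (\<lambda>z. ?w z * ((cmod (poly (pderiv \<phi>) z))\<^sup>2 * (cmod (poly f z))\<^sup>2))
    \<le> disc_integral (\<lambda>z. 2 * (?w z * (cmod (poly (pderiv (\<phi> * f)) z))\<^sup>2) + (2 * M\<^sup>2) * (?w z * (cmod (poly (pderiv f) z))\<^sup>2))"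
  proof (rule disc_integral_mono)
    fix z :: complex assume "z \<in> cball 0 1"
    then have z: "cmod z \<le> 1" by simp
    have "(cmod (poly (pderiv \<phi>) z) * cmod (poly f z))\<^sup>2
        = (cmod (poly (pderiv (\<phi> * f)) z - poly \<phi> z * poly (pderiv f) z))\<^sup>2"
      by (simp add: pderiv_mult norm_mult mult.commute)
    also have "\<dots> \<le> (cmod (poly (pderiv (\<phi> * f)) z) + cmod (poly \<phi> z * poly (pderiv f) z))\<^sup>2"
      by (intro power_mono norm_triangle_ineq4) auto
    also have "\<dots> \<le> 2 * (cmod (poly (pderiv (\<phi> * f)) z))\<^sup>2 + 2 * (cmod (poly \<phi> z * poly (pderiv f) z))\<^sup>2"
      by (smt (verit) power2_sum sum_squares_bound)
    also have "(cmod (poly \<phi> z * poly (pderiv f) z))\<^sup>2 \<le> M\<^sup>2 * (cmod (poly (pderiv f) z))\<^sup>2"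
      unfolding norm_mult power_mult_distrib by (intro mult_right_mono power_mono M z) auto
    finally have "(cmod (poly (pderiv \<phi>) z))\<^sup>2 * (cmod (poly f z))\<^sup>2
       \<le> 2 * (cmod (poly (pderiv (\<phi> * f)) z))\<^sup>2 + 2 * (M\<^sup>2 * (cmod (poly (pderiv f) z))\<^sup>2)"
      by (simp add: power_mult_distrib)
    from mult_left_mono[OF this, of "?w z"] z
    show "?w z * ((cmod (poly (pderiv \<phi>) z))\<^sup>2 * (cmod (poly f z))\<^sup>2)
      \<le> 2 * (?w z * (cmod (poly (pderiv (\<phi> * f)) z))\<^sup>2) + (2 * M\<^sup>2) * (?w z * (cmod (poly (pderiv f) z))\<^sup>2)"
      by (simp add: algebra_simps abs_square_le_1)
  qed (intro continuous_intros)+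
  also have "\<dots> = 2 * disc_integral (\<lambda>z. ?w z * (cmod (poly (pderiv (\<phi> * f)) z))\<^sup>2)
      + 2 * M\<^sup>2 * disc_integral (\<lambda>z. ?w z * (cmod (poly (pderiv f) z))\<^sup>2)"
    by (subst disc_integral_add) (auto simp: disc_integral_cmult intro!: continuous_intros)
  also have "\<dots> \<le> 2 * (pi * (M\<^sup>2 * poly_norm2 f)) + 2 * M\<^sup>2 * (pi * poly_norm2 f)"
    by (intro add_mono mult_left_mono order_trans[OF littlewood_paley_poly] poly_norm2_mult_le M) auto
  finally show ?thesis by (simp add: algebra_simps)
qed

section \<open>The corona estimate for polynomials\<close>

lemma cmod_cauchy_schwarz2:
  fixes a b x y :: complex
  shows "cmod (a * x + b * y) \<le> sqrt ((cmod a)\<^sup>2 + (cmod b)\<^sup>2) * sqrt ((cmod x)\<^sup>2 + (cmod y)\<^sup>2)"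
proof -
  have "cmod (a * x + b * y) \<le> cmod a * cmod x + cmod b * cmod y"
    using norm_triangle_ineq[of "a * x" "b * y"] by (simp add: norm_mult)
  also have "\<dots> \<le> sqrt ((cmod a)\<^sup>2 + (cmod b)\<^sup>2) * sqrt ((cmod x)\<^sup>2 + (cmod y)\<^sup>2)"
    using real_inner_class.Cauchy_Schwarz_ineq2[of "(cmod a, cmod b)" "(cmod x, cmod y)"]
    by (simp add: norm_prod_def)
  finally show ?thesis .
qed

text \<open>All products of two functions are split by this inequality, with one and the same \<open>s\<close>.  Choosing \<open>s\<close> at
the end takes the place of the Cauchy--Schwarz inequality for area integrals.\<close>

lemma weighted_amgm:
  fixes x y s :: real
  assumes "s > 0" shows "2 * (x * y) \<le> s * x\<^sup>2 + y\<^sup>2 / s"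
proof -
  have "0 \<le> (s * x - y)\<^sup>2 / s" using assms by simp
  then show ?thesis using assms by (simp add: power2_diff field_simps power2_eq_square)
qed

locale corona_poly =
  fixes \<phi> \<psi> h :: "complex poly" and \<epsilon> s :: real
  assumes \<epsilon>: "0 < \<epsilon>" "\<epsilon> \<le> 1" and s: "0 < s"
    and bounds: "\<And>z. cmod z \<le> 1 \<Longrightarrow> cmod (poly \<phi> z) \<le> 2" "\<And>z. cmod z \<le> 1 \<Longrightarrow> cmod (poly \<psi> z) \<le> 2"
    and low: "\<And>z. cmod z \<le> 1 \<Longrightarrow> \<epsilon>\<^sup>2 \<le> (cmod (poly \<phi> z))\<^sup>2 + (cmod (poly \<psi> z))\<^sup>2"
begin

definition v :: "complex \<Rightarrow> real" where "v z = (cmod (poly \<phi> z))\<^sup>2 + (cmod (poly \<psi> z))\<^sup>2"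

text \<open>The complex copy of \<open>v\<close>, in the form whose Wirtinger derivatives are evident.\<close>

definition w :: "complex \<Rightarrow> complex" where "w z = poly \<phi> z * cnj (poly \<phi> z) + poly \<psi> z * cnj (poly \<psi> z)"

definition \<kappa> :: "complex \<Rightarrow> real" where
  "\<kappa> z = sqrt ((cmod (poly (pderiv \<phi>) z))\<^sup>2 + (cmod (poly (pderiv \<psi>) z))\<^sup>2)"

definition wronskian :: "complex poly" where "wronskian = pderiv \<phi> * \<psi> - \<phi> * pderiv \<psi>"

text \<open>The \<open>z\<close>-derivative of \<open>w\<close>; the derivative by \<open>cnj z\<close> is its conjugate, since \<open>w\<close> is real.\<close>

definition dw :: "complex \<Rightarrow> complex" where
  "dw z = poly (pderiv \<phi>) z * cnj (poly \<phi> z) + poly (pderiv \<psi>) z * cnj (poly \<psi> z)"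

lemma w_eq: "w z = of_real (v z)"
  by (simp add: w_def v_def complex_norm_square del: of_real_power)

lemma v_ge: "cmod z \<le> 1 \<Longrightarrow> \<epsilon>\<^sup>2 \<le> v z"
  using low by (simp add: v_def)

lemma v_pos: "cmod z \<le> 1 \<Longrightarrow> v z > 0"
  using v_ge[of z] \<epsilon> by (smt (verit) zero_less_power)

lemma w_nz: "cmod z \<le> 1 \<Longrightarrow> w z \<noteq> 0"
  using v_pos[of z] by (simp add: w_eq)

lemma v_le: "cmod z \<le> 1 \<Longrightarrow> v z \<le> 8"
  using power_mono[OF bounds(1), of z 2] power_mono[OF bounds(2), of z 2]
  by (simp add: v_def)

lemma \<kappa>_nonneg: "\<kappa> z \<ge> 0" by (simp add: \<kappa>_def)

lemma wronskian_bound: "cmod (poly wronskian z) \<le> \<kappa> z * sqrt (v z)"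
  using cmod_cauchy_schwarz2[of "poly (pderiv \<phi>) z" "poly \<psi> z" "poly (pderiv \<psi>) z" "- poly \<phi> z"]
  by (simp add: wronskian_def \<kappa>_def v_def mult.commute add.commute)

lemma dw_bound: "cmod (dw z) \<le> \<kappa> z * sqrt (v z)"
  using cmod_cauchy_schwarz2[of "poly (pderiv \<phi>) z" "cnj (poly \<phi> z)" "poly (pderiv \<psi>) z" "cnj (poly \<psi> z)"]
  by (simp add: dw_def \<kappa>_def v_def)

text \<open>The quantity estimated is the derivative by \<open>cnj z\<close> of \<open>cnj \<phi> / w\<close> divided by \<open>\<psi>\<close>.  The exponent \<open>3\<close>
of \<open>\<epsilon>\<close> that comes out naturally is weakened to \<open>4\<close> to agree with the bound for its derivative.\<close>

lemma dbar_factor_bound: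
  assumes "cmod z \<le> 1" shows "cmod (cnj (poly wronskian z) * (inverse (w z) * inverse (w z))) \<le> \<kappa> z / \<epsilon> ^ 4"
proof -
  note v = v_pos[OF assms]
  have sq: "\<epsilon> \<le> sqrt (v z)" using v_ge[OF assms] by (rule real_le_rsqrt)
  have "\<epsilon> ^ 4 \<le> \<epsilon> ^ 3" using power_decreasing[of 3 4 \<epsilon>] \<epsilon> by simp
  also have "\<epsilon> ^ 3 \<le> sqrt (v z) ^ 3" using sq \<epsilon> by (intro power_mono) auto
  finally have e: "\<epsilon> ^ 4 \<le> sqrt (v z) ^ 3" .
  have "cmod (cnj (poly wronskian z) * (inverse (w z) * inverse (w z))) = cmod (poly wronskian z) / (v z * v z)"
    unfolding w_eq norm_mult norm_inverse norm_of_real using v by (simp add: field_simps)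
  also have "\<dots> \<le> \<kappa> z * sqrt (v z) / (v z * v z)"
    by (intro divide_right_mono wronskian_bound) (use v in auto)
  also have "\<dots> = \<kappa> z / sqrt (v z) ^ 3"
  proof -
    have "v z * v z = sqrt (v z) * sqrt (v z) ^ 3"
      using v real_sqrt_pow2[of "v z"] by (simp add: power2_eq_square power3_eq_cube)
    then show ?thesis using v by simp
  qed
  also have "\<dots> \<le> \<kappa> z / \<epsilon> ^ 4" using e \<epsilon> v \<kappa>_nonneg by (intro divide_left_mono) auto
  finally show ?thesis .
qed

lemma dbar_factor_deriv_bound:
  assumes "cmod z \<le> 1"
  shows "cmod (cnj (poly wronskian z) * (inverse (w z) * inverse (w z)) * (dw z * inverse (w z))) \<le> (\<kappa> z)\<^sup>2 / \<epsilon> ^ 4"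
proof -
  note v = v_pos[OF assms]
  have "cmod (cnj (poly wronskian z) * (inverse (w z) * inverse (w z)) * (dw z * inverse (w z)))
      = cmod (poly wronskian z) * cmod (dw z) / (v z) ^ 3"
    unfolding w_eq norm_mult norm_inverse norm_of_real using v by (simp add: field_simps power3_eq_cube)
  also have "\<dots> \<le> (\<kappa> z * sqrt (v z)) * (\<kappa> z * sqrt (v z)) / (v z) ^ 3"
    using v by (intro divide_right_mono mult_mono wronskian_bound dw_bound) (auto simp: \<kappa>_nonneg)
  also have "\<dots> = (\<kappa> z)\<^sup>2 / (v z)\<^sup>2"
  proof -
    have "(\<kappa> z * sqrt (v z)) * (\<kappa> z * sqrt (v z)) = (\<kappa> z)\<^sup>2 * v z"
      using v by (simp flip: power2_eq_square add: power_mult_distrib)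
    then show ?thesis using v by (simp only:) (simp add: power2_eq_square power3_eq_cube)
  qed
  also have "\<dots> \<le> (\<kappa> z)\<^sup>2 / (\<epsilon>\<^sup>2)\<^sup>2"
    using v_ge[OF assms] \<epsilon> v by (intro divide_left_mono power_mono) auto
  finally show ?thesis by simp
qed

lemma wirtinger_poly: "wirtinger (\<lambda>z. poly f z) (poly (pderiv f) z) 0 z"
  by (rule wirtinger_holomorphic) (rule poly_DERIV)

lemma wirtinger_poly_cnj: "wirtinger (\<lambda>z. cnj (poly f z)) 0 (cnj (poly (pderiv f) z)) z"
  using wirtinger_cnj[OF wirtinger_poly[of f z]] by simp

lemma wirtinger_w: "wirtinger w (dw z) (cnj (dw z)) z"
  unfolding w_def
  by (rule wirtinger_cong[OF wirtinger_add[OF wirtinger_mult[OF wirtinger_poly wirtinger_poly_cnj]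
        wirtinger_mult[OF wirtinger_poly wirtinger_poly_cnj]]]) (simp_all add: dw_def mult.commute)

lemma wirtinger_iw: "cmod z \<le> 1 \<Longrightarrow>
  wirtinger (\<lambda>z. inverse (w z)) (- dw z / (w z)\<^sup>2) (- cnj (dw z) / (w z)\<^sup>2) z"
  by (rule wirtinger_inverse[OF wirtinger_w w_nz])

lemma cont_w [continuous_intros]: "continuous_on A w"
  unfolding w_def by (intro continuous_intros)

lemma cont_dw [continuous_intros]: "continuous_on A dw"
  unfolding dw_def by (intro continuous_intros)

lemma cont_\<kappa> [continuous_intros]: "continuous_on A \<kappa>"
  unfolding \<kappa>_def by (intro continuous_intros)

lemma cont_iw: "continuous_on (cball 0 1) (\<lambda>z. inverse (w z))"
  by (intro continuous_intros) (auto simp: w_nz)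

text \<open>The integrand that Stokes' theorem produces: it is holomorphic up to a single factor that carries the first
derivatives of \<open>\<phi>\<close> and \<open>\<psi>\<close>.\<close>

definition remainder :: "complex poly \<Rightarrow> complex \<Rightarrow> complex" where
  "remainder c z = poly (h * c) z * (cnj (poly wronskian z) * (inverse (w z) * inverse (w z)))"

lemma cont_remainder: "continuous_on (cball 0 1) (remainder c)"
  unfolding remainder_def by (intro continuous_intros cont_iw) (auto simp: w_nz)

text \<open>The corona solutions \<open>f = cnj \<phi> h / w\<close> and \<open>g = cnj \<psi> h / w\<close> satisfy \<open>\<phi> f + \<psi> g = h\<close>, so their
derivatives by \<open>cnj z\<close> are \<open>\<psi> W h\<close> and \<open>- \<phi> W h\<close> for a common \<open>W\<close>, namely
\<open>cnj (\<phi>' \<psi> - \<phi> \<psi>') / w\<^sup>2\<close>.  Therefore the holomorphic functions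
\<open>a\<close> and \<open>b\<close> enter the area integral only through \<open>c = a \<psi> - b \<phi>\<close>.\<close>

lemma disc_integral_dbar:
  fixes a b :: "complex poly"
  defines "c \<equiv> a * \<psi> - b * \<phi>"
  shows "circle_integral (\<lambda>z. z * (poly h z * ((poly a z * cnj (poly \<phi> z) + poly b z * cnj (poly \<psi> z)) * inverse (w z))))
     = 2 * disc_integral (remainder c)"
proof -
  define F where "F = (\<lambda>z. poly h z * ((poly a z * cnj (poly \<phi> z) + poly b z * cnj (poly \<psi> z)) * inverse (w z)))"
  define A where "A = (\<lambda>z. poly (pderiv h) z * ((poly a z * cnj (poly \<phi> z) + poly b z * cnj (poly \<psi> z)) * inverse (w z))
    + poly h z * ((poly (pderiv a) z * cnj (poly \<phi> z) + poly (pderiv b) z * cnj (poly \<psi> z)) * inverse (w z)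
        + (poly a z * cnj (poly \<phi> z) + poly b z * cnj (poly \<psi> z)) * (- dw z / (w z)\<^sup>2)))"
  have "disc_integral (remainder c) = (1 / 2) * circle_integral (\<lambda>z. z * F z)"
  proof (rule stokes_dbar)
    fix z :: complex assume "z \<in> cball 0 1"
    then have z: "cmod z \<le> 1" by simp
    show "wirtinger F (A z) (remainder c z) z"
      unfolding F_def
    proof (rule wirtinger_cong[OF wirtinger_mult[OF wirtinger_poly wirtinger_mult[OF wirtinger_add[OF
              wirtinger_mult[OF wirtinger_poly wirtinger_poly_cnj]
              wirtinger_mult[OF wirtinger_poly wirtinger_poly_cnj]] wirtinger_iw[OF z]]]])
      define f f' g g' where "f = cnj (poly \<phi> z)" and "f' = cnj (poly (pderiv \<phi>) z)"
        and "g = cnj (poly \<psi> z)" and "g' = cnj (poly (pderiv \<psi>) z)"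
      define W where "W = inverse (w z)"
      have W: "w z * W = 1" "- cnj (dw z) / (w z)\<^sup>2 = - cnj (dw z) * (W * W)"
        using w_nz[OF z] by (simp_all add: W_def field_simps power2_eq_square)
      have wz: "w z = poly \<phi> z * f + poly \<psi> z * g" by (simp add: w_def f_def g_def)
      have dw: "cnj (dw z) = f' * poly \<phi> z + g' * poly \<psi> z" by (simp add: dw_def f'_def g'_def)
      have c: "poly c z = poly a z * poly \<psi> z - poly b z * poly \<phi> z" by (simp add: c_def)
      have wronskian: "cnj (poly wronskian z) = f' * g - f * g'" by (simp add: wronskian_def f'_def g'_def f_def g_def)
      have "(poly a z * f' + poly b z * g') * W + (poly a z * f + poly b z * g) * (- cnj (dw z) * (W * W))
          = (poly a z * f' + poly b z * g') * (w z * W) * W + (poly a z * f + poly b z * g) * (- cnj (dw z) * (W * W))"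
        by (simp add: W)
      also have "\<dots> = poly c z * ((f' * g - f * g') * (W * W))"
        unfolding wz dw c by (simp add: algebra_simps)
      finally have eq: "poly h z * ((poly a z * f' + poly b z * g') * W + (poly a z * f + poly b z * g) * (- cnj (dw z) * (W * W)))
          = poly h z * (poly c z * ((f' * g - f * g') * (W * W)))" by (rule arg_cong)
      show "0 * ((poly a z * cnj (poly \<phi> z) + poly b z * cnj (poly \<psi> z)) * inverse (w z)) +
        poly h z * ((0 * cnj (poly \<phi> z) + poly a z * cnj (poly (pderiv \<phi>) z) + (0 * cnj (poly \<psi> z) + poly b z * cnj (poly (pderiv \<psi>) z))) *
          inverse (w z) + (poly a z * cnj (poly \<phi> z) + poly b z * cnj (poly \<psi> z)) * (- cnj (dw z) / (w z)\<^sup>2)) = remainder c z"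
        unfolding remainder_def wronskian W(2) W_def[symmetric] f_def[symmetric] f'_def[symmetric] g_def[symmetric] g'_def[symmetric]
        using eq by simp
    qed (simp add: A_def)
  next
    show "continuous_on (cball 0 1) A"
      unfolding A_def by (intro continuous_intros cont_iw) (auto simp: w_nz)
  qed (rule cont_remainder)
  then have "circle_integral (\<lambda>z. z * F z) = 2 * disc_integral (remainder c)" by (simp add: mult.commute)
  then show ?thesis by (simp only: F_def)
qed

text \<open>A pointwise majorant in which \<open>h\<close> and \<open>c\<close> are already separated, with weights \<open>s\<close> and \<open>1 / s\<close>.\<close>

definition amgm_bound :: "complex poly \<Rightarrow> complex \<Rightarrow> real" where
  "amgm_bound c z = (1 / \<epsilon> ^ 4) * (s * ((cmod (poly h z))\<^sup>2 + (cmod (poly (pderiv h) z))\<^sup>2 + 2 * ((\<kappa> z)\<^sup>2 * (cmod (poly h z))\<^sup>2))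
      + (1 / s) * ((cmod (poly (pderiv c) z))\<^sup>2 + 3 * ((\<kappa> z)\<^sup>2 * (cmod (poly c z))\<^sup>2)))"

text \<open>After the weight \<open>1 - \<bar>z\<bar>\<^sup>2\<close> has been gained, each term is a product of one of \<open>h\<close>,
\<open>h'\<close>, \<open>\<kappa> h\<close> and one of \<open>c'\<close>, \<open>\<kappa> c\<close>, and each of these has a weighted area norm bounded by the
Hardy norm of \<open>h\<close> or \<open>c\<close>.\<close>

lemma disc_integral_remainder_le:
  "cmod (disc_integral (remainder c)) \<le> disc_integral (\<lambda>z. (1 - (cmod z)\<^sup>2) * amgm_bound c z)"
proof -
  define W where "W = (\<lambda>z. cnj (poly wronskian z) * (inverse (w z) * inverse (w z)))"
  define W' where "W' = (\<lambda>z. W z * (dw z * inverse (w z)))"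
  define A where "A = (\<lambda>z. poly (pderiv (h * c)) z * W z - 2 * (poly (h * c) z * W' z))"
  define B where "B = (\<lambda>z. poly (h * c) z * (cnj (poly (pderiv wronskian) z) * (inverse (w z) * inverse (w z)) +
      cnj (poly wronskian z) * (- cnj (dw z) / (w z)\<^sup>2 * inverse (w z) + inverse (w z) * (- cnj (dw z) / (w z)\<^sup>2))))"
  have cW: "continuous_on (cball 0 1) W"
    unfolding W_def by (intro continuous_intros cont_iw) (auto simp: w_nz)
  have cA: "continuous_on (cball 0 1) A"
    unfolding A_def W'_def by (intro continuous_intros cont_iw cW) (auto simp: w_nz)
  have "disc_integral (remainder c) = disc_integral (\<lambda>z. of_real (1 - (cmod z)\<^sup>2) * (2 * remainder c z + z * A z))"
  proof (rule disc_integral_weighted[where b = B])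
    fix z :: complex assume "z \<in> cball 0 1"
    then have z: "cmod z \<le> 1" by simp
    show "wirtinger (remainder c) (A z) (B z) z"
      unfolding remainder_def
      by (rule wirtinger_cong[OF wirtinger_mult[OF wirtinger_poly wirtinger_mult[OF wirtinger_poly_cnj
            wirtinger_mult[OF wirtinger_iw[OF z] wirtinger_iw[OF z]]]]])
        (simp_all add: A_def B_def W'_def W_def w_nz[OF z] field_simps power2_eq_square)
  next
    show "continuous_on (cball 0 1) A" by (rule cA)
    show "continuous_on (cball 0 1) B"
      unfolding B_def by (intro continuous_intros cont_iw) (auto simp: w_nz)
  qed
  also have "cmod \<dots> \<le> disc_integral (\<lambda>z. (1 - (cmod z)\<^sup>2) * amgm_bound c z)"
  proof (rule norm_disc_integral_le)
    fix z :: complex assume "z \<in> cball 0 1"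
    then have z: "cmod z \<le> 1" by simp
    define X Y C C' k e where "X = cmod (poly h z)" and "Y = cmod (poly (pderiv h) z)"
      and "C = cmod (poly c z)" and "C' = cmod (poly (pderiv c) z)" and "k = \<kappa> z" and "e = 1 / \<epsilon> ^ 4"
    have nn: "X \<ge> 0" "Y \<ge> 0" "C \<ge> 0" "C' \<ge> 0" "k \<ge> 0" "e > 0"
      using \<epsilon> by (auto simp: X_def Y_def C_def C'_def k_def e_def \<kappa>_nonneg)
    have W: "cmod (W z) \<le> e * k" and W': "cmod (W' z) \<le> e * k\<^sup>2"
      using dbar_factor_bound[OF z] dbar_factor_deriv_bound[OF z] by (simp_all add: W_def W'_def k_def e_def)
    have remainder: "cmod (remainder c z) \<le> X * C * (e * k)"
      unfolding remainder_def norm_mult poly_mult X_def C_def using W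
      by (intro mult_left_mono) (auto simp: W_def norm_mult)
    have "cmod (A z) \<le> cmod (poly (pderiv (h * c)) z) * cmod (W z) + 2 * (X * C * cmod (W' z))"
      unfolding A_def using norm_triangle_ineq4[of "poly (pderiv (h * c)) z * W z" "2 * (poly (h * c) z * W' z)"]
      by (simp add: norm_mult X_def C_def)
    also have "cmod (poly (pderiv (h * c)) z) \<le> X * C' + Y * C"
      using norm_triangle_ineq[of "poly c z * poly (pderiv h) z" "poly h z * poly (pderiv c) z"]
      by (simp add: pderiv_mult norm_mult X_def Y_def C_def C'_def mult.commute add.commute)
    finally have "cmod (A z) \<le> (X * C' + Y * C) * cmod (W z) + 2 * (X * C * cmod (W' z))"
      by (simp add: mult_right_mono)
    also have "\<dots> \<le> (X * C' + Y * C) * (e * k) + 2 * (X * C * (e * k\<^sup>2))"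
      using nn by (intro add_mono mult_left_mono W W') auto
    finally have A: "cmod (A z) \<le> (X * C' + Y * C) * (e * k) + 2 * (X * C * (e * k\<^sup>2))" .
    have "cmod (2 * remainder c z + z * A z) \<le> 2 * cmod (remainder c z) + cmod z * cmod (A z)"
      using norm_triangle_ineq[of "2 * remainder c z" "z * A z"] by (simp add: norm_mult)
    also have "\<dots> \<le> 2 * cmod (remainder c z) + 1 * cmod (A z)"
      using z by (intro add_left_mono mult_right_mono) auto
    also have "\<dots> \<le> 2 * (X * C * (e * k)) + ((X * C' + Y * C) * (e * k) + 2 * (X * C * (e * k\<^sup>2)))"
      using remainder A by simp
    also have "\<dots> = e * (2 * (X * (k * C)) + (k * X) * C' + Y * (k * C) + 2 * ((k * X) * (k * C)))"
      by (simp add: algebra_simps power2_eq_square)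
    also have "\<dots> \<le> e * (s * (X\<^sup>2 + Y\<^sup>2 + 2 * (k\<^sup>2 * X\<^sup>2)) + (1 / s) * (C'\<^sup>2 + 3 * (k\<^sup>2 * C\<^sup>2)))"
    proof (intro mult_left_mono)
      have m: "x * y \<le> s * x\<^sup>2 + y\<^sup>2 / s" if "x \<ge> 0" "y \<ge> 0" for x y :: real
        using weighted_amgm[OF s, of x y] that mult_nonneg_nonneg[OF that] by linarith
      have "2 * (X * (k * C)) + (k * X) * C' + Y * (k * C) + 2 * ((k * X) * (k * C))
        \<le> (s * X\<^sup>2 + (k * C)\<^sup>2 / s) + (s * (k * X)\<^sup>2 + C'\<^sup>2 / s) + (s * Y\<^sup>2 + (k * C)\<^sup>2 / s)
          + (s * (k * X)\<^sup>2 + (k * C)\<^sup>2 / s)"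
        using nn by (intro add_mono weighted_amgm s m) auto
      also have "\<dots> = s * (X\<^sup>2 + Y\<^sup>2 + 2 * (k\<^sup>2 * X\<^sup>2)) + (1 / s) * (C'\<^sup>2 + 3 * (k\<^sup>2 * C\<^sup>2))"
        using s by (simp add: field_simps power_mult_distrib)
      finally show "2 * (X * (k * C)) + (k * X) * C' + Y * (k * C) + 2 * ((k * X) * (k * C))
        \<le> s * (X\<^sup>2 + Y\<^sup>2 + 2 * (k\<^sup>2 * X\<^sup>2)) + (1 / s) * (C'\<^sup>2 + 3 * (k\<^sup>2 * C\<^sup>2))" .
    qed (use nn in auto)
    also have "\<dots> = amgm_bound c z"
      by (simp add: amgm_bound_def X_def Y_def C_def C'_def k_def e_def)
    finally have "cmod (2 * remainder c z + z * A z) \<le> amgm_bound c z" .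
    moreover have "0 \<le> 1 - (cmod z)\<^sup>2" using z by (simp add: abs_square_le_1)
    ultimately show "cmod (of_real (1 - (cmod z)\<^sup>2) * (2 * remainder c z + z * A z)) \<le> (1 - (cmod z)\<^sup>2) * amgm_bound c z"
      unfolding norm_mult norm_of_real by (simp add: mult_left_mono)
  next
    show "continuous_on (cball 0 1) (\<lambda>z. complex_of_real (1 - (cmod z)\<^sup>2) * (2 * remainder c z + z * A z))"
      by (intro continuous_intros cA cont_remainder)
    show "continuous_on (cball 0 1) (\<lambda>z. (1 - (cmod z)\<^sup>2) * amgm_bound c z)"
      unfolding amgm_bound_def by (intro continuous_intros)
  qed
  finally show ?thesis .
qed

lemma disc_integral_amgm_bound:
  "disc_integral (\<lambda>z. (1 - (cmod z)\<^sup>2) * amgm_bound c z)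
     \<le> (pi / \<epsilon> ^ 4) * (66 * s * poly_norm2 h + 97 / s * poly_norm2 c)"
proof -
  define L where "L = (\<lambda>F :: complex \<Rightarrow> real. disc_integral (\<lambda>z. (1 - (cmod z)\<^sup>2) * F z))"
  have L_add: "L (\<lambda>z. F z + F' z) = L F + L F'"
    if "continuous_on (cball 0 1) F" "continuous_on (cball 0 1) F'" for F F'
    unfolding L_def distrib_left by (rule disc_integral_add) (intro continuous_intros that)+
  have L_cmult: "L (\<lambda>z. k * F z) = k * L F" for k F
    unfolding L_def mult.left_commute[of _ k] by (rule disc_integral_cmult)
  have \<kappa>2: "(\<kappa> z)\<^sup>2 * t = (cmod (poly (pderiv \<phi>) z))\<^sup>2 * t + (cmod (poly (pderiv \<psi>) z))\<^sup>2 * t" for z t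
    by (simp add: \<kappa>_def algebra_simps)
  have 1: "L (\<lambda>z. (cmod (poly f z))\<^sup>2) \<le> pi * poly_norm2 f" for f
    unfolding L_def by (rule weighted_disc_integral_poly_le)
  have 2: "L (\<lambda>z. (cmod (poly (pderiv f) z))\<^sup>2) \<le> pi * poly_norm2 f" for f
    unfolding L_def by (rule littlewood_paley_poly)
  have 3: "L (\<lambda>z. (\<kappa> z)\<^sup>2 * (cmod (poly f z))\<^sup>2) \<le> 32 * pi * poly_norm2 f" for f
  proof -
    have "L (\<lambda>z. (\<kappa> z)\<^sup>2 * (cmod (poly f z))\<^sup>2)
       = L (\<lambda>z. (cmod (poly (pderiv \<phi>) z))\<^sup>2 * (cmod (poly f z))\<^sup>2) + L (\<lambda>z. (cmod (poly (pderiv \<psi>) z))\<^sup>2 * (cmod (poly f z))\<^sup>2)"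
      unfolding \<kappa>2 by (rule L_add) (intro continuous_intros)+
    also have "\<dots> \<le> 4 * 2\<^sup>2 * pi * poly_norm2 f + 4 * 2\<^sup>2 * pi * poly_norm2 f"
      unfolding L_def by (intro add_mono carleson_embedding_poly bounds)
    finally show ?thesis by simp
  qed
  have "disc_integral (\<lambda>z. (1 - (cmod z)\<^sup>2) * amgm_bound c z) = L (amgm_bound c)" by (simp add: L_def)
  also have "\<dots> = (1 / \<epsilon> ^ 4) * (s * (L (\<lambda>z. (cmod (poly h z))\<^sup>2) + L (\<lambda>z. (cmod (poly (pderiv h) z))\<^sup>2)
         + 2 * L (\<lambda>z. (\<kappa> z)\<^sup>2 * (cmod (poly h z))\<^sup>2))
      + (1 / s) * (L (\<lambda>z. (cmod (poly (pderiv c) z))\<^sup>2) + 3 * L (\<lambda>z. (\<kappa> z)\<^sup>2 * (cmod (poly c z))\<^sup>2)))"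
    unfolding amgm_bound_def
    by (simp only: L_cmult L_add continuous_intros)
  also have "\<dots> \<le> (1 / \<epsilon> ^ 4) * (s * (pi * poly_norm2 h + pi * poly_norm2 h + 2 * (32 * pi * poly_norm2 h))
      + (1 / s) * (pi * poly_norm2 c + 3 * (32 * pi * poly_norm2 c)))"
    using \<epsilon> s by (intro mult_left_mono add_mono 1 2 3) auto
  also have "\<dots> = (pi / \<epsilon> ^ 4) * (66 * s * poly_norm2 h + 97 / s * poly_norm2 c)"
    using \<epsilon> s by (simp add: field_simps)
  finally show ?thesis .
qed

text \<open>The hypotheses say that \<open>p\<close> and \<open>z a\<close> are the holomorphic and the conjugated antiholomorphic part of
\<open>cnj \<phi> h\<close> on the circle, and similarly for \<open>q\<close>, \<open>b\<close> and \<open>\<psi>\<close>.  Pairing \<open>h\<close> with itself through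
\<open>h = \<phi> f + \<psi> g\<close> gives a part with \<open>p\<close> and \<open>q\<close>, which is harmless, and a part with \<open>a\<close> and \<open>b\<close>, which
becomes the area integral of the remainder for \<open>c = a \<psi> - b \<phi>\<close>.  The point is that on the circle
\<open>z c = \<phi> cnj q - \<psi> cnj p\<close>, so \<open>c\<close> is controlled by \<open>p\<close> and \<open>q\<close> although \<open>a\<close> and \<open>b\<close> are not.\<close>

lemma poly_norm2_bound:
  fixes p q a b :: "complex poly"
  assumes p: "\<And>z. cmod z = 1 \<Longrightarrow> cnj (poly \<phi> z) * poly h z = poly p z + cnj (z * poly a z)"
    and q: "\<And>z. cmod z = 1 \<Longrightarrow> cnj (poly \<psi> z) * poly h z = poly q z + cnj (z * poly b z)"
  shows "poly_norm2 h \<le> (1 / \<epsilon> ^ 4) * (67 * s * poly_norm2 h + 777 / s * (poly_norm2 p + poly_norm2 q))"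
proof -
  define c where "c = a * \<psi> - b * \<phi>"
  define M where "M = poly_norm2 p + poly_norm2 q"
  define F where "F = (\<lambda>z. z * (poly h z * ((poly a z * cnj (poly \<phi> z) + poly b z * cnj (poly \<psi> z)) * inverse (w z))))"
  define H where "H = (\<lambda>z. (cnj (poly p z) * cnj (poly \<phi> z) + cnj (poly q z) * cnj (poly \<psi> z)) * (poly h z * inverse (w z)))"
  have p': "cnj (poly p z) = poly \<phi> z * cnj (poly h z) - z * poly a z" if "cmod z = 1" for z
    using arg_cong[OF p[OF that], of cnj] by (simp add: algebra_simps)
  have q': "cnj (poly q z) = poly \<psi> z * cnj (poly h z) - z * poly b z" if "cmod z = 1" for z
    using arg_cong[OF q[OF that], of cnj] by (simp add: algebra_simps)
  have Mi: "((\<lambda>t. (cmod (poly p (cis t)))\<^sup>2 + (cmod (poly q (cis t)))\<^sup>2) has_integral 2 * pi * M) {0..2 * pi}"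
    unfolding M_def distrib_left by (intro has_integral_add parseval_poly)
  \<comment> \<open>The identity \<open>z c = \<phi> cnj q - \<psi> cnj p\<close> holds on the circle only; it is what brings \<open>p\<close> and \<open>q\<close> in.\<close>
  have Nc: "poly_norm2 c \<le> 8 * M"
  proof -
    have "2 * pi * poly_norm2 c \<le> 8 * (2 * pi * M)"
    proof (rule has_integral_le[OF parseval_poly has_integral_mult_right[OF Mi]])
      fix t
      define z where "z = cis t"
      have z: "cmod z = 1" by (simp add: z_def)
      have "cmod (poly c z) = cmod (z * poly c z)" by (simp add: norm_mult z)
      also have "z * poly c z = cnj (poly q z) * poly \<phi> z + cnj (poly p z) * (- poly \<psi> z)"
        unfolding p'[OF z] q'[OF z] c_def by (simp add: algebra_simps)
      also have "cmod \<dots> \<le> sqrt ((cmod (poly q z))\<^sup>2 + (cmod (poly p z))\<^sup>2) * sqrt (v z)"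
        using cmod_cauchy_schwarz2[of "cnj (poly q z)" "poly \<phi> z" "cnj (poly p z)" "- poly \<psi> z"]
        by (simp add: v_def)
      finally have "(cmod (poly c z))\<^sup>2 \<le> (sqrt ((cmod (poly q z))\<^sup>2 + (cmod (poly p z))\<^sup>2) * sqrt (v z))\<^sup>2"
        by (rule power_mono) simp
      also have "\<dots> = v z * ((cmod (poly p z))\<^sup>2 + (cmod (poly q z))\<^sup>2)"
        using v_pos[of z] z by (simp add: power_mult_distrib)
      also have "\<dots> \<le> 8 * ((cmod (poly p z))\<^sup>2 + (cmod (poly q z))\<^sup>2)"
        using v_le[of z] z by (intro mult_right_mono) auto
      finally show "(cmod (poly c (cis t)))\<^sup>2 \<le> 8 * ((cmod (poly p (cis t)))\<^sup>2 + (cmod (poly q (cis t)))\<^sup>2)"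
        by (simp add: z_def)
    qed
    then have "2 * pi * poly_norm2 c \<le> 2 * pi * (8 * M)" by (simp add: mult_ac)
    then show ?thesis by (rule mult_left_le_imp_le) simp
  qed
  have cH: "continuous_on {0..2 * pi} (\<lambda>t. H (cis t))" and cF: "continuous_on {0..2 * pi} (\<lambda>t. F (cis t))"
    unfolding H_def F_def w_def by (intro continuous_intros; simp add: w_def[symmetric] w_nz)+
  have split: "of_real ((cmod (poly h z))\<^sup>2) = H z + F z" if z: "cmod z = 1" for z
  proof -
    have "w z * inverse (w z) = 1" using w_nz[of z] z by simp
    then have "of_real ((cmod (poly h z))\<^sup>2) = poly h z * cnj (poly h z) * (w z * inverse (w z))"
      by (simp add: complex_norm_square del: of_real_power)
    also have "\<dots> = H z + F z"
      unfolding H_def F_def p'[OF z] q'[OF z] by (simp add: w_def algebra_simps)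
    finally show ?thesis .
  qed
  have "complex_of_real (2 * pi * poly_norm2 h) = circle_integral (\<lambda>z. of_real ((cmod (poly h z))\<^sup>2))"
    unfolding circle_integral_def
    by (rule integral_unique[symmetric], rule has_integral_of_real[OF parseval_poly])
  also have "\<dots> = circle_integral (\<lambda>z. H z + F z)"
    unfolding circle_integral_def by (rule Henstock_Kurzweil_Integration.integral_cong) (rule split, simp)
  also have "\<dots> = circle_integral H + circle_integral F"
    unfolding circle_integral_def
    by (intro Henstock_Kurzweil_Integration.integral_add integrable_continuous_interval cH cF)
  finally have "2 * pi * poly_norm2 h = cmod (circle_integral H + circle_integral F)"
    by (metis abs_of_nonneg norm_of_real mult_nonneg_nonneg pi_ge_zero zero_le_numeral zero_le_power2)
  also have "\<dots> \<le> cmod (circle_integral H) + cmod (circle_integral F)"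
    by (rule norm_triangle_ineq)
  also have "cmod (circle_integral H) \<le> integral {0..2 * pi} (\<lambda>t. (1 / \<epsilon> ^ 4) * (s * (cmod (poly h (cis t)))\<^sup>2
        + (1 / s) * ((cmod (poly p (cis t)))\<^sup>2 + (cmod (poly q (cis t)))\<^sup>2)))"
    unfolding circle_integral_def
  proof (rule integral_norm_bound_integral)
    fix t
    define z where "z = cis t"
    have z: "cmod z = 1" by (simp add: z_def)
    have v: "v z > 0" "\<epsilon> \<le> sqrt (v z)"
      using v_pos[of z] v_ge[of z] z by (auto intro: real_le_rsqrt)
    define m where "m = sqrt ((cmod (poly p z))\<^sup>2 + (cmod (poly q z))\<^sup>2)"
    have m: "m \<ge> 0" by (simp add: m_def)
    have "cmod (H z) \<le> m * sqrt (v z) * (cmod (poly h z) / v z)"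
      unfolding H_def norm_mult w_eq norm_inverse norm_of_real
      using cmod_cauchy_schwarz2[of "cnj (poly p z)" "cnj (poly \<phi> z)" "cnj (poly q z)" "cnj (poly \<psi> z)"] v(1)
      by (intro mult_mono) (auto simp: m_def v_def[symmetric] w_eq norm_inverse field_simps)
    also have "\<dots> = (cmod (poly h z) * m) / sqrt (v z)"
      using v(1) real_div_sqrt[of "v z"] by (simp add: field_simps)
    also have "\<dots> \<le> (cmod (poly h z) * m) / \<epsilon> ^ 4"
    proof (rule divide_left_mono)
      show "\<epsilon> ^ 4 \<le> sqrt (v z)" using power_decreasing[of 1 4 \<epsilon>] \<epsilon> v(2) by simp
    qed (use m \<epsilon> v in auto)
    also have "\<dots> \<le> (1 / \<epsilon> ^ 4) * (s * (cmod (poly h z))\<^sup>2 + m\<^sup>2 / s)"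
    proof -
      have "cmod (poly h z) * m \<le> s * (cmod (poly h z))\<^sup>2 + m\<^sup>2 / s"
        using weighted_amgm[OF s, of "cmod (poly h z)" m] mult_nonneg_nonneg[OF norm_ge_zero m, of "poly h z"]
        by linarith
      then show ?thesis using \<epsilon> by (simp add: divide_right_mono)
    qed
    finally show "cmod (H (cis t)) \<le> (1 / \<epsilon> ^ 4) * (s * (cmod (poly h (cis t)))\<^sup>2
        + (1 / s) * ((cmod (poly p (cis t)))\<^sup>2 + (cmod (poly q (cis t)))\<^sup>2))"
      by (simp add: z_def m_def)
  qed (intro integrable_continuous_interval cH continuous_intros)+
  also have "\<dots> = (1 / \<epsilon> ^ 4) * (s * (2 * pi * poly_norm2 h) + (1 / s) * (2 * pi * M))"
    by (rule integral_unique) (intro has_integral_mult_right has_integral_add parseval_poly Mi)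
  also have "cmod (circle_integral F) \<le> 2 * ((pi / \<epsilon> ^ 4) * (66 * s * poly_norm2 h + 97 / s * (8 * M)))"
  proof -
    have "cmod (circle_integral F) = 2 * cmod (disc_integral (remainder c))"
      unfolding F_def disc_integral_dbar c_def by (simp add: norm_mult)
    also have "\<dots> \<le> 2 * ((pi / \<epsilon> ^ 4) * (66 * s * poly_norm2 h + 97 / s * poly_norm2 c))"
      using disc_integral_remainder_le[of c] disc_integral_amgm_bound[of c] by simp
    also have "\<dots> \<le> 2 * ((pi / \<epsilon> ^ 4) * (66 * s * poly_norm2 h + 97 / s * (8 * M)))"
      using \<epsilon> s Nc by (intro mult_left_mono add_left_mono) auto
    finally show ?thesis .
  qed
  also have "(1 / \<epsilon> ^ 4) * (s * (2 * pi * poly_norm2 h) + (1 / s) * (2 * pi * M))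
      + 2 * ((pi / \<epsilon> ^ 4) * (66 * s * poly_norm2 h + 97 / s * (8 * M)))
      = 2 * pi * ((1 / \<epsilon> ^ 4) * (67 * s * poly_norm2 h + 777 / s * M))"
    using \<epsilon> s by (simp add: field_simps)
  finally have "2 * pi * poly_norm2 h \<le> 2 * pi * ((1 / \<epsilon> ^ 4) * (67 * s * poly_norm2 h + 777 / s * M))" by simp
  then show ?thesis unfolding M_def by (rule mult_left_le_imp_le) simp
qed

end

text \<open>The preceding bound has \<open>\<parallel>h\<parallel>\<^sup>2\<close> on both sides; the choice \<open>s = \<epsilon>\<^sup>4 / 134\<close> makes its coefficient on the right
equal to \<open>1 / 2\<close>.\<close>

lemma corona_polynomial:
  fixes \<phi> \<psi> h p q a b :: "complex poly"
  assumes "0 < \<epsilon>" "\<epsilon> \<le> 1"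
    and "\<And>z. cmod z \<le> 1 \<Longrightarrow> cmod (poly \<phi> z) \<le> 2" "\<And>z. cmod z \<le> 1 \<Longrightarrow> cmod (poly \<psi> z) \<le> 2"
    and "\<And>z. cmod z \<le> 1 \<Longrightarrow> \<epsilon>\<^sup>2 \<le> (cmod (poly \<phi> z))\<^sup>2 + (cmod (poly \<psi> z))\<^sup>2"
    and p: "\<And>z. cmod z = 1 \<Longrightarrow> cnj (poly \<phi> z) * poly h z = poly p z + cnj (z * poly a z)"
    and q: "\<And>z. cmod z = 1 \<Longrightarrow> cnj (poly \<psi> z) * poly h z = poly q z + cnj (z * poly b z)"
  shows "poly_norm2 h \<le> 300000 / \<epsilon> ^ 8 * (poly_norm2 p + poly_norm2 q)"
proof -
  interpret corona_poly \<phi> \<psi> h \<epsilon> "\<epsilon> ^ 4 / 134"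
    by standard (use assms in auto)
  define T where "T = 1 / \<epsilon> ^ 8 * (poly_norm2 p + poly_norm2 q)"
  have "T \<ge> 0" using assms(1) by (simp add: T_def)
  have "poly_norm2 h \<le> (1 / \<epsilon> ^ 4) * (67 * (\<epsilon> ^ 4 / 134) * poly_norm2 h + 777 / (\<epsilon> ^ 4 / 134) * (poly_norm2 p + poly_norm2 q))"
    by (rule poly_norm2_bound[OF p q])
  also have "\<dots> = poly_norm2 h / 2 + 104118 * T"
    using assms(1) power_add[of \<epsilon> 4 4] unfolding T_def by (simp add: field_simps)
  finally have "poly_norm2 h \<le> 300000 * T" using \<open>T \<ge> 0\<close> by simp
  then show ?thesis by (simp add: T_def)
qed

section \<open>Isometric multipliers, their adjoints and conjugations\<close>

text \<open>Acting isometrically on the Hardy space characterizes the inner functions among the bounded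
holomorphic ones, and in this form closure under products is evident.\<close>

definition isometric_multiplier :: "complex fps \<Rightarrow> bool" where
  "isometric_multiplier \<theta> \<longleftrightarrow> (\<forall>f\<in>hardy2. \<theta> * f \<in> hardy2 \<and> hardy_norm (\<theta> * f) = hardy_norm f)"

lemma multiplierD:
  assumes "isometric_multiplier \<theta>" "f \<in> hardy2"
  shows "\<theta> * f \<in> hardy2" "hardy_norm (\<theta> * f) = hardy_norm f"
  using assms by (auto simp: isometric_multiplier_def)

lemma multiplier_in_hardy2: "isometric_multiplier \<theta> \<Longrightarrow> \<theta> \<in> hardy2"
  using multiplierD(1)[of \<theta> 1] by simp

lemma isometric_multiplier_1 [simp]: "isometric_multiplier 1"
  by (simp add: isometric_multiplier_def)

lemma isometric_multiplier_mult:
  "isometric_multiplier \<theta> \<Longrightarrow> isometric_multiplier \<beta> \<Longrightarrow> isometric_multiplier (\<theta> * \<beta>)"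
  by (simp add: isometric_multiplier_def mult.assoc)

lemma multiplier_prod:
  "(\<And>i. i \<in> I \<Longrightarrow> isometric_multiplier (\<theta> i)) \<Longrightarrow> isometric_multiplier (\<Prod>i\<in>I. \<theta> i)"
  by (induction I rule: infinite_finite_induct) (auto intro: isometric_multiplier_mult)

text \<open>Polarization, in a form that transfers an inner product from one pair of vectors to another.\<close>

lemma hardy_inner_eq_by_norms:
  assumes h: "f \<in> hardy2" "g \<in> hardy2" "f' \<in> hardy2" "g' \<in> hardy2"
    and "\<And>c. hardy_norm (fps_const c * f + g) = hardy_norm (fps_const c * f' + g')"
    and n: "hardy_norm f = hardy_norm f'" "hardy_norm g = hardy_norm g'"
  shows "hardy_inner f g = hardy_inner f' g'"
proof -
  have R: "Re (c * hardy_inner f g) = Re (c * hardy_inner f' g')" for c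
    using arg_cong[OF assms(5)[of c], of "\<lambda>x. x\<^sup>2"] n h
    by (simp add: hardy_norm_add_sq hardy2_const_mult hardy_norm_const_mult hardy_inner_const_left)
  show ?thesis using R[of 1] R[of "\<i>"] by (simp add: complex_eq_iff)
qed

lemma multiplier_inner:
  assumes \<theta>: "isometric_multiplier \<theta>" and f: "f \<in> hardy2" and g: "g \<in> hardy2"
  shows "hardy_inner (\<theta> * f) (\<theta> * g) = hardy_inner f g"
proof (rule hardy_inner_eq_by_norms)
  fix c
  have "fps_const c * (\<theta> * f) + \<theta> * g = \<theta> * (fps_const c * f + g)" by (simp add: algebra_simps)
  then show "hardy_norm (fps_const c * (\<theta> * f) + \<theta> * g) = hardy_norm (fps_const c * f + g)"
    using multiplierD(2)[OF \<theta>, of "fps_const c * f + g"] f g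
    by (simp add: hardy2_add hardy2_const_mult)
qed (use multiplierD[OF \<theta>] f g in auto)

lemma cutoff_eq_poly: "\<exists>p. fps_cutoff N f = fps_of_poly p" for f :: "complex fps"
  by (rule exI[of _ "\<Sum>k<N. monom (fps_nth f k) k"])
    (simp add: cutoff_eq_sum fps_of_poly_sum fps_of_poly_monom)

text \<open>A coefficient of \<open>\<theta> f\<close> depends on finitely many coefficients of \<open>f\<close>, so boundedness passes to all \<open>f\<close>
by Fatou's lemma; then the isometry extends by density.\<close>

lemma isometric_multiplier_by_polys:
  assumes p: "\<And>p. \<theta> * fps_of_poly p \<in> hardy2 \<and> hardy_norm (\<theta> * fps_of_poly p) = hardy_norm (fps_of_poly p)"
  shows "isometric_multiplier \<theta>"
  unfolding isometric_multiplier_def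
proof (intro ballI)
  have cut: "\<theta> * fps_cutoff N f \<in> hardy2" "hardy_norm (\<theta> * fps_cutoff N f) = hardy_norm (fps_cutoff N f)" for N f
    using p cutoff_eq_poly[of N f] by auto
  have contr: "\<theta> * f \<in> hardy2 \<and> hardy_norm (\<theta> * f) \<le> hardy_norm f" if f: "f \<in> hardy2" for f
  proof -
    have "hardy_norm (fps_cutoff N (\<theta> * f)) \<le> hardy_norm f" for N
    proof -
      have "fps_cutoff N (\<theta> * f) = fps_cutoff N (\<theta> * fps_cutoff N f)"
        by (rule fps_ext) (simp add: fps_cutoff_right_mult_nth)
      then have "hardy_norm (fps_cutoff N (\<theta> * f)) \<le> hardy_norm (\<theta> * fps_cutoff N f)"
        using hardy_norm_cutoff_le[OF cut(1)[of N f], of N] by (simp only:)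
      also have "\<dots> \<le> hardy_norm f" by (simp add: cut hardy_norm_cutoff_le f)
      finally show ?thesis .
    qed
    from hardy2_by_cutoffs[OF this] show ?thesis by auto
  qed
  fix f :: "complex fps" assume f: "f \<in> hardy2"
  have "(\<lambda>N. hardy_norm (\<theta> * fps_cutoff N f)) \<longlonglongrightarrow> hardy_norm (\<theta> * f)"
  proof (rule hardy_norm_tendsto)
    have "\<theta> * fps_cutoff N f - \<theta> * f = \<theta> * (fps_cutoff N f - f)" for N by (simp add: algebra_simps)
    then have "0 \<le> hardy_norm (\<theta> * fps_cutoff N f - \<theta> * f)"
      "hardy_norm (\<theta> * fps_cutoff N f - \<theta> * f) \<le> hardy_norm (fps_cutoff N f - f)" for N
      using contr[of "fps_cutoff N f - f"] f by (auto simp: hardy2_diff)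
    then show "(\<lambda>N. hardy_norm (\<theta> * fps_cutoff N f - \<theta> * f)) \<longlonglongrightarrow> 0"
      by (intro tendsto_sandwich[OF _ _ tendsto_const hardy_cutoff_tendsto[OF f]] always_eventually allI)
  qed (use contr f cut in auto)
  moreover have "(\<lambda>N. hardy_norm (\<theta> * fps_cutoff N f)) \<longlonglongrightarrow> hardy_norm f"
    unfolding cut by (rule hardy_norm_tendsto[OF f _ hardy_cutoff_tendsto[OF f]]) auto
  ultimately show "\<theta> * f \<in> hardy2 \<and> hardy_norm (\<theta> * f) = hardy_norm f"
    using LIMSEQ_unique contr[OF f] by blast
qed

text \<open>The co-analytic Toeplitz operator with symbol \<open>cnj \<theta>\<close>, given by its coefficients.\<close>

definition adj :: "complex fps \<Rightarrow> complex fps \<Rightarrow> complex fps" where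
  "adj \<theta> h = Abs_fps (\<lambda>k. hardy_inner h (fps_X ^ k * \<theta>))"

lemma adj_nth [simp]: "fps_nth (adj \<theta> h) k = hardy_inner h (fps_X ^ k * \<theta>)"
  by (simp add: adj_def)

lemma hardy_inner_mult_cutoff:
  assumes "isometric_multiplier \<theta>" "h \<in> hardy2"
  shows "hardy_inner h (\<theta> * fps_cutoff N g) = (\<Sum>k<N. fps_nth (adj \<theta> h) k * cnj (fps_nth g k))"
proof -
  have \<theta>: "\<theta> \<in> hardy2" by (rule multiplier_in_hardy2[OF assms(1)])
  have "\<theta> * fps_cutoff N g = (\<Sum>k<N. fps_const (fps_nth g k) * (fps_X ^ k * \<theta>))"
    by (simp add: cutoff_eq_sum sum_distrib_left mult_ac)
  then show ?thesis
    using assms(2) \<theta>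
    by (simp add: hardy_inner_sum_right hardy2_const_mult hardy2_X_power_mult hardy_inner_const_right mult.commute[of "hardy_inner _ _"])
qed

text \<open>Bessel's inequality for the orthonormal family \<open>fps_X ^ k * \<theta>\<close>.\<close>

lemma adj_contraction:
  assumes "isometric_multiplier \<theta>" "h \<in> hardy2"
  shows "adj \<theta> h \<in> hardy2" "hardy_norm (adj \<theta> h) \<le> hardy_norm h"
proof -
  have "hardy_norm (fps_cutoff N (adj \<theta> h)) \<le> hardy_norm h" for N
  proof -
    let ?g = "fps_cutoff N (adj \<theta> h)"
    have "complex_of_real ((hardy_norm ?g)\<^sup>2) = hardy_inner h (\<theta> * ?g)"
      unfolding hardy_norm_cutoff_sq hardy_inner_mult_cutoff[OF assms]
      by (simp add: complex_norm_square del: of_real_power)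
    then have "(hardy_norm ?g)\<^sup>2 = cmod (hardy_inner h (\<theta> * ?g))"
      by (metis abs_of_nonneg norm_of_real zero_le_power2)
    also have "\<dots> \<le> hardy_norm h * hardy_norm (\<theta> * ?g)"
      using multiplierD[OF assms(1), of ?g] assms(2) by (intro hardy_inner_bound) auto
    also have "\<dots> = hardy_norm h * hardy_norm ?g"
      using multiplierD[OF assms(1), of ?g] by simp
    finally have "hardy_norm ?g * hardy_norm ?g \<le> hardy_norm h * hardy_norm ?g"
      by (simp add: power2_eq_square)
    then show ?thesis
      using hardy_norm_nonneg[of ?g] hardy_norm_nonneg[OF assms(2)]
      by (metis hardy2_cutoff mult_right_le_imp_le not_le order.trans)
  qed
  from hardy2_by_cutoffs[OF this] show "adj \<theta> h \<in> hardy2" "hardy_norm (adj \<theta> h) \<le> hardy_norm h" by auto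
qed

lemma adj_inner:
  assumes \<theta>: "isometric_multiplier \<theta>" and h: "h \<in> hardy2" and g: "g \<in> hardy2"
  shows "hardy_inner h (\<theta> * g) = hardy_inner (adj \<theta> h) g"
proof (rule LIMSEQ_unique)
  show "(\<lambda>N. hardy_inner h (\<theta> * fps_cutoff N g)) \<longlonglongrightarrow> hardy_inner (adj \<theta> h) g"
    unfolding hardy_inner_mult_cutoff[OF \<theta> h] unfolding hardy_inner_def
    by (intro summable_LIMSEQ hardy_inner_summable adj_contraction \<theta> h g)
  show "(\<lambda>N. hardy_inner h (\<theta> * fps_cutoff N g)) \<longlonglongrightarrow> hardy_inner h (\<theta> * g)"
  proof (rule hardy_inner_tendsto_right)
    have "\<theta> * fps_cutoff N g - \<theta> * g = \<theta> * (fps_cutoff N g - g)" for N by (simp add: algebra_simps)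
    then show "(\<lambda>N. hardy_norm (\<theta> * fps_cutoff N g - \<theta> * g)) \<longlonglongrightarrow> 0"
      using hardy_cutoff_tendsto[OF g] g by (simp add: multiplierD(2)[OF \<theta>] hardy2_diff)
  qed (use multiplierD(1)[OF \<theta>] g h in auto)
qed

lemma adj_mult:
  assumes "isometric_multiplier \<theta>" "isometric_multiplier \<beta>" "h \<in> hardy2"
  shows "adj (\<theta> * \<beta>) h = adj \<beta> (adj \<theta> h)"
  by (rule fps_ext)
    (simp add: mult.left_commute[of _ \<theta>] adj_inner assms hardy2_X_power_mult multiplier_in_hardy2)

lemma adj_mult_self:
  assumes "isometric_multiplier \<theta>" "g \<in> hardy2"
  shows "adj \<theta> (\<theta> * g) = g"
proof (rule fps_ext)
  fix k
  have "fps_nth (adj \<theta> (\<theta> * g)) k = hardy_inner (\<theta> * g) (\<theta> * fps_X ^ k)" by (simp add: mult.commute)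
  also have "\<dots> = fps_nth g k" using assms by (simp add: multiplier_inner)
  finally show "fps_nth (adj \<theta> (\<theta> * g)) k = fps_nth g k" .
qed

lemma adj_0 [simp]: "adj \<theta> 0 = 0"
  by (rule fps_ext) simp

lemma adj_diff:
  "isometric_multiplier \<theta> \<Longrightarrow> f \<in> hardy2 \<Longrightarrow> g \<in> hardy2 \<Longrightarrow> adj \<theta> (f - g) = adj \<theta> f - adj \<theta> g"
  by (rule fps_ext) (simp add: hardy_inner_diff_left hardy2_X_power_mult multiplier_in_hardy2)

lemma adj_cutoff_tendsto:
  assumes \<theta>: "isometric_multiplier \<theta>" and h: "h \<in> hardy2"
  shows "(\<lambda>N. hardy_norm (adj \<theta> (fps_cutoff N h))) \<longlonglongrightarrow> hardy_norm (adj \<theta> h)"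
proof (rule hardy_norm_tendsto)
  show "(\<lambda>N. hardy_norm (adj \<theta> (fps_cutoff N h) - adj \<theta> h)) \<longlonglongrightarrow> 0"
    by (rule tendsto_sandwich[OF _ _ tendsto_const hardy_cutoff_tendsto[OF h]])
      (auto simp: adj_diff[symmetric] \<theta> h hardy2_diff adj_contraction[OF \<theta>])
qed (auto simp: adj_contraction[OF \<theta>] h)

lemma adj_sum:
  assumes "isometric_multiplier \<theta>" "\<And>i. i \<in> I \<Longrightarrow> f i \<in> hardy2"
  shows "adj \<theta> (\<Sum>i\<in>I. f i) = (\<Sum>i\<in>I. adj \<theta> (f i))"
  using assms by (intro fps_ext)
    (simp add: fps_sum_nth hardy_inner_sum_left hardy2_X_power_mult multiplier_in_hardy2)

text \<open>The orthogonal complement of the range of multiplication by \<open>\<theta>\<close>, as the kernel of its adjoint.\<close>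

definition coinvariant :: "complex fps \<Rightarrow> complex fps set" where
  "coinvariant \<theta> = {F \<in> hardy2. adj \<theta> F = 0}"

lemma coinvariantI: "F \<in> hardy2 \<Longrightarrow> adj \<theta> F = 0 \<Longrightarrow> F \<in> coinvariant \<theta>"
  and coinvariantD: "F \<in> coinvariant \<theta> \<Longrightarrow> F \<in> hardy2" "F \<in> coinvariant \<theta> \<Longrightarrow> adj \<theta> F = 0"
  by (auto simp: coinvariant_def)

lemma model_space_eq_coinvariant:
  assumes "isometric_multiplier (fps_expansion \<Theta> 0)"
  shows "model_space \<Theta> = coinvariant (fps_expansion \<Theta> 0)"
proof (intro set_eqI iffI)
  fix F assume F: "F \<in> model_space \<Theta>"
  then have "F \<in> hardy2" "\<And>k. hardy_inner F (fps_expansion \<Theta> 0 * fps_X ^ k) = 0"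
    by (auto simp: model_space_def)
  then show "F \<in> coinvariant (fps_expansion \<Theta> 0)"
    by (intro coinvariantI fps_ext) (simp_all add: mult.commute)
next
  fix F assume "F \<in> coinvariant (fps_expansion \<Theta> 0)"
  then show "F \<in> model_space \<Theta>"
    by (auto simp: model_space_def adj_inner[OF assms] coinvariantD)
qed

lemma coinvariant_const_mult:
  "isometric_multiplier \<theta> \<Longrightarrow> F \<in> coinvariant \<theta> \<Longrightarrow> fps_const c * F \<in> coinvariant \<theta>"
  by (auto simp: coinvariant_def fps_eq_iff hardy_inner_const_left hardy2_X_power_mult
      multiplier_in_hardy2 hardy2_const_mult)

lemma adj_coinvariant:
  assumes "isometric_multiplier \<theta>" "isometric_multiplier \<beta>" "F \<in> coinvariant \<theta>"
  shows "adj \<beta> F \<in> coinvariant \<theta>"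
proof (rule coinvariantI)
  have F: "F \<in> hardy2" "adj \<theta> F = 0" using assms(3) by (auto simp: coinvariantD)
  then show "adj \<beta> F \<in> hardy2" using assms adj_contraction by blast
  have "adj \<theta> (adj \<beta> F) = adj (\<beta> * \<theta>) F" using assms F by (simp add: adj_mult)
  also have "\<dots> = adj \<beta> (adj \<theta> F)" using assms F by (simp add: adj_mult mult.commute[of \<beta>])
  finally show "adj \<theta> (adj \<beta> F) = 0" by (simp add: F)
qed

text \<open>The orthogonal projection to the complement of the range of multiplication by \<open>\<theta>\<close>.\<close>

definition model_projection :: "complex fps \<Rightarrow> complex fps \<Rightarrow> complex fps" where
  "model_projection \<theta> h = h - \<theta> * adj \<theta> h"

lemma model_projection_props:
  assumes \<theta>: "isometric_multiplier \<theta>" and h: "h \<in> hardy2"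
  shows "model_projection \<theta> h \<in> coinvariant \<theta>"
    and "hardy_inner (model_projection \<theta> h) h = of_real ((hardy_norm (model_projection \<theta> h))\<^sup>2)"
    and "(hardy_norm (model_projection \<theta> h))\<^sup>2 = (hardy_norm h)\<^sup>2 - (hardy_norm (adj \<theta> h))\<^sup>2"
proof -
  have a: "adj \<theta> h \<in> hardy2" using adj_contraction[OF \<theta> h] by auto
  note m = multiplierD[OF \<theta> a]
  have p: "model_projection \<theta> h \<in> hardy2" unfolding model_projection_def using h m by auto
  show 1: "model_projection \<theta> h \<in> coinvariant \<theta>"
    using p by (auto intro!: coinvariantI simp: model_projection_def adj_diff[OF \<theta> h] adj_mult_self[OF \<theta> a] m)
  have "hardy_inner (model_projection \<theta> h) (\<theta> * adj \<theta> h) = 0"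
    using adj_inner[OF \<theta> p a] coinvariantD(2)[OF 1] by simp
  then have "hardy_inner (model_projection \<theta> h) h = hardy_inner (model_projection \<theta> h) (model_projection \<theta> h)"
    using hardy_inner_diff_right[OF h m(1) p] by (simp add: model_projection_def[of \<theta> h, symmetric])
  then show 2: "hardy_inner (model_projection \<theta> h) h = of_real ((hardy_norm (model_projection \<theta> h))\<^sup>2)"
    using hardy_inner_self[OF p] by simp
  have "hardy_inner (\<theta> * adj \<theta> h) h = cnj (hardy_inner h (\<theta> * adj \<theta> h))"
    by (rule hardy_inner_commute[OF h m(1)])
  also have "hardy_inner h (\<theta> * adj \<theta> h) = of_real ((hardy_norm (adj \<theta> h))\<^sup>2)"
    by (simp add: adj_inner[OF \<theta> h a] hardy_inner_self[OF a])
  finally have 3: "hardy_inner (\<theta> * adj \<theta> h) h = of_real ((hardy_norm (adj \<theta> h))\<^sup>2)" by simp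
  have "complex_of_real ((hardy_norm (model_projection \<theta> h))\<^sup>2) = of_real ((hardy_norm h)\<^sup>2 - (hardy_norm (adj \<theta> h))\<^sup>2)"
    using hardy_inner_diff_left[OF h m(1) h] 2 3 hardy_inner_self[OF h]
    by (simp add: model_projection_def[of \<theta> h, symmetric])
  then show "(hardy_norm (model_projection \<theta> h))\<^sup>2 = (hardy_norm h)\<^sup>2 - (hardy_norm (adj \<theta> h))\<^sup>2"
    by (simp only: of_real_eq_iff)
qed

definition szego :: "complex \<Rightarrow> complex fps" where
  "szego z = Abs_fps (\<lambda>n. cnj z ^ n)"

lemma szego_in_hardy2: assumes "cmod z < 1" shows "szego z \<in> hardy2"
proof -
  have "(cmod z)\<^sup>2 < 1" using assms by (simp add: abs_square_less_1)
  then have "summable (\<lambda>n. ((cmod z)\<^sup>2) ^ n)" by (intro summable_geometric) simp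
  then show ?thesis by (simp add: hardy2_iff szego_def norm_power power_mult[symmetric] mult.commute)
qed

lemma hardy_norm_szego_pos: assumes "cmod z < 1" shows "hardy_norm (szego z) > 0"
proof -
  have "fps_nth (szego z) 0 = 1" by (simp add: szego_def)
  then have "szego z \<noteq> 0" by (metis fps_zero_nth zero_neq_one)
  then show ?thesis
    using hardy_norm_eq_0_iff[OF szego_in_hardy2[OF assms]] hardy_norm_nonneg[OF szego_in_hardy2[OF assms]]
    by linarith
qed

lemma hardy_inner_szego: "hardy_inner f (szego z) = eval_fps f z"
  by (simp add: hardy_inner_def eval_fps_def szego_def)

text \<open>The kernels are eigenvectors of the adjoints, which is how operator inequalities become inequalities for
the values of \<open>\<theta>\<close>.\<close>

lemma adj_szego:
  assumes \<theta>: "isometric_multiplier \<theta>" and z: "cmod z < 1"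
  shows "adj \<theta> (szego z) = fps_const (cnj (eval_fps \<theta> z)) * szego z"
proof (rule fps_ext)
  fix k
  note h = multiplier_in_hardy2[OF \<theta>] szego_in_hardy2[OF z]
  have s: "summable (\<lambda>n. fps_nth (szego z) n * cnj (fps_nth \<theta> n))"
    by (rule hardy_inner_summable[OF h(2,1)])
  have "fps_nth (adj \<theta> (szego z)) k = (\<Sum>n. fps_nth (szego z) (n + k) * cnj (fps_nth \<theta> n))"
    by (simp add: hardy_inner_X_power_mult h)
  also have "\<dots> = (\<Sum>n. cnj z ^ k * (fps_nth (szego z) n * cnj (fps_nth \<theta> n)))"
    by (simp add: szego_def power_add mult_ac)
  also have "\<dots> = cnj z ^ k * hardy_inner (szego z) \<theta>"
    unfolding hardy_inner_def by (rule suminf_mult[OF s])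
  also have "hardy_inner (szego z) \<theta> = cnj (eval_fps \<theta> z)"
    using hardy_inner_commute[OF h] by (simp add: hardy_inner_szego)
  finally show "fps_nth (adj \<theta> (szego z)) k = fps_nth (fps_const (cnj (eval_fps \<theta> z)) * szego z) k"
    by (simp add: szego_def)
qed

lemma eval_multiplier_mult:
  assumes \<theta>: "isometric_multiplier \<theta>" and f: "f \<in> hardy2" and z: "cmod z < 1"
  shows "eval_fps (\<theta> * f) z = eval_fps \<theta> z * eval_fps f z"
proof -
  note s = szego_in_hardy2[OF z]
  note m = multiplierD(1)[OF \<theta> f]
  have "eval_fps (\<theta> * f) z = cnj (hardy_inner (szego z) (\<theta> * f))"
    using hardy_inner_commute[OF s m] by (simp add: hardy_inner_szego)
  also have "\<dots> = eval_fps \<theta> z * cnj (hardy_inner (szego z) f)"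
    using f s by (simp add: adj_inner \<theta> adj_szego z hardy_inner_const_left)
  also have "cnj (hardy_inner (szego z) f) = eval_fps f z"
    using hardy_inner_commute[OF s f] by (simp add: hardy_inner_szego)
  finally show ?thesis .
qed

lemma eval_multiplier_prod:
  assumes "\<And>i. i \<in> I \<Longrightarrow> isometric_multiplier (\<theta> i)" "cmod z < 1"
  shows "eval_fps (\<Prod>i\<in>I. \<theta> i) z = (\<Prod>i\<in>I. eval_fps (\<theta> i) z)"
  using assms
  by (induction I rule: infinite_finite_induct)
    (auto simp: eval_multiplier_mult multiplier_prod multiplier_in_hardy2)

lemma cmod_eval_multiplier_le:
  assumes \<theta>: "isometric_multiplier \<theta>" and z: "cmod z < 1"
  shows "cmod (eval_fps \<theta> z) \<le> 1"
proof -
  have "cmod (eval_fps \<theta> z) * hardy_norm (szego z) \<le> 1 * hardy_norm (szego z)"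
    using adj_contraction(2)[OF \<theta> szego_in_hardy2[OF z]]
    by (simp add: adj_szego \<theta> z hardy_norm_const_mult szego_in_hardy2)
  then show ?thesis using hardy_norm_szego_pos[OF z] by (rule mult_right_le_imp_le)
qed

text \<open>On the unit circle this is the holomorphic part of \<open>\<theta> * cnj (z * y)\<close>.\<close>

definition conj_op :: "complex fps \<Rightarrow> complex fps \<Rightarrow> complex fps" where
  "conj_op \<theta> y = Abs_fps (\<lambda>k. hardy_inner \<theta> (fps_X ^ Suc k * y))"

lemma conj_op_nth [simp]: "fps_nth (conj_op \<theta> y) k = hardy_inner \<theta> (fps_X ^ Suc k * y)"
  by (simp add: conj_op_def)

text \<open>For a polynomial \<open>y\<close> let \<open>r\<close> be the polynomial with reversed and conjugated coefficients,
\<open>r = z\<^sup>M\<^sup>-\<^sup>1 cnj y\<close> on the circle.  The product \<open>\<theta> r\<close> has the norm of \<open>y\<close>; its coefficients from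
\<open>M\<close> on are those of the conjugate, the lower ones are the conjugated coefficients of
\<open>adj \<theta> y\<close> in reversed order.\<close>

lemma conj_op_finite:
  fixes \<theta> y :: "complex fps"
  assumes \<theta>: "isometric_multiplier \<theta>" and y: "\<And>n. n \<ge> M \<Longrightarrow> fps_nth y n = 0"
  shows "conj_op \<theta> y \<in> hardy2" "(hardy_norm y)\<^sup>2 = (hardy_norm (conj_op \<theta> y))\<^sup>2 + (hardy_norm (adj \<theta> y))\<^sup>2"
proof -
  define r where "r = Abs_fps (\<lambda>i. if i < M then cnj (fps_nth y (M - Suc i)) else 0)"
  have rn: "fps_nth r i = (if i < M then cnj (fps_nth y (M - Suc i)) else 0)" for i by (simp add: r_def)
  have \<theta>h: "\<theta> \<in> hardy2" by (rule multiplier_in_hardy2[OF \<theta>])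
  have yh: "y \<in> hardy2" by (rule hardy2_finite[OF y])
  have rh: "r \<in> hardy2" by (rule hardy2_finite[of M]) (simp add: rn)
  have ah: "adj \<theta> y \<in> hardy2" using adj_contraction[OF \<theta> yh] by auto
  have n1: "(hardy_norm r)\<^sup>2 = (hardy_norm y)\<^sup>2"
  proof -
    have "(hardy_norm r)\<^sup>2 = (\<Sum>i<M. (cmod (fps_nth r i))\<^sup>2)"
      unfolding hardy_norm_sq[OF rh] by (rule suminf_finite) (auto simp: rn)
    also have "\<dots> = (\<Sum>i<M. (cmod (fps_nth y (M - Suc i)))\<^sup>2)" by (simp add: rn)
    also have "\<dots> = (\<Sum>i<M. (cmod (fps_nth y i))\<^sup>2)" by (rule sum.nat_diff_reindex)
    also have "\<dots> = (hardy_norm y)\<^sup>2"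
      unfolding hardy_norm_sq[OF yh] by (rule suminf_finite[symmetric]) (auto simp: y not_less)
    finally show ?thesis .
  qed
  have hi: "fps_nth (r * \<theta>) (k + M) = fps_nth (conj_op \<theta> y) k" for k
  proof -
    have "fps_nth (conj_op \<theta> y) k = (\<Sum>n. fps_nth \<theta> (n + Suc k) * cnj (fps_nth y n))"
      unfolding conj_op_nth by (rule hardy_inner_X_power_mult[OF \<theta>h yh])
    also have "\<dots> = (\<Sum>n<M. fps_nth \<theta> (n + Suc k) * cnj (fps_nth y n))"
      by (rule suminf_finite) (auto simp: y not_less)
    also have "\<dots> = (\<Sum>i<M. fps_nth \<theta> (M - Suc i + Suc k) * cnj (fps_nth y (M - Suc i)))"
      by (rule sum.nat_diff_reindex[symmetric])
    also have "\<dots> = (\<Sum>i<M. fps_nth r i * fps_nth \<theta> (k + M - i))"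
      by (intro sum.cong refl) (auto simp: rn mult.commute intro!: arg_cong[of _ _ "fps_nth \<theta>"])
    also have "\<dots> = (\<Sum>i=0..k + M. fps_nth r i * fps_nth \<theta> (k + M - i))"
      by (rule sum.mono_neutral_left) (auto simp: rn)
    finally show ?thesis by (simp add: fps_mult_nth)
  qed
  have lo: "fps_nth (r * \<theta>) j = cnj (fps_nth (adj \<theta> y) (M - Suc j))" if j: "j < M" for j
  proof -
    have "fps_nth (adj \<theta> y) (M - Suc j) = (\<Sum>n. fps_nth y (n + (M - Suc j)) * cnj (fps_nth \<theta> n))"
      unfolding adj_nth by (rule hardy_inner_X_power_mult[OF yh \<theta>h])
    also have "\<dots> = (\<Sum>n<Suc j. fps_nth y (n + (M - Suc j)) * cnj (fps_nth \<theta> n))"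
      by (rule suminf_finite) (use j in \<open>auto simp: y not_less\<close>)
    also have "\<dots> = (\<Sum>i<Suc j. fps_nth y (Suc j - Suc i + (M - Suc j)) * cnj (fps_nth \<theta> (Suc j - Suc i)))"
      by (rule sum.nat_diff_reindex[symmetric])
    also have "\<dots> = (\<Sum>i<Suc j. cnj (fps_nth r i * fps_nth \<theta> (j - i)))"
      by (intro sum.cong refl) (use j in \<open>auto simp: rn intro!: arg_cong[of _ _ "fps_nth y"]\<close>)
    also have "\<dots> = cnj (\<Sum>i<Suc j. fps_nth r i * fps_nth \<theta> (j - i))" by (simp only: cnj_sum)
    finally show ?thesis by (simp only: fps_mult_nth complex_cnj_cnj atLeast0AtMost lessThan_Suc_atMost)
  qed
  note m = multiplierD[OF \<theta> rh, unfolded mult.commute[of \<theta> r]]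
  have sm: "summable (\<lambda>j. (cmod (fps_nth (r * \<theta>) j))\<^sup>2)" using m(1) by (simp add: hardy2_iff)
  have "summable (\<lambda>k. (cmod (fps_nth (r * \<theta>) (k + M)))\<^sup>2)"
    using sm by (subst summable_iff_shift)
  then show ch: "conj_op \<theta> y \<in> hardy2" by (simp only: hi hardy2_iff)
  have "(hardy_norm y)\<^sup>2 = (hardy_norm (r * \<theta>))\<^sup>2" by (simp add: m n1)
  also have "\<dots> = (\<Sum>k. (cmod (fps_nth (r * \<theta>) (k + M)))\<^sup>2) + (\<Sum>j<M. (cmod (fps_nth (r * \<theta>) j))\<^sup>2)"
    unfolding hardy_norm_sq[OF m(1)] by (rule suminf_split_initial_segment[OF sm])
  also have "(\<Sum>k. (cmod (fps_nth (r * \<theta>) (k + M)))\<^sup>2) = (hardy_norm (conj_op \<theta> y))\<^sup>2"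
    by (simp only: hi hardy_norm_sq[OF ch])
  also have "(\<Sum>j<M. (cmod (fps_nth (r * \<theta>) j))\<^sup>2) = (\<Sum>j<M. (cmod (fps_nth (adj \<theta> y) (M - Suc j)))\<^sup>2)"
    by (intro sum.cong refl) (simp only: lo lessThan_iff complex_mod_cnj)
  also have "\<dots> = (\<Sum>j<M. (cmod (fps_nth (adj \<theta> y) j))\<^sup>2)" by (rule sum.nat_diff_reindex)
  also have "\<dots> = (hardy_norm (adj \<theta> y))\<^sup>2"
    unfolding hardy_norm_sq[OF ah]
  proof (rule suminf_finite[symmetric])
    fix k assume "k \<notin> {..<M}"
    then have "hardy_inner y (fps_X ^ k * \<theta>) = 0"
      by (simp add: hardy_inner_X_power_mult yh \<theta>h y)
    then show "(cmod (fps_nth (adj \<theta> y) k))\<^sup>2 = 0" by simp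
  qed simp
  finally show "(hardy_norm y)\<^sup>2 = (hardy_norm (conj_op \<theta> y))\<^sup>2 + (hardy_norm (adj \<theta> y))\<^sup>2" .
qed

lemma conj_op_diff:
  assumes "\<theta> \<in> hardy2" "f \<in> hardy2" "g \<in> hardy2"
  shows "conj_op \<theta> (f - g) = conj_op \<theta> f - conj_op \<theta> g"
  using assms by (intro fps_ext)
    (simp add: right_diff_distrib hardy_inner_diff_right hardy2_X_power_mult del: power_Suc)

lemma conj_op_sum:
  assumes "\<theta> \<in> hardy2" "\<And>i. i \<in> I \<Longrightarrow> f i \<in> hardy2"
  shows "conj_op \<theta> (\<Sum>i\<in>I. f i) = (\<Sum>i\<in>I. conj_op \<theta> (f i))"
  using assms by (intro fps_ext)
    (simp add: fps_sum_nth sum_distrib_left hardy_inner_sum_right hardy2_X_power_mult del: power_Suc)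

lemma conj_op_const:
  assumes "\<theta> \<in> hardy2" "f \<in> hardy2"
  shows "conj_op \<theta> (fps_const c * f) = fps_const (cnj c) * conj_op \<theta> f"
  using assms by (intro fps_ext)
    (simp add: mult.left_commute[of "fps_X ^ _"] hardy_inner_const_right hardy2_X_power_mult del: power_Suc)

lemma conj_op_contraction:
  assumes \<theta>: "isometric_multiplier \<theta>" and y: "y \<in> hardy2"
  shows "conj_op \<theta> y \<in> hardy2" "hardy_norm (conj_op \<theta> y) \<le> hardy_norm y"
proof -
  have \<theta>h: "\<theta> \<in> hardy2" by (rule multiplier_in_hardy2[OF \<theta>])
  have cf: "hardy_norm (conj_op \<theta> (fps_cutoff N y)) \<le> hardy_norm y" for N
  proof -
    note c = conj_op_finite[OF \<theta>, of N "fps_cutoff N y"]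
    have "(hardy_norm (conj_op \<theta> (fps_cutoff N y)))\<^sup>2 \<le> (hardy_norm (fps_cutoff N y))\<^sup>2"
      using c by simp
    then have "hardy_norm (conj_op \<theta> (fps_cutoff N y)) \<le> hardy_norm (fps_cutoff N y)"
      by (rule power2_le_imp_le) simp
    then show ?thesis using hardy_norm_cutoff_le[OF y, of N] by simp
  qed
  have coef: "(\<lambda>N. fps_nth (conj_op \<theta> (fps_cutoff N y)) k) \<longlonglongrightarrow> fps_nth (conj_op \<theta> y) k" for k
    unfolding conj_op_nth
  proof (rule hardy_inner_tendsto_right)
    show "(\<lambda>N. hardy_norm (fps_X ^ Suc k * fps_cutoff N y - fps_X ^ Suc k * y)) \<longlonglongrightarrow> 0"
      unfolding right_diff_distrib[symmetric] using hardy_cutoff_tendsto[OF y] y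
      by (simp add: hardy2_diff del: power_Suc)
  qed (auto simp del: power_Suc simp: y \<theta>h)
  have "hardy_norm (fps_cutoff K (conj_op \<theta> y)) \<le> hardy_norm y" for K
  proof (rule LIMSEQ_le_const2)
    show "(\<lambda>N. hardy_norm (fps_cutoff K (conj_op \<theta> (fps_cutoff N y)))) \<longlonglongrightarrow> hardy_norm (fps_cutoff K (conj_op \<theta> y))"
    proof -
      have e: "hardy_norm (fps_cutoff K F) = sqrt (\<Sum>k<K. (cmod (fps_nth F k))\<^sup>2)" for F
        by (metis hardy_norm_cutoff_sq hardy_norm_nonneg hardy2_cutoff real_sqrt_abs abs_of_nonneg)
      show ?thesis unfolding e by (intro tendsto_intros coef)
    qed
    show "\<exists>N. \<forall>n\<ge>N. hardy_norm (fps_cutoff K (conj_op \<theta> (fps_cutoff n y))) \<le> hardy_norm y"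
    proof (intro exI allI impI)
      fix n
      have "conj_op \<theta> (fps_cutoff n y) \<in> hardy2" by (rule conj_op_finite(1)[OF \<theta>, of n]) simp
      from order_trans[OF hardy_norm_cutoff_le[OF this] cf]
      show "hardy_norm (fps_cutoff K (conj_op \<theta> (fps_cutoff n y))) \<le> hardy_norm y" .
    qed
  qed
  from hardy2_by_cutoffs[OF this] show "conj_op \<theta> y \<in> hardy2" "hardy_norm (conj_op \<theta> y) \<le> hardy_norm y" by auto
qed

lemma conj_op_cutoff_tendsto:
  assumes \<theta>: "isometric_multiplier \<theta>" and y: "y \<in> hardy2"
  shows "(\<lambda>N. hardy_norm (conj_op \<theta> (fps_cutoff N y) - conj_op \<theta> y)) \<longlonglongrightarrow> 0"
  by (rule tendsto_sandwich[OF _ _ tendsto_const hardy_cutoff_tendsto[OF y]])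
    (auto simp: conj_op_diff[symmetric] multiplier_in_hardy2[OF \<theta>] y hardy2_diff
      conj_op_contraction[OF \<theta>])

text \<open>The identity extends from polynomials by density.  It shows that the conjugation is isometric exactly on
the kernel of the adjoint.\<close>

lemma conj_op_pythagoras:
  assumes \<theta>: "isometric_multiplier \<theta>" and y: "y \<in> hardy2"
  shows "(hardy_norm y)\<^sup>2 = (hardy_norm (conj_op \<theta> y))\<^sup>2 + (hardy_norm (adj \<theta> y))\<^sup>2"
proof (rule LIMSEQ_unique)
  let ?y = "\<lambda>N. fps_cutoff N y"
  have 1: "(\<lambda>N. hardy_norm (?y N)) \<longlonglongrightarrow> hardy_norm y"
    by (rule hardy_norm_tendsto[OF y _ hardy_cutoff_tendsto[OF y]]) simp
  have 2: "(\<lambda>N. hardy_norm (conj_op \<theta> (?y N))) \<longlonglongrightarrow> hardy_norm (conj_op \<theta> y)"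
    by (rule hardy_norm_tendsto[OF _ _ conj_op_cutoff_tendsto[OF \<theta> y]])
      (auto simp: conj_op_contraction[OF \<theta>] y)
  note 3 = adj_cutoff_tendsto[OF \<theta> y]
  show "(\<lambda>N. (hardy_norm (?y N))\<^sup>2) \<longlonglongrightarrow> (hardy_norm y)\<^sup>2" by (intro tendsto_intros 1)
  have "(hardy_norm (?y N))\<^sup>2 = (hardy_norm (conj_op \<theta> (?y N)))\<^sup>2 + (hardy_norm (adj \<theta> (?y N)))\<^sup>2" for N
    by (rule conj_op_finite(2)[OF \<theta>, of N]) simp
  then show "(\<lambda>N. (hardy_norm (?y N))\<^sup>2) \<longlonglongrightarrow> (hardy_norm (conj_op \<theta> y))\<^sup>2 + (hardy_norm (adj \<theta> y))\<^sup>2"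
    by (simp only:) (intro tendsto_intros 2 3)
qed

text \<open>For a monomial \<open>y\<close> the inner product of the conjugate with \<open>\<theta> z\<^sup>k\<close> is that of \<open>\<theta>\<close> with a higher
monomial times \<open>\<theta>\<close>, hence \<open>0\<close>; antilinearity and density give the general case.\<close>

lemma conj_op_coinvariant:
  assumes \<theta>: "isometric_multiplier \<theta>" and y: "y \<in> hardy2"
  shows "conj_op \<theta> y \<in> coinvariant \<theta>"
proof (rule coinvariantI)
  have \<theta>h: "\<theta> \<in> hardy2" by (rule multiplier_in_hardy2[OF \<theta>])
  show ch: "conj_op \<theta> y \<in> hardy2" by (rule conj_op_contraction[OF \<theta> y])
  have mono: "hardy_inner (conj_op \<theta> (fps_X ^ m)) (fps_X ^ k * \<theta>) = 0" for m k
  proof -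
    let ?g = "fps_X ^ k * \<theta>"
    have gh: "?g \<in> hardy2" using \<theta>h by auto
    have "fps_nth (conj_op \<theta> (fps_X ^ m)) j = fps_nth \<theta> (j + Suc m)" for j
    proof -
      have "hardy_inner \<theta> (fps_X ^ Suc j * fps_X ^ m) = hardy_inner \<theta> (fps_X ^ (j + Suc m))"
        by (simp add: power_add mult_ac)
      then show ?thesis by (simp only: conj_op_nth hardy_inner_X_power)
    qed
    then have "hardy_inner (conj_op \<theta> (fps_X ^ m)) ?g = (\<Sum>j. fps_nth \<theta> (j + Suc m) * cnj (fps_nth ?g j))"
      unfolding hardy_inner_def by simp
    also have "\<dots> = hardy_inner \<theta> (fps_X ^ Suc m * ?g)"
      by (rule hardy_inner_X_power_mult[OF \<theta>h gh, symmetric])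
    also have "fps_X ^ Suc m * ?g = \<theta> * fps_X ^ (Suc m + k)" by (simp add: power_add mult_ac)
    also have "hardy_inner \<theta> \<dots> = hardy_inner (\<theta> * 1) (\<theta> * fps_X ^ (Suc m + k))" by simp
    also have "\<dots> = hardy_inner 1 (fps_X ^ (Suc m + k))"
      by (rule multiplier_inner[OF \<theta>]) (simp_all del: power_Suc add_Suc)
    also have "\<dots> = 0" by (simp del: power_Suc add_Suc)
    finally show ?thesis .
  qed
  show "adj \<theta> (conj_op \<theta> y) = 0"
  proof (rule fps_ext)
    fix k
    let ?g = "fps_X ^ k * \<theta>"
    have "hardy_inner (conj_op \<theta> (fps_cutoff N y)) ?g = 0" for N
      unfolding cutoff_eq_sum using \<theta>h conj_op_contraction(1)[OF \<theta>]
      by (simp add: conj_op_sum conj_op_const hardy2_const_mult hardy_inner_sum_left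
          hardy_inner_const_left hardy2_X_power_mult mono)
    moreover have "(\<lambda>N. hardy_inner (conj_op \<theta> (fps_cutoff N y)) ?g) \<longlonglongrightarrow> hardy_inner (conj_op \<theta> y) ?g"
      by (rule hardy_inner_tendsto_left[OF _ _ conj_op_cutoff_tendsto[OF \<theta> y]])
        (auto simp: conj_op_contraction[OF \<theta>] y \<theta>h)
    ultimately show "fps_nth (adj \<theta> (conj_op \<theta> y)) k = fps_nth 0 k"
      by (simp add: LIMSEQ_const_iff)
  qed
qed

text \<open>Passing to a larger product turns the conjugation of one model space into that of a larger one:
multiplication by \<open>\<beta>\<close> preserves inner products.\<close>

lemma conj_op_mult:
  assumes "isometric_multiplier \<beta>" "isometric_multiplier \<theta>" "y \<in> hardy2"
  shows "conj_op (\<beta> * \<theta>) (\<beta> * y) = conj_op \<theta> y"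
proof (rule fps_ext)
  fix k
  have "hardy_inner (\<beta> * \<theta>) (fps_X ^ Suc k * (\<beta> * y)) = hardy_inner (\<beta> * \<theta>) (\<beta> * (fps_X ^ Suc k * y))"
    by (simp add: mult_ac)
  also have "\<dots> = hardy_inner \<theta> (fps_X ^ Suc k * y)"
    by (rule multiplier_inner[OF assms(1)])
      (use assms multiplier_in_hardy2 in \<open>auto simp del: power_Suc\<close>)
  finally show "fps_nth (conj_op (\<beta> * \<theta>) (\<beta> * y)) k = fps_nth (conj_op \<theta> y) k"
    by (simp only: conj_op_nth)
qed

section \<open>The corona estimate in the Hardy space\<close>

text \<open>On the circle \<open>cnj z = 1 / z\<close>, so the product of \<open>cnj f\<close> and \<open>H\<close> splits into nonnegative and negative
powers of \<open>z\<close>.\<close>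

lemma toeplitz_polynomial:
  fixes f H :: "complex poly"
  obtains p a where "\<And>z. cmod z = 1 \<Longrightarrow> cnj (poly f z) * poly H z = poly p z + cnj (z * poly a z)"
    and "fps_of_poly p = adj (fps_of_poly f) (fps_of_poly H)"
proof
  let ?N = "Suc (degree f)" and ?d = "Suc (degree H)"
  define p where "p = (\<Sum>l<?d. \<Sum>m<?N. if m \<le> l then monom (cnj (coeff f m) * coeff H l) (l - m) else 0)"
  define a where "a = (\<Sum>l<?d. \<Sum>m<?N. if m \<le> l then 0 else monom (coeff f m * cnj (coeff H l)) (m - l - 1))"
  show "cnj (poly f z) * poly H z = poly p z + cnj (z * poly a z)" if z: "cmod z = 1" for z
  proof -
    have u: "cnj z ^ n * z ^ n = 1" for n
      using z by (simp add: power_mult_distrib[symmetric] mult.commute[of "cnj z"] complex_norm_square[symmetric])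
    have "cnj (poly f z) * poly H z = poly H z * cnj (poly f z)" by (rule mult.commute)
    also have "\<dots> = (\<Sum>l<?d. \<Sum>m<?N. cnj (coeff f m) * coeff H l * (cnj z ^ m * z ^ l))"
      unfolding poly_lessThan[of f] poly_lessThan[of H] cnj_sum sum_product
      by (simp add: mult_ac)
    also have "\<dots> = (\<Sum>l<?d. \<Sum>m<?N. (if m \<le> l then cnj (coeff f m) * coeff H l * z ^ (l - m) else 0)
        + cnj (z * (if m \<le> l then 0 else coeff f m * cnj (coeff H l) * z ^ (m - l - 1))))"
    proof (intro sum.cong refl)
      fix l m
      show "cnj (coeff f m) * coeff H l * (cnj z ^ m * z ^ l) =
         (if m \<le> l then cnj (coeff f m) * coeff H l * z ^ (l - m) else 0)
        + cnj (z * (if m \<le> l then 0 else coeff f m * cnj (coeff H l) * z ^ (m - l - 1)))"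
      proof (cases "m \<le> l")
        case True
        then have "cnj z ^ m * z ^ l = (cnj z ^ m * z ^ m) * z ^ (l - m)"
          by (simp add: mult.assoc power_add[symmetric])
        then show ?thesis using True by (simp add: u)
      next
        case False
        then have "cnj z ^ m * z ^ l = (cnj z ^ l * z ^ l) * (cnj z * cnj z ^ (m - l - 1))"
          by (simp add: power_Suc[symmetric] mult.commute mult.left_commute power_add[symmetric] del: power_Suc)
        then show ?thesis using False by (simp add: u)
      qed
    qed
    also have "\<dots> = poly p z + cnj (z * poly a z)"
      unfolding sum.distrib p_def a_def poly_sum sum_distrib_left cnj_sum
      by (intro arg_cong2[of _ _ _ _ "(+)"] sum.cong refl) (auto simp: poly_monom)
    finally show ?thesis .
  qed
  show "fps_of_poly p = adj (fps_of_poly f) (fps_of_poly H)"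
  proof (rule fps_ext)
    fix k
    have "coeff p k = (\<Sum>m<?N. \<Sum>l<?d. if m \<le> l \<and> l - m = k then cnj (coeff f m) * coeff H l else 0)"
      unfolding p_def coeff_sum by (subst sum.swap, intro sum.cong refl) (auto simp del: sum.lessThan_Suc)
    also have "\<dots> = (\<Sum>m<?N. cnj (coeff f m) * coeff H (m + k))"
    proof (intro sum.cong refl)
      fix m
      have "(\<Sum>l<?d. if m \<le> l \<and> l - m = k then cnj (coeff f m) * coeff H l else 0)
          = (\<Sum>l<?d. if l = m + k then cnj (coeff f m) * coeff H l else 0)"
        by (intro sum.cong refl) auto
      also have "\<dots> = cnj (coeff f m) * coeff H (m + k)"
        by (auto simp: coeff_eq_0)
      finally show "(\<Sum>l<?d. if m \<le> l \<and> l - m = k then cnj (coeff f m) * coeff H l else 0)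
          = cnj (coeff f m) * coeff H (m + k)" .
    qed
    also have "\<dots> = (\<Sum>m. coeff H (m + k) * cnj (coeff f m))"
      by (subst suminf_finite[of "{..<?N}"]) (auto simp: coeff_eq_0 mult.commute not_less)
    finally show "fps_nth (fps_of_poly p) k = fps_nth (adj (fps_of_poly f) (fps_of_poly H)) k"
      by (simp add: hardy_inner_X_power_mult)
  qed
qed

text \<open>On a polynomial the adjoint depends on finitely many coefficients of the symbol only.  Hence symbols may
be replaced by approximations that converge coefficientwise.\<close>

lemma adj_polynomial_norm:
  assumes f: "f \<in> hardy2" and H: "degree H < d"
  shows "(hardy_norm (adj f (fps_of_poly H)))\<^sup>2
     = (\<Sum>k<d. (cmod (\<Sum>n<d. coeff H (n + k) * cnj (fps_nth f n)))\<^sup>2)"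
proof -
  have e: "fps_nth (adj f (fps_of_poly H)) k = (\<Sum>n<d. coeff H (n + k) * cnj (fps_nth f n))" for k
    using H unfolding adj_nth hardy_inner_X_power_mult[OF hardy2_fps_of_poly f] fps_of_poly_nth
    by (intro suminf_finite) (auto simp: coeff_eq_0)
  have z: "(\<Sum>n<d. coeff H (n + k) * cnj (fps_nth f n)) = 0" if "k \<ge> d" for k
    using H that by (auto intro!: sum.neutral simp: coeff_eq_0)
  have "adj f (fps_of_poly H) \<in> hardy2"
    by (rule hardy2_finite[of d]) (simp only: e z)
  then have "(hardy_norm (adj f (fps_of_poly H)))\<^sup>2 = (\<Sum>k. (cmod (fps_nth (adj f (fps_of_poly H)) k))\<^sup>2)"
    by (rule hardy_norm_sq)
  also have "\<dots> = (\<Sum>k<d. (cmod (fps_nth (adj f (fps_of_poly H)) k))\<^sup>2)"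
  proof (rule suminf_finite)
    fix k assume "k \<notin> {..<d}"
    then show "(cmod (fps_nth (adj f (fps_of_poly H)) k))\<^sup>2 = 0" by (simp add: e z del: adj_nth)
  qed simp
  finally show ?thesis by (simp only: e)
qed

text \<open>After dilation the coefficients are absolutely summable.\<close>

lemma dilated_partial_sum_uniform:
  assumes \<theta>: "\<theta> \<in> hardy2" and \<rho>: "0 \<le> \<rho>" "\<rho> < 1" and \<eta>: "\<eta> > 0"
  shows "\<forall>\<^sub>F N in sequentially. \<forall>z. cmod z \<le> 1 \<longrightarrow>
     cmod ((\<Sum>m<N. fps_nth \<theta> m * of_real \<rho> ^ m * z ^ m) - eval_fps \<theta> (of_real \<rho> * z)) \<le> \<eta>"
proof -
  define g where "g = (\<lambda>m. cmod (fps_nth \<theta> m) * \<rho> ^ m)"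
  have g: "summable g"
    using hardy_inner_summable_norm[OF \<theta> szego_in_hardy2[of "of_real \<rho>"]] \<rho>
    by (simp add: g_def szego_def norm_power)
  have "(\<lambda>N. suminf g - (\<Sum>m<N. g m)) \<longlonglongrightarrow> suminf g - suminf g"
    by (intro tendsto_intros summable_LIMSEQ g)
  then have "\<forall>\<^sub>F N in sequentially. suminf g - (\<Sum>m<N. g m) < \<eta>"
    by (rule order_tendstoD) (use \<eta> in simp)
  then show ?thesis
  proof (rule eventually_mono, intro allI impI)
    fix N z assume N: "suminf g - (\<Sum>m<N. g m) < \<eta>" and z: "cmod z \<le> 1"
    define f where "f = (\<lambda>m. fps_nth \<theta> m * of_real \<rho> ^ m * z ^ m)"
    have le: "norm (f m) \<le> g m" for m
      using z \<rho> by (simp add: f_def g_def norm_mult norm_power mult_left_le power_le_one)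
    have sf: "summable (\<lambda>m. norm (f m))"
      by (rule summable_comparison_test'[OF g]) (simp add: le)
    have "eval_fps \<theta> (of_real \<rho> * z) = suminf f"
      by (simp add: eval_fps_def f_def power_mult_distrib mult.assoc)
    also have "\<dots> = (\<Sum>m. f (m + N)) + (\<Sum>m<N. f m)"
      by (rule suminf_split_initial_segment[OF summable_norm_cancel[OF sf]])
    finally have "cmod ((\<Sum>m<N. f m) - eval_fps \<theta> (of_real \<rho> * z)) = cmod (\<Sum>m. f (m + N))"
      by simp
    also have "\<dots> \<le> (\<Sum>m. norm (f (m + N)))"
      by (rule summable_norm) (use sf in \<open>subst summable_iff_shift\<close>)
    also have "\<dots> \<le> (\<Sum>m. g (m + N))"
      using sf g le by (intro suminf_le) (auto simp: summable_iff_shift[of "\<lambda>m. norm (f m)"] summable_iff_shift[of g])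
    also have "\<dots> = suminf g - (\<Sum>m<N. g m)"
      using suminf_split_initial_segment[OF g, of N] by simp
    finally show "cmod ((\<Sum>m<N. fps_nth \<theta> m * of_real \<rho> ^ m * z ^ m) - eval_fps \<theta> (of_real \<rho> * z)) \<le> \<eta>"
      using N by (simp add: f_def)
  qed
qed

lemma square_le_of_close:
  fixes a b \<eta> :: real
  assumes "0 \<le> a" "a \<le> b + \<eta>" shows "a\<^sup>2 \<le> 2 * b\<^sup>2 + 2 * \<eta>\<^sup>2"
proof -
  have "a\<^sup>2 \<le> (b + \<eta>)\<^sup>2" using assms by (intro power_mono)
  also have "\<dots> \<le> 2 * b\<^sup>2 + 2 * \<eta>\<^sup>2"
    using sum_squares_bound[of b \<eta>] by (simp add: power2_sum)
  finally show ?thesis .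
qed

text \<open>A dilate of the symbols is uniformly close to its Taylor polynomials on the closed disc, where the corona
lower bound persists with \<open>\<epsilon> / 2\<close> in the place of \<open>\<epsilon>\<close>.\<close>

lemma corona_dilate:
  fixes H :: "complex poly"
  assumes \<theta>: "isometric_multiplier \<theta>" and \<beta>: "isometric_multiplier \<beta>"
    and \<epsilon>: "0 < \<epsilon>" "\<epsilon> \<le> 1"
    and low: "\<And>z. cmod z < 1 \<Longrightarrow> \<epsilon>\<^sup>2 \<le> (cmod (eval_fps \<theta> z))\<^sup>2 + (cmod (eval_fps \<beta> z))\<^sup>2"
    and \<rho>: "0 \<le> \<rho>" "\<rho> < 1" and d: "degree H < d"
  defines "T \<equiv> (\<lambda>f. \<Sum>k<d. (cmod (\<Sum>n<d. coeff H (n + k) * cnj (fps_nth f n * of_real \<rho> ^ n)))\<^sup>2)"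
  shows "poly_norm2 H \<le> 300000 / (\<epsilon> / 2) ^ 8 * (T \<theta> + T \<beta>)"
proof -
  note h = multiplier_in_hardy2[OF \<theta>] multiplier_in_hardy2[OF \<beta>]
  have "\<forall>\<^sub>F N in sequentially. d \<le> N
      \<and> (\<forall>z. cmod z \<le> 1 \<longrightarrow> cmod ((\<Sum>m<N. fps_nth \<theta> m * of_real \<rho> ^ m * z ^ m) - eval_fps \<theta> (of_real \<rho> * z)) \<le> \<epsilon> / 4)
      \<and> (\<forall>z. cmod z \<le> 1 \<longrightarrow> cmod ((\<Sum>m<N. fps_nth \<beta> m * of_real \<rho> ^ m * z ^ m) - eval_fps \<beta> (of_real \<rho> * z)) \<le> \<epsilon> / 4)"
    by (intro eventually_conj eventually_ge_at_top dilated_partial_sum_uniform h \<rho>) (use \<epsilon> in simp_all)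
  from eventually_happens'[OF sequentially_bot this]
  obtain N where N: "d \<le> N"
    and N\<theta>: "\<And>z. cmod z \<le> 1 \<Longrightarrow> cmod ((\<Sum>m<N. fps_nth \<theta> m * of_real \<rho> ^ m * z ^ m) - eval_fps \<theta> (of_real \<rho> * z)) \<le> \<epsilon> / 4"
    and N\<beta>: "\<And>z. cmod z \<le> 1 \<Longrightarrow> cmod ((\<Sum>m<N. fps_nth \<beta> m * of_real \<rho> ^ m * z ^ m) - eval_fps \<beta> (of_real \<rho> * z)) \<le> \<epsilon> / 4"
    by blast
  define P where "P = (\<lambda>f::complex fps. \<Sum>m<N. monom (fps_nth f m * of_real \<rho> ^ m) m)"
  have P: "poly (P f) z = (\<Sum>m<N. fps_nth f m * of_real \<rho> ^ m * z ^ m)" for f z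
    by (simp add: P_def poly_sum poly_monom)
  have Pc: "coeff (P f) n = (if n < N then fps_nth f n * of_real \<rho> ^ n else 0)" for f n
    by (simp add: P_def coeff_sum)
  have \<rho>z: "cmod (of_real \<rho> * z) < 1" if "cmod z \<le> 1" for z
    using that \<rho> mult_left_mono[of "cmod z" 1 \<rho>] by (simp add: norm_mult)
  obtain p a where pa: "\<And>z. cmod z = 1 \<Longrightarrow> cnj (poly (P \<theta>) z) * poly H z = poly p z + cnj (z * poly a z)"
    "fps_of_poly p = adj (fps_of_poly (P \<theta>)) (fps_of_poly H)" by (rule toeplitz_polynomial[of "P \<theta>" H]) (rule that, blast+)
  obtain q b where qb: "\<And>z. cmod z = 1 \<Longrightarrow> cnj (poly (P \<beta>) z) * poly H z = poly q z + cnj (z * poly b z)"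
    "fps_of_poly q = adj (fps_of_poly (P \<beta>)) (fps_of_poly H)" by (rule toeplitz_polynomial[of "P \<beta>" H]) (rule that, blast+)
  have T: "(hardy_norm (adj (fps_of_poly (P f)) (fps_of_poly H)))\<^sup>2 = T f" for f
    unfolding adj_polynomial_norm[OF hardy2_fps_of_poly d] T_def
    by (intro sum.cong refl arg_cong[of _ _ "\<lambda>x. (cmod x)\<^sup>2"]) (use N in \<open>simp add: Pc\<close>)
  have "poly_norm2 H \<le> 300000 / (\<epsilon> / 2) ^ 8 * (poly_norm2 p + poly_norm2 q)"
  proof (rule corona_polynomial[where \<phi> = "P \<theta>" and \<psi> = "P \<beta>" and a = a and b = b])
    fix z assume z: "cmod z \<le> 1"
    have 1: "cmod (poly (P \<theta>) z) \<le> cmod (eval_fps \<theta> (of_real \<rho> * z)) + \<epsilon> / 4"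
      "cmod (eval_fps \<theta> (of_real \<rho> * z)) \<le> cmod (poly (P \<theta>) z) + \<epsilon> / 4"
      using N\<theta>[OF z] norm_triangle_ineq2[of "poly (P \<theta>) z" "eval_fps \<theta> (of_real \<rho> * z)"]
        norm_triangle_ineq2[of "eval_fps \<theta> (of_real \<rho> * z)" "poly (P \<theta>) z"]
      by (simp_all add: P norm_minus_commute)
    have 2: "cmod (poly (P \<beta>) z) \<le> cmod (eval_fps \<beta> (of_real \<rho> * z)) + \<epsilon> / 4"
      "cmod (eval_fps \<beta> (of_real \<rho> * z)) \<le> cmod (poly (P \<beta>) z) + \<epsilon> / 4"
      using N\<beta>[OF z] norm_triangle_ineq2[of "poly (P \<beta>) z" "eval_fps \<beta> (of_real \<rho> * z)"]
        norm_triangle_ineq2[of "eval_fps \<beta> (of_real \<rho> * z)" "poly (P \<beta>) z"]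
      by (simp_all add: P norm_minus_commute)
    show "cmod (poly (P \<theta>) z) \<le> 2" "cmod (poly (P \<beta>) z) \<le> 2"
      using 1(1) 2(1) cmod_eval_multiplier_le[OF \<theta> \<rho>z[OF z]]
        cmod_eval_multiplier_le[OF \<beta> \<rho>z[OF z]] \<epsilon> by linarith+
    have "\<epsilon>\<^sup>2 \<le> (cmod (eval_fps \<theta> (of_real \<rho> * z)))\<^sup>2 + (cmod (eval_fps \<beta> (of_real \<rho> * z)))\<^sup>2"
      by (rule low[OF \<rho>z[OF z]])
    also have "\<dots> \<le> (2 * (cmod (poly (P \<theta>) z))\<^sup>2 + 2 * (\<epsilon> / 4)\<^sup>2) + (2 * (cmod (poly (P \<beta>) z))\<^sup>2 + 2 * (\<epsilon> / 4)\<^sup>2)"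
      by (intro add_mono square_le_of_close 1 2) auto
    moreover have "(\<epsilon> / 2)\<^sup>2 = \<epsilon>\<^sup>2 / 4" "(\<epsilon> / 4)\<^sup>2 = \<epsilon>\<^sup>2 / 16" by (simp_all add: power_divide)
    ultimately show "(\<epsilon> / 2)\<^sup>2 \<le> (cmod (poly (P \<theta>) z))\<^sup>2 + (cmod (poly (P \<beta>) z))\<^sup>2"
      using zero_le_power2[of \<epsilon>] by linarith
  qed (use \<epsilon> pa qb in auto)
  then show ?thesis by (simp only: pa(2) qb(2) T)
qed

text \<open>Both adjoints of \<open>H\<close> for the dilated symbols are polynomials in \<open>\<rho>\<close>, so \<open>\<rho>\<close> may tend to
\<open>1\<close>.\<close>

lemma corona_hardy_polynomial:
  fixes H :: "complex poly"
  assumes \<theta>: "isometric_multiplier \<theta>" and \<beta>: "isometric_multiplier \<beta>"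
    and \<epsilon>: "0 < \<epsilon>" "\<epsilon> \<le> 1"
    and low: "\<And>z. cmod z < 1 \<Longrightarrow> \<epsilon>\<^sup>2 \<le> (cmod (eval_fps \<theta> z))\<^sup>2 + (cmod (eval_fps \<beta> z))\<^sup>2"
  shows "poly_norm2 H \<le> 300000 / (\<epsilon> / 2) ^ 8 *
     ((hardy_norm (adj \<theta> (fps_of_poly H)))\<^sup>2 + (hardy_norm (adj \<beta> (fps_of_poly H)))\<^sup>2)"
proof -
  let ?d = "Suc (degree H)"
  define T where "T = (\<lambda>f \<rho>. \<Sum>k<?d. (cmod (\<Sum>n<?d. coeff H (n + k) * cnj (fps_nth f n * complex_of_real \<rho> ^ n)))\<^sup>2)"
  have "((\<lambda>\<rho>. 300000 / (\<epsilon> / 2) ^ 8 * (T \<theta> \<rho> + T \<beta> \<rho>)) \<longlongrightarrow> 300000 / (\<epsilon> / 2) ^ 8 * (T \<theta> 1 + T \<beta> 1)) (at_left 1)"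
    unfolding T_def by (intro tendsto_intros) (use \<epsilon> in auto)
  moreover have "\<forall>\<^sub>F \<rho> in at_left 1. poly_norm2 H \<le> 300000 / (\<epsilon> / 2) ^ 8 * (T \<theta> \<rho> + T \<beta> \<rho>)"
  proof -
    have "\<forall>\<^sub>F \<rho> in at_left (1::real). \<rho> \<in> {0<..<1}" by (rule eventually_at_left_real) simp
    then show ?thesis
      by (rule eventually_mono) (unfold T_def, rule corona_dilate[OF \<theta> \<beta> \<epsilon> low _ _ lessI], auto)
  qed
  ultimately have "poly_norm2 H \<le> 300000 / (\<epsilon> / 2) ^ 8 * (T \<theta> 1 + T \<beta> 1)"
    by (rule tendsto_lowerbound) simp
  moreover have "T f 1 = (hardy_norm (adj f (fps_of_poly H)))\<^sup>2" if "f \<in> hardy2" for f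
    unfolding T_def adj_polynomial_norm[OF that lessI] by simp
  ultimately show ?thesis
    using multiplier_in_hardy2[OF \<theta>] multiplier_in_hardy2[OF \<beta>] by simp
qed

theorem corona_hardy:
  assumes \<theta>: "isometric_multiplier \<theta>" and \<beta>: "isometric_multiplier \<beta>"
    and \<epsilon>: "0 < \<epsilon>" "\<epsilon> \<le> 1"
    and low: "\<And>z. cmod z < 1 \<Longrightarrow> \<epsilon>\<^sup>2 \<le> (cmod (eval_fps \<theta> z))\<^sup>2 + (cmod (eval_fps \<beta> z))\<^sup>2"
    and h: "h \<in> hardy2"
  shows "(hardy_norm h)\<^sup>2 \<le> 300000 / (\<epsilon> / 2) ^ 8 * ((hardy_norm (adj \<theta> h))\<^sup>2 + (hardy_norm (adj \<beta> h))\<^sup>2)"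
proof (rule LIMSEQ_le)
  let ?h = "\<lambda>N. fps_cutoff N h"
  have 1: "(\<lambda>N. hardy_norm (?h N)) \<longlonglongrightarrow> hardy_norm h"
    by (rule hardy_norm_tendsto[OF h _ hardy_cutoff_tendsto[OF h]]) simp
  show "(\<lambda>N. (hardy_norm (?h N))\<^sup>2) \<longlonglongrightarrow> (hardy_norm h)\<^sup>2" by (intro tendsto_intros 1)
  show "(\<lambda>N. 300000 / (\<epsilon> / 2) ^ 8 * ((hardy_norm (adj \<theta> (?h N)))\<^sup>2 + (hardy_norm (adj \<beta> (?h N)))\<^sup>2))
      \<longlonglongrightarrow> 300000 / (\<epsilon> / 2) ^ 8 * ((hardy_norm (adj \<theta> h))\<^sup>2 + (hardy_norm (adj \<beta> h))\<^sup>2)"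
    by (intro tendsto_mult tendsto_const tendsto_add tendsto_power adj_cutoff_tendsto \<theta> \<beta> h)
  show "\<exists>K. \<forall>N\<ge>K. (hardy_norm (?h N))\<^sup>2 \<le> 300000 / (\<epsilon> / 2) ^ 8 *
      ((hardy_norm (adj \<theta> (?h N)))\<^sup>2 + (hardy_norm (adj \<beta> (?h N)))\<^sup>2)"
  proof (intro exI allI impI)
    fix N
    obtain H where "?h N = fps_of_poly H" using cutoff_eq_poly by blast
    then show "(hardy_norm (?h N))\<^sup>2 \<le> 300000 / (\<epsilon> / 2) ^ 8 *
      ((hardy_norm (adj \<theta> (?h N)))\<^sup>2 + (hardy_norm (adj \<beta> (?h N)))\<^sup>2)"
      using corona_hardy_polynomial[OF \<theta> \<beta> \<epsilon> low, of H] by simp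
  qed
qed

section \<open>Inner functions are isometric multipliers\<close>

text \<open>The partial sums are dominated by the absolutely convergent series of coefficients.\<close>

lemma parseval_power_series:
  assumes "1 \<le> fps_conv_radius g" and r: "0 \<le> r" "r < 1"
  shows "(\<lambda>n. (cmod (fps_nth g n * of_real r ^ n))\<^sup>2) sums
     (1 / (2 * pi) * integral {0..2 * pi} (\<lambda>t. (cmod (eval_fps g (of_real r * cis t)))\<^sup>2))"
proof -
  define c where "c = (\<lambda>n. fps_nth g n * complex_of_real r ^ n)"
  have "ereal (norm (complex_of_real r)) < fps_conv_radius g"
    using r assms(1) by (auto intro: less_le_trans[of _ 1])
  then have sc: "summable (\<lambda>n. norm (c n))"
    unfolding c_def fps_conv_radius_def by (rule abs_summable_in_conv_radius)
  define M where "M = (\<Sum>n. norm (c n))"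
  have tm: "norm (c n * cis t ^ n) = norm (c n)" for n t
    by (simp add: norm_mult norm_power)
  have "((\<lambda>k. integral {0..2 * pi} (\<lambda>t. (cmod (\<Sum>n<k. c n * cis t ^ n))\<^sup>2)) \<longlonglongrightarrow>
     integral {0..2 * pi} (\<lambda>t. (cmod (eval_fps g (of_real r * cis t)))\<^sup>2))"
  proof (rule dominated_convergence(2))
    show "(\<lambda>t. (cmod (\<Sum>n<k. c n * cis t ^ n))\<^sup>2) integrable_on {0..2 * pi}" for k
      using parseval_circle[of c k] by blast
    show "(\<lambda>t. M\<^sup>2) integrable_on {0..2 * pi}" by blast
    show "norm ((cmod (\<Sum>n<k. c n * cis t ^ n))\<^sup>2) \<le> M\<^sup>2" for k t
    proof -
      have "cmod (\<Sum>n<k. c n * cis t ^ n) \<le> (\<Sum>n<k. norm (c n))"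
        by (rule order_trans[OF norm_sum]) (simp add: tm)
      also have "\<dots> \<le> M" unfolding M_def by (rule sum_le_suminf[OF sc]) auto
      finally show ?thesis by (simp add: power_mono)
    qed
    show "(\<lambda>k. (cmod (\<Sum>n<k. c n * cis t ^ n))\<^sup>2) \<longlonglongrightarrow> (cmod (eval_fps g (of_real r * cis t)))\<^sup>2" for t
    proof -
      have "summable (\<lambda>n. c n * cis t ^ n)"
        by (rule summable_norm_cancel) (simp only: tm sc)
      moreover have "eval_fps g (of_real r * cis t) = (\<Sum>n. c n * cis t ^ n)"
        by (simp add: eval_fps_def c_def power_mult_distrib mult.assoc)
      ultimately show ?thesis by (intro tendsto_intros) (simp only: summable_LIMSEQ)
    qed
  qed
  then have "(\<lambda>k. 1 / (2 * pi) * (2 * pi * (\<Sum>n<k. (cmod (c n))\<^sup>2))) \<longlonglongrightarrow>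
     1 / (2 * pi) * integral {0..2 * pi} (\<lambda>t. (cmod (eval_fps g (of_real r * cis t)))\<^sup>2)"
    unfolding integral_unique[OF parseval_circle] by (intro tendsto_intros)
  then show ?thesis by (simp add: sums_def c_def)
qed

text \<open>For a polynomial \<open>p\<close> the square means of \<open>\<Theta> p\<close> over circles of radius \<open>r\<close> converge, as \<open>r\<close> tends to \<open>1\<close>, to
the square mean of \<open>p\<close>, by dominated convergence and because the radial limits of \<open>\<Theta>\<close> are unimodular almost
everywhere.  By Parseval these means are \<open>\<Sum>n. \<bar>g\<^sub>n\<bar>\<^sup>2 r\<^sup>2\<^sup>n\<close> for the coefficients \<open>g\<^sub>n\<close> of the product.\<close>

lemma inner_function_isometric:
  assumes "inner_function \<Theta>"
  shows "isometric_multiplier (fps_expansion \<Theta> 0)"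
proof (rule isometric_multiplier_by_polys)
  fix p :: "complex poly"
  define F where "F = fps_expansion \<Theta> 0"
  define g where "g = F * fps_of_poly p"
  have hol: "\<Theta> holomorphic_on ball 0 1"
    and bdd: "bounded (\<Theta> ` ball 0 1)"
    and ae: "AE t\<in>{0..2 * pi} in lebesgue.
        \<exists>l. cmod l = 1 \<and> ((\<lambda>r. \<Theta> (complex_of_real r * cis t)) \<longlongrightarrow> l) (at_left 1)"
    using assms by (auto simp: inner_function_def)
  have hol': "\<Theta> holomorphic_on eball 0 1" using hol by (simp add: one_ereal_def)
  have radF: "1 \<le> fps_conv_radius F" unfolding F_def by (rule conv_radius_fps_expansion[OF hol'])
  have radg: "1 \<le> fps_conv_radius g"
    unfolding g_def using fps_conv_radius_mult[of F "fps_of_poly p"] radF by (auto simp: min_def split: if_splits)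
  have ev: "eval_fps g z = \<Theta> z * poly p z" if z: "cmod z < 1" for z
  proof -
    have "ereal (norm z) < fps_conv_radius F" using z radF by (auto intro: less_le_trans[of _ 1])
    then have "eval_fps g z = eval_fps F z * poly p z" unfolding g_def by (simp add: eval_fps_mult)
    also have "eval_fps F z = \<Theta> z"
      using eval_fps_expansion[OF hol', of z] z by (simp add: F_def in_eball_iff one_ereal_def)
    finally show ?thesis .
  qed
  obtain B where B: "\<And>z. cmod z < 1 \<Longrightarrow> cmod (\<Theta> z) \<le> B"
    using bdd unfolding bounded_iff by (metis imageI mem_ball_0)
  have "compact (cball (0::complex) 1)" by simp
  then have "bounded (poly p ` cball 0 1)"
    by (intro compact_imp_bounded compact_continuous_image continuous_intros)
  then obtain B' where B': "\<And>z. cmod z \<le> 1 \<Longrightarrow> cmod (poly p z) \<le> B'"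
    unfolding bounded_iff by (metis imageI mem_cball_0)
  obtain N where N: "negligible N"
    and lim: "\<And>t. t \<in> {0..2 * pi} - N \<Longrightarrow>
        \<exists>l. cmod l = 1 \<and> ((\<lambda>r. \<Theta> (complex_of_real r * cis t)) \<longlongrightarrow> l) (at_left 1)"
    using ae unfolding eventually_ae_filter_negligible by blast
  define r where "r = (\<lambda>j::nat. 1 - 1 / real (j + 2))"
  have r: "0 \<le> r j" "r j < 1" for j by (auto simp: r_def)
  have rl: "r \<longlonglongrightarrow> 1"
    using tendsto_diff[OF tendsto_const LIMSEQ_ignore_initial_segment[OF lim_1_over_n, of 2], of "1::real"]
    by (simp add: r_def)
  have rlim: "filterlim r (at_left 1) sequentially"
    unfolding filterlim_at by (auto simp: rl r intro!: always_eventually) (metis r(2) less_irrefl)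
  \<comment> \<open>The dominated convergence theorem for this integral asks for limits at all points, so the integrands
    are changed to \<open>0\<close> on the null set where \<open>\<Theta>\<close> has no unimodular radial limit.\<close>
  define f where "f = (\<lambda>j t. if t \<in> N then 0 else (cmod (eval_fps g (of_real (r j) * cis t)))\<^sup>2)"
  define f\<^sub>0 where "f\<^sub>0 = (\<lambda>t. if t \<in> N then 0 else (cmod (poly p (cis t)))\<^sup>2)"
  have rz: "cmod (of_real (r j) * cis t) < 1" for j t using r[of j] by (simp add: norm_mult)
  have int: "(\<lambda>t. (cmod (eval_fps g (of_real (r j) * cis t)))\<^sup>2) integrable_on {0..2 * pi}" for j
  proof (intro integrable_continuous_interval continuous_intros)
    show "(\<lambda>t. complex_of_real (r j) * cis t) ` {0..2 * pi} \<subseteq> eball 0 (fps_conv_radius g)"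
    proof
      fix z assume "z \<in> (\<lambda>t. complex_of_real (r j) * cis t) ` {0..2 * pi}"
      then have "ereal (cmod z) < 1" using rz by (auto simp: one_ereal_def)
      from less_le_trans[OF this radg] show "z \<in> eball 0 (fps_conv_radius g)"
        by (simp add: in_eball_iff)
    qed
  qed
  have "(\<lambda>j. integral {0..2 * pi} (f j)) \<longlonglongrightarrow> integral {0..2 * pi} f\<^sub>0"
  proof (rule dominated_convergence(2))
    show "f j integrable_on {0..2 * pi}" for j
      by (rule integrable_spike[OF int N]) (simp add: f_def)
    show "(\<lambda>t. (B * B')\<^sup>2) integrable_on {0..2 * pi}" by blast
    show "norm (f j t) \<le> (B * B')\<^sup>2" for j t
    proof -
      have "cmod (eval_fps g (of_real (r j) * cis t)) \<le> B * B'"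
        unfolding ev[OF rz] norm_mult[of "\<Theta> _"]
        using B[OF rz, of j t] B'[of "of_real (r j) * cis t"] rz[of j t]
        by (intro mult_mono) (auto intro: order_trans[OF norm_ge_zero])
      then show ?thesis by (simp add: f_def power_mono)
    qed
    show "(\<lambda>j. f j t) \<longlonglongrightarrow> f\<^sub>0 t" if t: "t \<in> {0..2 * pi}" for t
    proof (cases "t \<in> N")
      case False
      then obtain l where l: "cmod l = 1" "((\<lambda>r. \<Theta> (complex_of_real r * cis t)) \<longlongrightarrow> l) (at_left 1)"
        using lim t by blast
      have "(\<lambda>j. \<Theta> (complex_of_real (r j) * cis t)) \<longlonglongrightarrow> l"
        using filterlim_compose[OF l(2) rlim] .
      then have "(\<lambda>j. (cmod (\<Theta> (complex_of_real (r j) * cis t) * poly p (complex_of_real (r j) * cis t)))\<^sup>2)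
          \<longlonglongrightarrow> (cmod (l * poly p (complex_of_real 1 * cis t)))\<^sup>2"
        by (intro tendsto_intros rl)
      then show ?thesis using False l by (simp add: f_def f\<^sub>0_def ev[OF rz] norm_mult)
    qed (simp add: f_def f\<^sub>0_def)
  qed
  moreover have "integral {0..2 * pi} (f j) = integral {0..2 * pi} (\<lambda>t. (cmod (eval_fps g (of_real (r j) * cis t)))\<^sup>2)" for j
    by (rule integral_spike[OF N]) (simp add: f_def)
  moreover have "integral {0..2 * pi} f\<^sub>0 = integral {0..2 * pi} (\<lambda>t. (cmod (poly p (cis t)))\<^sup>2)"
    by (rule integral_spike[OF N]) (simp add: f\<^sub>0_def)
  ultimately have "(\<lambda>j. 1 / (2 * pi) * integral {0..2 * pi} (\<lambda>t. (cmod (eval_fps g (of_real (r j) * cis t)))\<^sup>2))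
      \<longlonglongrightarrow> 1 / (2 * pi) * (2 * pi * poly_norm2 p)"
    using integral_unique[OF parseval_poly[of p]] by (intro tendsto_intros) simp
  moreover define S where "S = (\<lambda>j. \<Sum>n. (cmod (fps_nth g n * of_real (r j) ^ n))\<^sup>2)"
  ultimately have S: "S \<longlonglongrightarrow> poly_norm2 p"
    using parseval_power_series[OF radg r] by (simp add: sums_iff)
  have sm: "summable (\<lambda>n. (cmod (fps_nth g n * of_real (r j) ^ n))\<^sup>2)" for j
    using parseval_power_series[OF radg r] by (rule sums_summable)
  have "hardy_norm (fps_cutoff K g) \<le> hardy_norm (fps_of_poly p)" for K
  proof (rule power2_le_imp_le)
    have "(\<lambda>j. \<Sum>n<K. (cmod (fps_nth g n * of_real (r j) ^ n))\<^sup>2) \<longlonglongrightarrow>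
        (\<Sum>n<K. (cmod (fps_nth g n * of_real 1 ^ n))\<^sup>2)"
      by (intro tendsto_intros rl)
    then have "(\<Sum>n<K. (cmod (fps_nth g n * of_real 1 ^ n))\<^sup>2) \<le> poly_norm2 p"
      by (rule LIMSEQ_le[OF _ S]) (auto simp: S_def intro!: sum_le_suminf sm)
    then show "(hardy_norm (fps_cutoff K g))\<^sup>2 \<le> poly_norm2 p"
      by (simp add: hardy_norm_cutoff_sq)
  qed simp
  from hardy2_by_cutoffs[OF this]
  have g: "g \<in> hardy2" and le: "hardy_norm g \<le> hardy_norm (fps_of_poly p)" by auto
  have "poly_norm2 p \<le> (hardy_norm g)\<^sup>2"
  proof (rule LIMSEQ_le_const2[OF S], intro exI allI impI)
    fix j
    show "S j \<le> (hardy_norm g)\<^sup>2"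
      unfolding S_def hardy_norm_sq[OF g]
    proof (rule suminf_le[OF _ sm])
      show "summable (\<lambda>n. (cmod (fps_nth g n))\<^sup>2)" using g by (simp add: hardy2_iff)
      show "(cmod (fps_nth g n * of_real (r j) ^ n))\<^sup>2 \<le> (cmod (fps_nth g n))\<^sup>2" for n
        using r[of j] by (intro power_mono) (auto simp: norm_mult norm_power mult_left_le power_le_one)
    qed
  qed
  then have "hardy_norm (fps_of_poly p) \<le> hardy_norm g"
    by (rule power2_le_imp_le) (use g in simp)
  with le g show "fps_expansion \<Theta> 0 * fps_of_poly p \<in> hardy2 \<and>
      hardy_norm (fps_expansion \<Theta> 0 * fps_of_poly p) = hardy_norm (fps_of_poly p)"
    by (simp add: g_def F_def)
qed

section \<open>Bessel systems and weak separation\<close>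

lemma hardy_sums_finite_support:
  assumes "hardy_sums f S" and "\<And>n. n \<ge> N \<Longrightarrow> f n = 0" and "\<And>n. f n \<in> hardy2"
  shows "S = (\<Sum>n<N. f n)"
proof -
  have S: "S \<in> hardy2" "(\<lambda>M. hardy_norm ((\<Sum>n<M. f n) - S)) \<longlonglongrightarrow> 0"
    using assms(1) by (auto simp: hardy_sums_def)
  have "\<forall>\<^sub>F M in sequentially. hardy_norm ((\<Sum>n<M. f n) - S) = hardy_norm ((\<Sum>n<N. f n) - S)"
  proof (rule eventually_sequentiallyI)
    fix M assume "N \<le> M"
    then have "(\<Sum>n<M. f n) = (\<Sum>n<N. f n)" using assms(2) by (intro sum.mono_neutral_right) auto
    then show "hardy_norm ((\<Sum>n<M. f n) - S) = hardy_norm ((\<Sum>n<N. f n) - S)" by simp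
  qed
  then have "(\<lambda>M. hardy_norm ((\<Sum>n<M. f n) - S)) \<longlonglongrightarrow> hardy_norm ((\<Sum>n<N. f n) - S)"
    by (rule tendsto_eventually)
  then have "hardy_norm ((\<Sum>n<N. f n) - S) = 0" using S(2) LIMSEQ_unique by blast
  then have "(\<Sum>n<N. f n) - S = 0"
    using hardy_norm_eq_0_iff[of "(\<Sum>n<N. f n) - S"] S(1) assms(3) by (simp add: hardy2_diff hardy2_sum)
  then show ?thesis by simp
qed

text \<open>The Bessel inequality for finite sums of vectors of arbitrary norm; \<open>bessel_system\<close> speaks of unit vectors and series.\<close>

locale bessel_coinvariant =
  fixes \<theta> :: "nat \<Rightarrow> complex fps" and C :: real
  assumes isometric: "\<And>n. isometric_multiplier (\<theta> n)"
    and C: "C \<ge> 1"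
    and bessel: "\<And>y N. (\<And>n. n < N \<Longrightarrow> y n \<in> coinvariant (\<theta> n)) \<Longrightarrow>
        (hardy_norm (\<Sum>n<N. y n))\<^sup>2 \<le> C\<^sup>2 * (\<Sum>n<N. (hardy_norm (y n))\<^sup>2)"
begin

text \<open>The dual form of the Bessel inequality: the sum on the left is the inner product of \<open>x\<close> with the sum of its
projections.\<close>

lemma sum_model_projection_le:
  assumes x: "x \<in> hardy2"
  shows "(\<Sum>n<N. (hardy_norm (model_projection (\<theta> n) x))\<^sup>2) \<le> C\<^sup>2 * (hardy_norm x)\<^sup>2"
proof -
  define T where "T = (\<Sum>n<N. (hardy_norm (model_projection (\<theta> n) x))\<^sup>2)"
  define w where "w = (\<Sum>n<N. model_projection (\<theta> n) x)"
  note p = model_projection_props[OF isometric x]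
  have ph: "model_projection (\<theta> n) x \<in> hardy2" for n using p(1) by (rule coinvariantD)
  have w: "w \<in> hardy2" unfolding w_def by (intro hardy2_sum ph)
  have T0: "T \<ge> 0" unfolding T_def by (intro sum_nonneg) auto
  have "complex_of_real T = hardy_inner w x"
    unfolding T_def w_def using ph x by (simp add: hardy_inner_sum_left p(2) del: of_real_power)
  then have "T = cmod (hardy_inner w x)" using T0 by (metis abs_of_nonneg norm_of_real)
  also have "\<dots> \<le> hardy_norm w * hardy_norm x" by (rule hardy_inner_bound[OF w x])
  finally have "T\<^sup>2 \<le> (hardy_norm w * hardy_norm x)\<^sup>2" using T0 by (rule power_mono)
  also have "\<dots> = (hardy_norm w)\<^sup>2 * (hardy_norm x)\<^sup>2" by (rule power_mult_distrib)
  also have "\<dots> \<le> (C\<^sup>2 * T) * (hardy_norm x)\<^sup>2"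
    unfolding T_def w_def by (intro mult_right_mono bessel p(1)) auto
  finally have "T * T \<le> T * (C\<^sup>2 * (hardy_norm x)\<^sup>2)" by (simp add: power2_eq_square mult_ac)
  then have "T \<le> C\<^sup>2 * (hardy_norm x)\<^sup>2"
    using T0 by (cases "T = 0") (auto dest: mult_left_le_imp_le)
  then show ?thesis by (simp add: T_def)
qed

text \<open>The squared norm of the projection of a normalized Szego kernel is \<open>1 - \<bar>\<theta>\<^sub>n z\<bar>\<^sup>2\<close>.\<close>

lemma sum_defect_le:
  assumes z: "cmod z < 1"
  shows "(\<Sum>n<N. 1 - (cmod (eval_fps (\<theta> n) z))\<^sup>2) \<le> C\<^sup>2"
proof -
  note k = szego_in_hardy2[OF z]
  have "(hardy_norm (model_projection (\<theta> n) (szego z)))\<^sup>2 = (1 - (cmod (eval_fps (\<theta> n) z))\<^sup>2) * (hardy_norm (szego z))\<^sup>2" for n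
    unfolding model_projection_props(3)[OF isometric k] adj_szego[OF isometric z] hardy_norm_const_mult[OF k]
    by (simp add: algebra_simps power_mult_distrib)
  then have "(\<Sum>n<N. 1 - (cmod (eval_fps (\<theta> n) z))\<^sup>2) * (hardy_norm (szego z))\<^sup>2 \<le> C\<^sup>2 * (hardy_norm (szego z))\<^sup>2"
    using sum_model_projection_le[OF k, of N] by (simp add: sum_distrib_right)
  then show ?thesis
    by (rule mult_right_le_imp_le) (use hardy_norm_szego_pos[OF z] in simp)
qed

text \<open>If \<open>\<eta>\<^sup>2 \<le> p \<le> 1\<close> then \<open>1 / p = 1 + (1 - p) / p \<le> exp ((1 - p) / \<eta>\<^sup>2)\<close>; the exponents are summed by the bound
for the defects.\<close>

lemma product_lower_bound:
  assumes z: "cmod z < 1" and \<eta>: "0 < \<eta>" and J: "J \<subseteq> {..<N}"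
    and low: "\<And>j. j \<in> J \<Longrightarrow> \<eta> \<le> cmod (eval_fps (\<theta> j) z)"
  shows "exp (- C\<^sup>2 / \<eta>\<^sup>2) \<le> (cmod (eval_fps (\<Prod>j\<in>J. \<theta> j) z))\<^sup>2"
proof -
  define p where "p = (\<lambda>j. (cmod (eval_fps (\<theta> j) z))\<^sup>2)"
  have fin: "finite J" using J finite_subset by blast
  have p1: "p j \<le> 1" for j
    using cmod_eval_multiplier_le[OF isometric z] by (simp add: p_def power_le_one)
  have ge: "exp (- (1 - p j) / \<eta>\<^sup>2) \<le> p j" if j: "j \<in> J" for j
  proof -
    have pe: "\<eta>\<^sup>2 \<le> p j" unfolding p_def by (intro power_mono low j) (use \<eta> in simp)
    have pp: "p j > 0" using pe \<eta> by (smt (verit) zero_less_power)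
    have "1 / p j = 1 + (1 - p j) / p j" using pp by (simp add: field_simps)
    also have "\<dots> \<le> 1 + (1 - p j) / \<eta>\<^sup>2"
      using pe p1[of j] \<eta> pp by (intro add_left_mono divide_left_mono) auto
    also have "\<dots> \<le> exp ((1 - p j) / \<eta>\<^sup>2)" by (rule exp_ge_add_one_self)
    finally have "inverse (exp ((1 - p j) / \<eta>\<^sup>2)) \<le> inverse (1 / p j)"
      by (rule le_imp_inverse_le) (use pp in simp)
    then show ?thesis unfolding minus_divide_left[symmetric] exp_minus by simp
  qed
  have "(\<Sum>j\<in>J. 1 - p j) \<le> (\<Sum>j<N. 1 - p j)"
    by (rule sum_mono2) (use J p1 in auto)
  also have "\<dots> \<le> C\<^sup>2" unfolding p_def by (rule sum_defect_le[OF z])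
  finally have "- C\<^sup>2 / \<eta>\<^sup>2 \<le> (\<Sum>j\<in>J. - (1 - p j) / \<eta>\<^sup>2)"
    by (simp only: sum_divide_distrib[symmetric] sum_negf) (rule divide_right_mono, auto)
  then have "exp (- C\<^sup>2 / \<eta>\<^sup>2) \<le> exp (\<Sum>j\<in>J. - (1 - p j) / \<eta>\<^sup>2)" by simp
  also have "\<dots> = (\<Prod>j\<in>J. exp (- (1 - p j) / \<eta>\<^sup>2))" by (rule exp_sum[OF fin])
  also have "\<dots> \<le> (\<Prod>j\<in>J. p j)" by (intro prod_mono conjI exp_ge_zero ge)
  also have "\<dots> = (cmod (eval_fps (\<Prod>j\<in>J. \<theta> j) z))\<^sup>2"
    by (simp add: p_def eval_multiplier_prod[OF isometric z] prod_norm[symmetric] prod_power_distrib)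
  finally show ?thesis .
qed

text \<open>The constant does not depend on \<open>N\<close>.  The products \<open>B n\<close> in the proof run over all indices below
\<open>N\<close> other than \<open>n\<close>, so the adjoint of \<open>B n\<close> annihilates all summands but the \<open>n\<close>-th.  The number \<open>\<epsilon>\<close> is such that
\<open>\<epsilon>\<^sup>2\<close> is below both \<open>\<eta>\<^sup>2\<close> and the lower bound for products of values that are at least \<open>\<eta>\<close>.\<close>

lemma riesz_lower_bound:
  assumes \<eta>: "0 < \<eta>" "\<eta> \<le> 1"
    and sep: "\<And>n j z. n \<noteq> j \<Longrightarrow> cmod z < 1 \<Longrightarrow> \<eta> \<le> cmod (eval_fps (\<theta> n) z) \<or> \<eta> \<le> cmod (eval_fps (\<theta> j) z)"
    and g: "\<And>n. g n \<in> coinvariant (\<theta> n)"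
  defines "\<epsilon> \<equiv> min \<eta> (exp (- C\<^sup>2 / \<eta>\<^sup>2 / 2))"
  shows "(\<Sum>n<N. (hardy_norm (g n))\<^sup>2) \<le> 300000 / (\<epsilon> / 2) ^ 8 * C\<^sup>2 * (hardy_norm (\<Sum>n<N. g n))\<^sup>2"
proof -
  define B where "B = (\<lambda>n. \<Prod>j\<in>{..<N} - {n}. \<theta> j)"
  define S where "S = (\<Sum>n<N. g n)"
  define y where "y = (\<lambda>n. adj (B n) (g n))"
  define w where "w = (\<Sum>n<N. B n * y n)"
  define T where "T = (\<Sum>n<N. (hardy_norm (y n))\<^sup>2)"
  define P where "P = (\<Prod>j<N. \<theta> j)"
  define K where "K = 300000 / (\<epsilon> / 2) ^ 8"
  have \<epsilon>: "0 < \<epsilon>" "\<epsilon> \<le> 1" using \<eta> by (auto simp: \<epsilon>_def)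
  have K: "K \<ge> 0" using \<epsilon> by (simp add: K_def)
  have B: "isometric_multiplier (B n)" for n unfolding B_def by (intro multiplier_prod isometric)
  have P: "isometric_multiplier P" unfolding P_def by (intro multiplier_prod isometric)
  have PB: "P = B n * \<theta> n" if "n < N" for n
    using that unfolding P_def B_def by (subst prod.remove[of _ n]) (auto simp: mult.commute)
  have gh: "g n \<in> hardy2" for n using g by (rule coinvariantD)
  have yc: "y n \<in> coinvariant (\<theta> n)" for n unfolding y_def by (intro adj_coinvariant isometric B g)
  have yh: "y n \<in> hardy2" for n using yc by (rule coinvariantD)
  have Bh: "B n * y n \<in> hardy2" for n by (rule multiplierD(1)[OF B yh])
  have Sh: "S \<in> hardy2" unfolding S_def by (intro hardy2_sum gh)
  have wh: "w \<in> hardy2" unfolding w_def by (intro hardy2_sum Bh)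
  \<comment> \<open>The corona estimate is applied to \<open>g n\<close>, on which the adjoint of \<open>\<theta> n\<close> vanishes.\<close>
  have cor: "(hardy_norm (g n))\<^sup>2 \<le> K * (hardy_norm (y n))\<^sup>2" for n
  proof -
    have "(hardy_norm (g n))\<^sup>2 \<le> K * ((hardy_norm (adj (\<theta> n) (g n)))\<^sup>2 + (hardy_norm (adj (B n) (g n)))\<^sup>2)"
      unfolding K_def
    proof (rule corona_hardy[OF isometric B \<epsilon> _ gh])
      fix z assume z: "cmod z < 1"
      show "\<epsilon>\<^sup>2 \<le> (cmod (eval_fps (\<theta> n) z))\<^sup>2 + (cmod (eval_fps (B n) z))\<^sup>2"
      proof (cases "\<eta> \<le> cmod (eval_fps (\<theta> n) z)")
        case True
        have "\<epsilon>\<^sup>2 \<le> (cmod (eval_fps (\<theta> n) z))\<^sup>2"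
          using True \<epsilon> by (intro power_mono) (auto simp: \<epsilon>_def)
        then show ?thesis by (simp add: add_increasing2)
      next
        case False
        have "\<epsilon>\<^sup>2 \<le> (exp (- C\<^sup>2 / \<eta>\<^sup>2 / 2))\<^sup>2" using \<epsilon> by (intro power_mono) (auto simp: \<epsilon>_def)
        also have "\<dots> = exp (- C\<^sup>2 / \<eta>\<^sup>2)" by (simp add: exp_double[symmetric])
        also have "\<dots> \<le> (cmod (eval_fps (B n) z))\<^sup>2"
          unfolding B_def
          by (rule product_lower_bound[OF z \<eta>(1), where N = N]) (use sep[OF _ z] False in auto)
        finally show ?thesis by (simp add: add_increasing)
      qed
    qed
    then show ?thesis using coinvariantD(2)[OF g] by (simp add: y_def)
  qed
  have yS: "adj (B n) S = y n" if n: "n < N" for n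
  proof -
    have z: "adj (B n) (g k) = 0" if k: "k < N" "k \<noteq> n" for k
    proof -
      define R where "R = (\<Prod>j\<in>{..<N} - {n} - {k}. \<theta> j)"
      have R: "isometric_multiplier R" unfolding R_def by (intro multiplier_prod isometric)
      have "B n = \<theta> k * R" unfolding B_def R_def using k by (intro prod.remove) auto
      then show ?thesis using adj_mult[OF isometric R gh, of k k] coinvariantD(2)[OF g] by simp
    qed
    have "adj (B n) S = (\<Sum>k<N. adj (B n) (g k))" unfolding S_def by (rule adj_sum[OF B gh])
    also have "\<dots> = (\<Sum>k<N. if k = n then y n else 0)"
      by (intro sum.cong refl) (auto simp: z y_def)
    also have "\<dots> = y n" using n by simp
    finally show ?thesis .
  qed
  have T0: "T \<ge> 0" unfolding T_def by (intro sum_nonneg) auto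
  \<comment> \<open>The adjoint of \<open>B n\<close> is moved to the other side, where the vectors \<open>B n * y n\<close> add up to \<open>w\<close>.\<close>
  have "complex_of_real T = hardy_inner S w"
  proof -
    have "hardy_inner S w = (\<Sum>n<N. hardy_inner (y n) (y n))"
      unfolding w_def using Bh Sh by (simp add: hardy_inner_sum_right adj_inner B yh yS)
    then show ?thesis by (simp add: T_def hardy_inner_self yh del: of_real_power)
  qed
  then have "T = cmod (hardy_inner S w)" using T0 by (metis abs_of_nonneg norm_of_real)
  also have "\<dots> \<le> hardy_norm S * hardy_norm w" by (rule hardy_inner_bound[OF Sh wh])
  finally have "T\<^sup>2 \<le> (hardy_norm S * hardy_norm w)\<^sup>2" using T0 by (rule power_mono)
  also have "\<dots> = (hardy_norm S)\<^sup>2 * (hardy_norm w)\<^sup>2" by (rule power_mult_distrib)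
  also have "(hardy_norm w)\<^sup>2 \<le> C\<^sup>2 * T"
  proof -
    \<comment> \<open>Both \<open>w\<close> and its conjugate for \<open>P\<close> have the same norm because \<open>w\<close> is in the kernel of the adjoint of \<open>P\<close>.\<close>
    have "adj P w = (\<Sum>n<N. adj P (B n * y n))" unfolding w_def by (rule adj_sum[OF P Bh])
    also have "\<dots> = 0"
      by (intro sum.neutral ballI)
        (simp add: PB adj_mult[OF B isometric Bh] adj_mult_self[OF B yh] coinvariantD(2)[OF yc])
    finally have a: "adj P w = 0" .
    have "conj_op P w = (\<Sum>n<N. conj_op P (B n * y n))"
      unfolding w_def by (rule conj_op_sum[OF multiplier_in_hardy2[OF P] Bh])
    also have "\<dots> = (\<Sum>n<N. conj_op (\<theta> n) (y n))"
      by (intro sum.cong refl) (simp add: PB conj_op_mult[OF B isometric yh])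
    finally have c: "conj_op P w = (\<Sum>n<N. conj_op (\<theta> n) (y n))" .
    have "(hardy_norm w)\<^sup>2 = (hardy_norm (\<Sum>n<N. conj_op (\<theta> n) (y n)))\<^sup>2"
      using conj_op_pythagoras[OF P wh] by (simp add: a c)
    also have "\<dots> \<le> C\<^sup>2 * (\<Sum>n<N. (hardy_norm (conj_op (\<theta> n) (y n)))\<^sup>2)"
      by (intro bessel conj_op_coinvariant isometric yh)
    also have "\<dots> \<le> C\<^sup>2 * T"
      unfolding T_def
      by (intro mult_left_mono sum_mono power_mono conj_op_contraction hardy_norm_nonneg isometric yh) auto
    finally show ?thesis .
  qed
  then have "(hardy_norm S)\<^sup>2 * (hardy_norm w)\<^sup>2 \<le> (hardy_norm S)\<^sup>2 * (C\<^sup>2 * T)"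
    by (intro mult_left_mono) auto
  finally have "T * T \<le> T * (C\<^sup>2 * (hardy_norm S)\<^sup>2)" by (simp add: power2_eq_square mult_ac)
  then have T: "T \<le> C\<^sup>2 * (hardy_norm S)\<^sup>2"
    using T0 by (cases "T = 0") (auto dest: mult_left_le_imp_le)
  have "(\<Sum>n<N. (hardy_norm (g n))\<^sup>2) \<le> (\<Sum>n<N. K * (hardy_norm (y n))\<^sup>2)"
    by (intro sum_mono cor)
  also have "\<dots> = K * T" by (simp add: T_def sum_distrib_left)
  also have "\<dots> \<le> K * (C\<^sup>2 * (hardy_norm S)\<^sup>2)" by (rule mult_left_mono[OF T K])
  finally show ?thesis by (simp add: K_def S_def mult.assoc)
qed

end

text \<open>The definition of a Bessel system speaks of unit vectors in every space; where a given vector vanishes, or its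
index is too large, the selection \<open>u\<close> supplies one with coefficient \<open>0\<close>.\<close>

lemma bessel_system_finite_sums:
  assumes iso: "\<And>n. isometric_multiplier (\<theta> n)"
    and K: "\<And>n. K n = coinvariant (\<theta> n)"
    and u: "unit_selection K u"
    and bessel: "\<And>h a. unit_selection K h \<Longrightarrow> square_summable a \<Longrightarrow>
         (\<exists>S. hardy_sums (\<lambda>n. fps_const (a n) * h n) S \<and>
              (hardy_norm S)\<^sup>2 \<le> C\<^sup>2 * (\<Sum>n. (cmod (a n))\<^sup>2))"
    and y: "\<And>n. n < N \<Longrightarrow> y n \<in> coinvariant (\<theta> n)"
  shows "(hardy_norm (\<Sum>n<N. y n))\<^sup>2 \<le> C\<^sup>2 * (\<Sum>n<N. (hardy_norm (y n))\<^sup>2)"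
proof -
  define h where "h = (\<lambda>n. if n < N \<and> y n \<noteq> 0 then fps_const (of_real (1 / hardy_norm (y n))) * y n else u n)"
  define a where "a = (\<lambda>n. if n < N then complex_of_real (hardy_norm (y n)) else 0)"
  have yh: "y n \<in> hardy2" if "n < N" for n using y[OF that] by (rule coinvariantD)
  have uh: "u n \<in> hardy2" for n using u by (auto simp: unit_selection_def K coinvariant_def)
  have "unit_selection K h"
    unfolding unit_selection_def
  proof
    fix n
    show "h n \<in> K n \<and> hardy_norm (h n) = 1"
    proof (cases "n < N \<and> y n \<noteq> 0")
      case True
      then have n: "n < N" and "hardy_norm (y n) \<noteq> 0" using hardy_norm_eq_0_iff[OF yh] by auto
      with True show ?thesis
        using y[OF n] yh[OF n] coinvariant_const_mult[OF iso y[OF n]]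
        by (simp add: h_def K hardy_norm_const_mult norm_divide del: of_real_divide)
    next
      case False
      then show ?thesis using u by (auto simp: h_def unit_selection_def)
    qed
  qed
  moreover have "square_summable a"
    unfolding square_summable_def by (rule summable_finite[of "{..<N}"]) (auto simp: a_def)
  ultimately obtain S where S: "hardy_sums (\<lambda>n. fps_const (a n) * h n) S"
    and le: "(hardy_norm S)\<^sup>2 \<le> C\<^sup>2 * (\<Sum>n. (cmod (a n))\<^sup>2)"
    using bessel by blast
  have ah: "fps_const (a n) * h n = (if n < N then y n else 0)" for n
  proof (cases "n < N \<and> y n \<noteq> 0")
    case True
    then have "hardy_norm (y n) \<noteq> 0" using hardy_norm_eq_0_iff[OF yh] by auto
    then have "fps_const (a n) * h n = fps_const (a n * of_real (1 / hardy_norm (y n))) * y n"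
      using True by (simp add: h_def mult.assoc[symmetric] del: of_real_divide)
    also have "a n * of_real (1 / hardy_norm (y n)) = 1"
      using True \<open>hardy_norm (y n) \<noteq> 0\<close> by (simp add: a_def)
    finally show ?thesis using True by simp
  next
    case False
    then show ?thesis by (auto simp: a_def)
  qed
  have "S = (\<Sum>n<N. fps_const (a n) * h n)"
    by (rule hardy_sums_finite_support[OF S]) (auto simp: ah yh)
  then have "S = (\<Sum>n<N. y n)" by (simp add: ah)
  moreover have "(\<Sum>n. (cmod (a n))\<^sup>2) = (\<Sum>n<N. (hardy_norm (y n))\<^sup>2)"
    by (subst suminf_finite[of "{..<N}"]) (auto simp: a_def)
  ultimately show ?thesis using le by simp
qed

text \<open>If both values at \<open>z\<close> are small, the Szego kernel at \<open>z\<close> is close to both model spaces, and its two projections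
are nearly parallel.  With \<open>m\<close> the squared norm of the kernel, their inner product is at least
\<open>(1 - 3 \<eta>\<^sup>2) m\<close>, so the sine of their angle is at most \<open>sqrt 6 * \<eta>\<close>, which is less than \<open>3 \<eta>\<close>.\<close>

lemma separation_pointwise:
  assumes \<theta>: "isometric_multiplier \<theta>" and \<beta>: "isometric_multiplier \<beta>"
    and \<delta>: "0 < \<delta>" and \<eta>: "0 < \<eta>" "\<eta> \<le> 1 / 2" "3 * \<eta> \<le> \<delta>"
    and sep: "\<And>F G. F \<in> coinvariant \<theta> - {0} \<Longrightarrow> G \<in> coinvariant \<beta> - {0} \<Longrightarrow> \<delta> \<le> vector_sin F G"
    and z: "cmod z < 1"
  shows "\<eta> \<le> cmod (eval_fps \<theta> z) \<or> \<eta> \<le> cmod (eval_fps \<beta> z)"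
proof (rule ccontr)
  define a b where "a = cmod (eval_fps \<theta> z)" and "b = cmod (eval_fps \<beta> z)"
  assume "\<not> (\<eta> \<le> cmod (eval_fps \<theta> z) \<or> \<eta> \<le> cmod (eval_fps \<beta> z))"
  then have a: "0 \<le> a" "a < \<eta>" and b: "0 \<le> b" "b < \<eta>" by (auto simp: a_def b_def)
  define k where "k = szego z"
  define m where "m = (hardy_norm k)\<^sup>2"
  have kh: "k \<in> hardy2" and kpos: "hardy_norm k > 0"
    unfolding k_def by (rule szego_in_hardy2[OF z]) (rule hardy_norm_szego_pos[OF z])
  have m: "m > 0" using kpos by (simp add: m_def)
  have ad: "hardy_norm (adj \<theta> k) = a * hardy_norm k" "hardy_norm (adj \<beta> k) = b * hardy_norm k"
    using kh by (simp_all add: k_def adj_szego \<theta> \<beta> z hardy_norm_const_mult a_def b_def)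
  note adh = adj_contraction(1)[OF \<theta> kh] adj_contraction(1)[OF \<beta> kh]
  define A A' where "A = \<theta> * adj \<theta> k" and "A' = \<beta> * adj \<beta> k"
  have Ah: "A \<in> hardy2" "A' \<in> hardy2" and An: "hardy_norm A = a * hardy_norm k" "hardy_norm A' = b * hardy_norm k"
    using multiplierD[OF \<theta> adh(1)] multiplierD[OF \<beta> adh(2)] by (simp_all add: A_def A'_def ad)
  define F G where "F = model_projection \<theta> k" and "G = model_projection \<beta> k"
  have FA: "F = k - A" "G = k - A'" by (simp_all add: F_def G_def model_projection_def A_def A'_def)
  have Fc: "F \<in> coinvariant \<theta>" "G \<in> coinvariant \<beta>" unfolding F_def G_def by (intro model_projection_props \<theta> \<beta> kh)+
  have Fh: "F \<in> hardy2" "G \<in> hardy2" using Fc by (auto simp: coinvariantD)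
  have a2: "a\<^sup>2 \<le> \<eta>\<^sup>2" "b\<^sup>2 \<le> \<eta>\<^sup>2" "a * b \<le> \<eta>\<^sup>2"
    using a b by (auto intro: power_mono simp: power2_eq_square mult_mono)
  have \<eta>2: "\<eta>\<^sup>2 \<le> 1 / 4" using power_mono[OF \<eta>(2), of 2] \<eta>(1) by (simp add: power2_eq_square)
  have FN: "(hardy_norm F)\<^sup>2 = (1 - a\<^sup>2) * m" "(hardy_norm G)\<^sup>2 = (1 - b\<^sup>2) * m"
    using model_projection_props(3)[OF \<theta> kh] model_projection_props(3)[OF \<beta> kh]
    by (simp_all add: F_def G_def ad m_def power_mult_distrib algebra_simps)
  have pos: "(1 - a\<^sup>2) * m > 0" "(1 - b\<^sup>2) * m > 0" using a2 \<eta>2 m by auto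
  have Fpos: "hardy_norm F > 0" "hardy_norm G > 0"
    using FN pos hardy_norm_nonneg[OF Fh(1)] hardy_norm_nonneg[OF Fh(2)] by (metis less_eq_real_def zero_power2 less_irrefl)+
  have FGle: "hardy_norm F * hardy_norm G \<le> m"
  proof -
    have "hardy_norm F \<le> hardy_norm k" "hardy_norm G \<le> hardy_norm k"
      by (rule power2_le_imp_le; use FN m kpos in \<open>simp add: m_def[symmetric] mult_left_le_one_le\<close>)+
    then have "hardy_norm F * hardy_norm G \<le> hardy_norm k * hardy_norm k"
      using Fpos by (intro mult_mono) auto
    then show ?thesis by (simp add: m_def power2_eq_square)
  qed
  have ip: "cmod (hardy_inner F G) \<ge> (1 - 3 * \<eta>\<^sup>2) * m"
  proof -
    have "hardy_inner F G = hardy_inner k k - (hardy_inner A k + hardy_inner k A' - hardy_inner A A')"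
      unfolding FA using kh Ah by (simp add: hardy_inner_diff_left hardy_inner_diff_right hardy2_diff)
    then have "cmod (hardy_inner F G) \<ge> cmod (hardy_inner k k)
        - cmod (hardy_inner A k + hardy_inner k A' - hardy_inner A A')"
      by (metis norm_triangle_ineq2)
    moreover have "cmod (hardy_inner A k + hardy_inner k A' - hardy_inner A A')
        \<le> cmod (hardy_inner A k) + cmod (hardy_inner k A') + cmod (hardy_inner A A')"
      by (meson add_right_mono norm_triangle_ineq norm_triangle_ineq4 order_trans)
    moreover have "cmod (hardy_inner k k) = m" by (simp add: hardy_inner_self[OF kh] m_def norm_power del: of_real_power)
    moreover have "cmod (hardy_inner k A') = b\<^sup>2 * m"
      unfolding A'_def adj_inner[OF \<beta> kh adh(2)] hardy_inner_self[OF adh(2)] ad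
      by (simp add: m_def power_mult_distrib norm_mult norm_power)
    moreover have "cmod (hardy_inner A k) = a\<^sup>2 * m"
    proof -
      have "hardy_inner k A = of_real ((a * hardy_norm k)\<^sup>2)"
        unfolding A_def adj_inner[OF \<theta> kh adh(1)] hardy_inner_self[OF adh(1)] ad ..
      then show ?thesis
        unfolding hardy_inner_commute[OF kh Ah(1)]
        by (simp add: m_def power_mult_distrib norm_mult norm_power)
    qed
    moreover have "cmod (hardy_inner A A') \<le> (a * b) * m"
      using hardy_inner_bound[OF Ah] by (simp add: An m_def power2_eq_square mult_ac)
    moreover have "a\<^sup>2 * m \<le> \<eta>\<^sup>2 * m" "b\<^sup>2 * m \<le> \<eta>\<^sup>2 * m" "(a * b) * m \<le> \<eta>\<^sup>2 * m"
      using a2 m by (auto intro: mult_right_mono)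
    ultimately show ?thesis by (simp add: algebra_simps)
  qed
  define c where "c = cmod (hardy_inner F G) / (hardy_norm F * hardy_norm G)"
  have FGp: "hardy_norm F * hardy_norm G > 0" using Fpos by simp
  have nn: "0 \<le> 1 - 3 * \<eta>\<^sup>2" using \<eta>2 by simp
  have "(1 - 3 * \<eta>\<^sup>2) * (hardy_norm F * hardy_norm G) \<le> (1 - 3 * \<eta>\<^sup>2) * m"
    using FGle nn by (rule mult_left_mono)
  then have "(1 - 3 * \<eta>\<^sup>2) * (hardy_norm F * hardy_norm G) \<le> cmod (hardy_inner F G)" using ip by linarith
  then have c: "1 - 3 * \<eta>\<^sup>2 \<le> c" unfolding c_def using FGp by (simp add: pos_le_divide_eq)
  have "(1 - 3 * \<eta>\<^sup>2)\<^sup>2 \<le> c\<^sup>2" using c nn by (rule power_mono)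
  moreover have "(1 - 3 * \<eta>\<^sup>2)\<^sup>2 = 1 - 6 * \<eta>\<^sup>2 + 9 * (\<eta>\<^sup>2)\<^sup>2" by (simp add: power2_eq_square algebra_simps)
  ultimately have "1 - c\<^sup>2 \<le> 6 * \<eta>\<^sup>2" using zero_le_power2[of "\<eta>\<^sup>2"] by linarith
  also have "\<dots> < 9 * \<eta>\<^sup>2" using \<eta>(1) by simp
  also have "\<dots> = (3 * \<eta>)\<^sup>2" by (simp add: power_mult_distrib)
  also have "\<dots> \<le> \<delta>\<^sup>2" using \<eta> by (intro power_mono) auto
  finally have "sqrt (1 - c\<^sup>2) < sqrt (\<delta>\<^sup>2)" by (simp only: real_sqrt_less_iff)
  then have "vector_sin F G < \<delta>" using \<delta> by (simp add: vector_sin_def c_def)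
  moreover have "F \<noteq> 0" "G \<noteq> 0" using Fpos by auto
  ultimately show False using sep[of F G] Fc by auto
qed

lemma weakly_separatedE:
  assumes "weakly_separated K"
  obtains \<delta> where "0 < \<delta>"
    "\<And>n j F G. n \<noteq> j \<Longrightarrow> F \<in> K n - {0} \<Longrightarrow> G \<in> K j - {0} \<Longrightarrow> \<delta> \<le> vector_sin F G"
proof -
  define I where "I = (INF (n, j) \<in> {(n, j). n \<noteq> j}. subspace_sin (K n) (K j))"
  have "0 < I" using assms by (simp add: weakly_separated_def I_def)
  then obtain d where d: "0 < d" "d < I" using dense by blast
  then obtain \<delta> where \<delta>: "d = ereal \<delta>" by (cases d) auto
  show ?thesis
  proof
    show "0 < \<delta>" using d \<delta> by simp
    fix n j :: nat and F G assume "n \<noteq> j" and FG: "F \<in> K n - {0}" "G \<in> K j - {0}"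
    then have "I \<le> subspace_sin (K n) (K j)" unfolding I_def by (intro INF_lower2[of "(n, j)"]) auto
    also have "\<dots> \<le> ereal (vector_sin F G)"
      unfolding subspace_sin_def using FG by (intro INF_lower2[of "(F, G)"]) auto
    finally show "\<delta> \<le> vector_sin F G" using d \<delta> by (metis ereal_less_eq(3) less_le_trans order.strict_implies_order)
  qed
qed

theorem theorem1p3:
  fixes \<Theta> :: "nat \<Rightarrow> complex \<Rightarrow> complex"
  assumes "\<And>n. inner_function (\<Theta> n)"
    and "weakly_separated (\<lambda>n. model_space (\<Theta> n))"
    and "bessel_system (\<lambda>n. model_space (\<Theta> n))"
  shows "riesz_system (\<lambda>n. model_space (\<Theta> n))"
proof (cases "\<exists>u. unit_selection (\<lambda>n. model_space (\<Theta> n)) u")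
  case False
  \<comment> \<open>If one of the model spaces is trivial, there is no selection of unit vectors at all.\<close>
  then show ?thesis unfolding riesz_system_def by (intro exI[of _ 1]) auto
next
  case True
  then obtain u where u: "unit_selection (\<lambda>n. model_space (\<Theta> n)) u" by blast
  define \<theta> where "\<theta> = (\<lambda>n. fps_expansion (\<Theta> n) 0)"
  have iso: "isometric_multiplier (\<theta> n)" for n
    unfolding \<theta>_def by (rule inner_function_isometric[OF assms(1)])
  have K: "model_space (\<Theta> n) = coinvariant (\<theta> n)" for n
    unfolding \<theta>_def by (rule model_space_eq_coinvariant) (use iso in \<open>simp add: \<theta>_def\<close>)
  obtain C where C: "C \<ge> 1" and bes: "\<And>h a. unit_selection (\<lambda>n. model_space (\<Theta> n)) h \<Longrightarrow> square_summable a \<Longrightarrow>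
      (\<exists>S. hardy_sums (\<lambda>n. fps_const (a n) * h n) S \<and> (hardy_norm S)\<^sup>2 \<le> C\<^sup>2 * (\<Sum>n. (cmod (a n))\<^sup>2))"
    using assms(3) unfolding bessel_system_def by blast
  interpret bessel_coinvariant \<theta> C
    by standard (use iso C bessel_system_finite_sums[OF iso K u bes] in auto)
  obtain \<delta> where \<delta>: "0 < \<delta>" and sep: "\<And>n j F G. n \<noteq> j \<Longrightarrow> F \<in> model_space (\<Theta> n) - {0} \<Longrightarrow>
      G \<in> model_space (\<Theta> j) - {0} \<Longrightarrow> \<delta> \<le> vector_sin F G"
    using weakly_separatedE[OF assms(2)] by blast
  define \<eta> where "\<eta> = min (1 / 2) (\<delta> / 3)"
  have \<eta>: "0 < \<eta>" "\<eta> \<le> 1 / 2" "3 * \<eta> \<le> \<delta>" "\<eta> \<le> 1" using \<delta> by (auto simp: \<eta>_def)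
  have pw: "\<eta> \<le> cmod (eval_fps (\<theta> n) z) \<or> \<eta> \<le> cmod (eval_fps (\<theta> j) z)" if "n \<noteq> j" "cmod z < 1" for n j z
    by (rule separation_pointwise[OF iso iso \<delta> \<eta>(1-3) _ that(2)]) (use sep[OF that(1)] K in auto)
  define L where "L = 300000 / (min \<eta> (exp (- C\<^sup>2 / \<eta>\<^sup>2 / 2)) / 2) ^ 8 * C\<^sup>2"
  have L: "L \<ge> 0" using \<eta> by (simp add: L_def)
  define C' where "C' = C + L"
  have C': "C' \<ge> 1" "C \<le> C'" "L \<le> C'\<^sup>2"
  proof -
    show 1: "C' \<ge> 1" "C \<le> C'" using C L by (auto simp: C'_def)
    have "L \<le> C'" using C by (simp add: C'_def)
    also have "\<dots> \<le> C'\<^sup>2" using 1 by (simp add: power2_eq_square)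
    finally show "L \<le> C'\<^sup>2" .
  qed
  show ?thesis
    unfolding riesz_system_def
  proof (intro exI[of _ C'] conjI C' allI impI)
    fix h a
    assume h: "unit_selection (\<lambda>n. model_space (\<Theta> n)) h" and a: "square_summable a"
    obtain S where S: "hardy_sums (\<lambda>n. fps_const (a n) * h n) S" "(hardy_norm S)\<^sup>2 \<le> C\<^sup>2 * (\<Sum>n. (cmod (a n))\<^sup>2)"
      using bes[OF h a] by blast
    have sa: "summable (\<lambda>n. (cmod (a n))\<^sup>2)" using a by (simp add: square_summable_def)
    have hc: "h n \<in> coinvariant (\<theta> n)" "hardy_norm (h n) = 1" for n
      using h by (auto simp: unit_selection_def K)
    have gc: "fps_const (a n) * h n \<in> coinvariant (\<theta> n)" for n by (intro coinvariant_const_mult iso hc)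
    have gh: "fps_const (a n) * h n \<in> hardy2" for n using gc by (rule coinvariantD)
    have gn: "(hardy_norm (fps_const (a n) * h n))\<^sup>2 = (cmod (a n))\<^sup>2" for n
      using hc coinvariantD(1)[OF hc(1)] by (simp add: hardy_norm_const_mult)
    let ?P = "\<lambda>N. \<Sum>n<N. fps_const (a n) * h n"
    have low: "(\<Sum>n<N. (cmod (a n))\<^sup>2) \<le> L * (hardy_norm (?P N))\<^sup>2" for N
    proof -
      have "(\<Sum>n<N. (hardy_norm (fps_const (a n) * h n))\<^sup>2) \<le> L * (hardy_norm (?P N))\<^sup>2"
        unfolding L_def by (rule riesz_lower_bound[OF \<eta>(1,4) pw gc])
      then show ?thesis by (simp only: gn)
    qed
    have "(\<lambda>N. hardy_norm (?P N)) \<longlonglongrightarrow> hardy_norm S"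
      by (rule hardy_norm_tendsto) (use S(1) gh in \<open>auto simp: hardy_sums_def\<close>)
    then have "(\<lambda>N. L * (hardy_norm (?P N))\<^sup>2) \<longlonglongrightarrow> L * (hardy_norm S)\<^sup>2" by (intro tendsto_intros)
    from LIMSEQ_le[OF summable_LIMSEQ[OF sa] this] low
    have "(\<Sum>n. (cmod (a n))\<^sup>2) \<le> L * (hardy_norm S)\<^sup>2" by blast
    also have "\<dots> \<le> C'\<^sup>2 * (hardy_norm S)\<^sup>2" by (intro mult_right_mono C') auto
    finally have lower: "1 / C'\<^sup>2 * (\<Sum>n. (cmod (a n))\<^sup>2) \<le> (hardy_norm S)\<^sup>2"
      using C' by (simp add: pos_divide_le_eq mult.commute)
    have "C\<^sup>2 * (\<Sum>n. (cmod (a n))\<^sup>2) \<le> C'\<^sup>2 * (\<Sum>n. (cmod (a n))\<^sup>2)"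
      using C C' by (intro mult_right_mono power_mono suminf_nonneg sa) auto
    with S(2) have "(hardy_norm S)\<^sup>2 \<le> C'\<^sup>2 * (\<Sum>n. (cmod (a n))\<^sup>2)" by linarith
    with S(1) lower show "\<exists>S. hardy_sums (\<lambda>n. fps_const (a n) * h n) S \<and>
        1 / C'\<^sup>2 * (\<Sum>n. (cmod (a n))\<^sup>2) \<le> (hardy_norm S)\<^sup>2 \<and> (hardy_norm S)\<^sup>2 \<le> C'\<^sup>2 * (\<Sum>n. (cmod (a n))\<^sup>2)"
      by blast
  qed
qed

end
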